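(* Let $\underline{N}=(N_0, N_1, N_2, N_3)$ be a commuting quadruple of operators on a complex Hilbert space. Then the following are equivalent: (1) $\underline{N}$ is an $\mathbb{H}$-unitary; (2) $N_0^*$ is subnormal, $(N_1, N_2, N_3)$ is an $\mathbb{E}$-unitary and $N_0^*N_0=I-N_1^*N_1$; (3) $(N_1, N_2, N_3)$ is an $\mathbb{E}$-unitary, $N_0^*N_0=I-N_1^*N_1$ and $N_0N_0^*=I-N_1N_1^*$; (4) $(N_0, N_1)$ is a $\mathbb{B}_2$-unitary and $(N_1, N_2, N_3)$ is an $\mathbb{E}$-unitary; (5) there is a $2\times 2$ unitary block operator matrix $A=[A_{ij}]_{i,j=1}^2$, where the $A_{ij}$ are commuting normal operators, such that $\underline{N}=(A_{21}, A_{11}, A_{22}, A_{11}A_{22}-A_{12}A_{21})$.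
   Context: All operators are bounded linear maps on complex Hilbert spaces; $\mathbb{D}$ is the open unit disc in $\mathbb{C}$; $\mathbb{B}_2$ is the open Euclidean unit ball of $\mathbb{C}^2$. The tetrablock is $\mathbb{E}=\{(x_1,x_2,x_3)\in\mathbb{C}^3 : 1-x_1z_1-x_2z_2+x_3z_1z_2\neq 0 \text{ whenever } |z_1|\le 1, |z_2|\le 1\}$. The hexablock is $\mathbb{H}=\{(a,x_1,x_2,x_3)\in\mathbb{C}\times\mathbb{E} : \sup_{z_1,z_2\in\mathbb{D}}\left|\frac{a\sqrt{(1-|z_1|^2)(1-|z_2|^2)}}{1-x_1z_1-x_2z_2+x_3z_1z_2}\right|<1\}$. For a bounded domain $\Omega\subset\mathbb{C}^n$, the distinguished boundary $b\Omega$ is the smallest closed subset of $\overline{\Omega}$ on which every function continuous on $\overline{\Omega}$ and analytic in $\Omega$ attains its maximum modulus. For $\Omega\in\{\mathbb{H},\mathbb{E},\mathbb{B}_2\}$, an $\Omega$-unitary is a commuting tuple of normal operators whose Taylor joint spectrum (equivalently, the support of the joint spectral measure) is contained in $b\Omega$. An operator is subnormal if it is the restriction of a normal operator to a closed invariant subspace. *)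

theory Defs
  imports "HOL-Analysis.Analysis"
begin

section \<open>Complex Hilbert spaces\<close>

text \<open>The inner product is linear in its first argument. The last axiom gives positivity and
  definiteness, as the norm already has these properties.\<close>

class complex_inner_space = real_normed_vector +
  fixes scaleC :: "complex \<Rightarrow> 'a \<Rightarrow> 'a" (infixr \<open>*\<^sub>C\<close> 75)
    and cinner :: "'a \<Rightarrow> 'a \<Rightarrow> complex"
  assumes scaleC_add_right: "c *\<^sub>C (x + y) = c *\<^sub>C x + c *\<^sub>C y"
    and scaleC_add_left: "(c + d) *\<^sub>C x = c *\<^sub>C x + d *\<^sub>C x"
    and scaleC_scaleC: "c *\<^sub>C d *\<^sub>C x = (c * d) *\<^sub>C x"
    and scaleC_of_real: "complex_of_real r *\<^sub>C x = r *\<^sub>R x"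
    and cinner_commute: "cinner x y = cnj (cinner y x)"
    and cinner_add_left: "cinner (x + y) z = cinner x z + cinner y z"
    and cinner_scaleC_left: "cinner (c *\<^sub>C x) y = c * cinner x y"
    and cinner_self: "cinner x x = complex_of_real ((norm x)\<^sup>2)"

class chilbert_space = complex_inner_space + banach

instantiation complex :: chilbert_space
begin

definition scaleC_complex :: "complex \<Rightarrow> complex \<Rightarrow> complex" where
  "scaleC_complex c x = c * x"

definition cinner_complex :: "complex \<Rightarrow> complex \<Rightarrow> complex" where
  "cinner_complex x y = x * cnj y"

instance
  by standard
    (simp_all add: scaleC_complex_def cinner_complex_def algebra_simps scaleR_conv_of_real
      complex_norm_square flip: of_real_power)

end

instantiation prod :: (complex_inner_space, complex_inner_space) complex_inner_space
begin

definition scaleC_prod :: "complex \<Rightarrow> 'a \<times> 'b \<Rightarrow> 'a \<times> 'b" where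
  "scaleC_prod c p = (c *\<^sub>C fst p, c *\<^sub>C snd p)"

definition cinner_prod :: "'a \<times> 'b \<Rightarrow> 'a \<times> 'b \<Rightarrow> complex" where
  "cinner_prod p q = cinner (fst p) (fst q) + cinner (snd p) (snd q)"

instance
proof
  fix x y z :: "'a \<times> 'b" and c d :: complex and r :: real
  show "c *\<^sub>C (x + y) = c *\<^sub>C x + c *\<^sub>C y" "(c + d) *\<^sub>C x = c *\<^sub>C x + d *\<^sub>C x"
    "c *\<^sub>C d *\<^sub>C x = (c * d) *\<^sub>C x" "complex_of_real r *\<^sub>C x = r *\<^sub>R x"
    by (simp_all add: scaleC_prod_def prod_eq_iff scaleC_add_right scaleC_add_left
        scaleC_scaleC scaleC_of_real)
  show "cinner x y = cnj (cinner y x)"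
    by (metis cinner_commute cinner_prod_def complex_cnj_add)
  show "cinner (x + y) z = cinner x z + cinner y z" "cinner (c *\<^sub>C x) y = c * cinner x y"
    by (simp_all add: cinner_prod_def scaleC_prod_def cinner_add_left cinner_scaleC_left
        algebra_simps)
  show "cinner x x = complex_of_real ((norm x)\<^sup>2)"
    by (simp add: cinner_prod_def norm_prod_def cinner_self)
qed

end

instance prod :: (chilbert_space, chilbert_space) chilbert_space ..


section \<open>The Hilbert space of square-summable sequences in a Hilbert space\<close>

typedef (overloaded) 'a l2_seq =
  "{f :: nat \<Rightarrow> 'a::real_normed_vector. summable (\<lambda>n. (norm (f n))\<^sup>2)}"
  morphisms l2_nth Abs_l2_seq
  by (rule exI[of _ "\<lambda>_. 0"]) simp

setup_lifting type_definition_l2_seq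

lemma l2_partial_le:
  fixes f :: "nat \<Rightarrow> 'a::real_normed_vector"
  assumes "summable (\<lambda>n. (norm (f n))\<^sup>2)"
  shows "L2_set (\<lambda>k. norm (f k)) {..<N} \<le> sqrt (\<Sum>n. (norm (f n))\<^sup>2)"
  unfolding L2_set_def using assms by (intro real_sqrt_le_mono sum_le_suminf) auto

lemma l2_boundI:
  fixes f :: "nat \<Rightarrow> 'a::real_normed_vector"
  assumes "\<And>N. L2_set (\<lambda>k. norm (f k)) {..<N} \<le> c"
  shows "summable (\<lambda>n. (norm (f n))\<^sup>2)" "sqrt (\<Sum>n. (norm (f n))\<^sup>2) \<le> c"
proof -
  have c: "0 \<le> c" using assms[of 0] by simp
  have le: "(\<Sum>k<N. (norm (f k))\<^sup>2) \<le> c\<^sup>2" for N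
    using assms[of N] c unfolding L2_set_def by (simp add: real_sqrt_le_iff' sqrt_le_D)
  show s: "summable (\<lambda>n. (norm (f n))\<^sup>2)"
    by (rule summableI_nonneg_bounded[OF _ le]) auto
  have "(\<Sum>n. (norm (f n))\<^sup>2) \<le> c\<^sup>2"
    by (rule suminf_le_const[OF s le])
  then show "sqrt (\<Sum>n. (norm (f n))\<^sup>2) \<le> c"
    using c by (simp add: real_le_lsqrt suminf_nonneg s)
qed

lemma l2_add_bound:
  fixes f g :: "nat \<Rightarrow> 'a::real_normed_vector"
  assumes "summable (\<lambda>n. (norm (f n))\<^sup>2)" "summable (\<lambda>n. (norm (g n))\<^sup>2)"
  shows "L2_set (\<lambda>k. norm (f k + g k)) {..<N}
    \<le> sqrt (\<Sum>n. (norm (f n))\<^sup>2) + sqrt (\<Sum>n. (norm (g n))\<^sup>2)"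
proof -
  have "L2_set (\<lambda>k. norm (f k + g k)) {..<N} \<le> L2_set (\<lambda>k. norm (f k) + norm (g k)) {..<N}"
    by (intro L2_set_mono) (auto intro: norm_triangle_ineq)
  also have "\<dots> \<le> L2_set (\<lambda>k. norm (f k)) {..<N} + L2_set (\<lambda>k. norm (g k)) {..<N}"
    by (rule L2_set_triangle_ineq)
  also have "\<dots> \<le> sqrt (\<Sum>n. (norm (f n))\<^sup>2) + sqrt (\<Sum>n. (norm (g n))\<^sup>2)"
    by (intro add_mono l2_partial_le assms)
  finally show ?thesis .
qed

instantiation l2_seq :: (real_normed_vector) real_normed_vector
begin

lift_definition zero_l2_seq :: "'a l2_seq" is "\<lambda>_. 0" by simp

lift_definition plus_l2_seq :: "'a l2_seq \<Rightarrow> 'a l2_seq \<Rightarrow> 'a l2_seq" is "\<lambda>f g n. f n + g n"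
  by (rule l2_boundI(1)[OF l2_add_bound])

lift_definition uminus_l2_seq :: "'a l2_seq \<Rightarrow> 'a l2_seq" is "\<lambda>f n. - f n" by simp

lift_definition minus_l2_seq :: "'a l2_seq \<Rightarrow> 'a l2_seq \<Rightarrow> 'a l2_seq" is "\<lambda>f g n. f n - g n"
  subgoal for f g using l2_boundI(1)[OF l2_add_bound, of f "\<lambda>n. - g n"] by simp
  done

lift_definition scaleR_l2_seq :: "real \<Rightarrow> 'a l2_seq \<Rightarrow> 'a l2_seq" is "\<lambda>r f n. r *\<^sub>R f n"
  by (simp add: power_mult_distrib summable_mult)

lift_definition norm_l2_seq :: "'a l2_seq \<Rightarrow> real" is "\<lambda>f. sqrt (\<Sum>n. (norm (f n))\<^sup>2)" .

definition sgn_l2_seq :: "'a l2_seq \<Rightarrow> 'a l2_seq" where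
  "sgn_l2_seq x = scaleR (inverse (norm x)) x"
definition dist_l2_seq :: "'a l2_seq \<Rightarrow> 'a l2_seq \<Rightarrow> real" where "dist_l2_seq x y = norm (x - y)"
definition uniformity_l2_seq :: "('a l2_seq \<times> 'a l2_seq) filter" where
  [code del]: "uniformity_l2_seq = (INF e\<in>{0 <..}. principal {(x, y). dist x y < e})"
definition open_l2_seq :: "'a l2_seq set \<Rightarrow> bool" where
  [code del]: "open_l2_seq S = (\<forall>x\<in>S. \<forall>\<^sub>F (x', y) in uniformity. x' = x \<longrightarrow> y \<in> S)"

instance
proof
  fix x y z :: "'a l2_seq" and a b :: real
  show "x + y + z = x + (y + z)" "x + y = y + x" "0 + x = x" "- x + x = 0" "x - y = x + - y"
    "a *\<^sub>R (x + y) = a *\<^sub>R x + a *\<^sub>R y" "(a + b) *\<^sub>R x = a *\<^sub>R x + b *\<^sub>R x"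
    "a *\<^sub>R b *\<^sub>R x = (a * b) *\<^sub>R x" "1 *\<^sub>R x = x"
    by (transfer; simp add: algebra_simps)+
  show "norm (x + y) \<le> norm x + norm y"
    by transfer (rule l2_boundI(2)[OF l2_add_bound])
  show "norm (a *\<^sub>R x) = \<bar>a\<bar> * norm x"
    by transfer (simp add: power_mult_distrib suminf_mult real_sqrt_mult)
  show "(norm x = 0) = (x = 0)"
    by transfer (simp add: suminf_eq_zero_iff fun_eq_iff)
qed (simp_all add: sgn_l2_seq_def dist_l2_seq_def uniformity_l2_seq_def open_l2_seq_def)

end

lemma norm_l2_nth_le: "norm (l2_nth x n) \<le> norm x"
proof transfer
  fix x :: "nat \<Rightarrow> 'a" and n
  assume "summable (\<lambda>n. (norm (x n))\<^sup>2)"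
  from l2_partial_le[OF this, of "Suc n"] member_le_L2_set[of "{..<Suc n}" n "\<lambda>k. norm (x k)"]
  show "norm (x n) \<le> sqrt (\<Sum>n. (norm (x n))\<^sup>2)" by simp
qed

instance l2_seq :: (banach) complete_space
proof
  fix X :: "nat \<Rightarrow> 'a l2_seq"
  assume X: "Cauchy X"
  have "Cauchy (\<lambda>m. l2_nth (X m) k)" for k
  proof (rule CauchyI)
    fix e :: real assume "0 < e"
    then obtain M where M: "\<And>m n. m \<ge> M \<Longrightarrow> n \<ge> M \<Longrightarrow> norm (X m - X n) < e"
      using CauchyD[OF X] by blast
    have "norm (l2_nth (X m) k - l2_nth (X n) k) \<le> norm (X m - X n)" for m n
      using norm_l2_nth_le[of "X m - X n" k] by (simp add: minus_l2_seq.rep_eq)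
    then have "norm (l2_nth (X m) k - l2_nth (X n) k) < e" if "m \<ge> M" "n \<ge> M" for m n
      using M[OF that] by (rule le_less_trans)
    then show "\<exists>M. \<forall>m\<ge>M. \<forall>n\<ge>M. norm (l2_nth (X m) k - l2_nth (X n) k) < e"
      by (intro exI[of _ M] allI impI)
  qed
  then have "\<forall>k. \<exists>l. (\<lambda>m. l2_nth (X m) k) \<longlonglongrightarrow> l"
    by (simp add: Cauchy_convergent_iff convergent_def)
  then obtain L where L: "\<And>k. (\<lambda>m. l2_nth (X m) k) \<longlonglongrightarrow> L k"
    by metis
  have close: "\<exists>M. \<forall>m\<ge>M. \<forall>N. L2_set (\<lambda>k. norm (l2_nth (X m) k - L k)) {..<N} \<le> e"
    if e: "0 < e" for e :: real
  proof -
    obtain M where M: "\<And>m n. m \<ge> M \<Longrightarrow> n \<ge> M \<Longrightarrow> norm (X m - X n) < e"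
      using CauchyD[OF X e] by blast
    have "L2_set (\<lambda>k. norm (l2_nth (X m) k - L k)) {..<N} \<le> e" if m: "m \<ge> M" for m N
    proof (rule LIMSEQ_le_const2)
      show "(\<lambda>n. L2_set (\<lambda>k. norm (l2_nth (X m) k - l2_nth (X n) k)) {..<N})
          \<longlonglongrightarrow> L2_set (\<lambda>k. norm (l2_nth (X m) k - L k)) {..<N}"
        unfolding L2_set_def by (intro tendsto_intros L)
      have "L2_set (\<lambda>k. norm (l2_nth (X m) k - l2_nth (X n) k)) {..<N} \<le> norm (X m - X n)" for n
        using l2_partial_le[of "l2_nth (X m - X n)" N] l2_nth[of "X m - X n"]
        by (simp add: minus_l2_seq.rep_eq norm_l2_seq.rep_eq)
      then show "\<exists>N0. \<forall>n\<ge>N0.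
          L2_set (\<lambda>k. norm (l2_nth (X m) k - l2_nth (X n) k)) {..<N} \<le> e"
        using M[OF m] by (meson less_imp_le order_trans)
    qed
    then show ?thesis by blast
  qed
  have diff: "summable (\<lambda>k. (norm (l2_nth (X m) k - L k))\<^sup>2)"
    if "\<forall>N. L2_set (\<lambda>k. norm (l2_nth (X m) k - L k)) {..<N} \<le> e" for m and e :: real
    using that l2_boundI(1)[of "\<lambda>k. l2_nth (X m) k - L k" e] by blast
  obtain M where M: "\<forall>m\<ge>M. \<forall>N. L2_set (\<lambda>k. norm (l2_nth (X m) k - L k)) {..<N} \<le> 1"
    using close[of 1] by auto
  have "summable (\<lambda>k. (norm (l2_nth (X M - Abs_l2_seq (\<lambda>k. l2_nth (X M) k - L k)) k))\<^sup>2)"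
    using l2_nth[of "X M - Abs_l2_seq (\<lambda>k. l2_nth (X M) k - L k)"] by simp
  moreover have "l2_nth (X M - Abs_l2_seq (\<lambda>k. l2_nth (X M) k - L k)) k = L k" for k
    using diff[of M 1] M by (simp add: minus_l2_seq.rep_eq Abs_l2_seq_inverse)
  ultimately have Ls: "summable (\<lambda>k. (norm (L k))\<^sup>2)" by simp
  have "X \<longlonglongrightarrow> Abs_l2_seq L"
  proof (rule LIMSEQ_I)
    fix e :: real assume "0 < e"
    then obtain M where M: "\<forall>m\<ge>M. \<forall>N. L2_set (\<lambda>k. norm (l2_nth (X m) k - L k)) {..<N} \<le> e / 2"
      using close[of "e / 2"] by auto
    have "norm (X m - Abs_l2_seq L) < e" if "m \<ge> M" for m
      using l2_boundI(2)[of "\<lambda>k. l2_nth (X m) k - L k" "e / 2"] M that \<open>0 < e\<close> Ls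
      by (simp add: norm_l2_seq.rep_eq minus_l2_seq.rep_eq Abs_l2_seq_inverse)
    then show "\<exists>no. \<forall>n\<ge>no. norm (X n - Abs_l2_seq L) < e" by blast
  qed
  then show "convergent X" by (rule convergentI)
qed

lemma norm_scaleC: "norm (c *\<^sub>C x) = cmod c * norm (x :: 'a::complex_inner_space)"
proof -
  have "complex_of_real ((norm (c *\<^sub>C x))\<^sup>2) = c * cnj (c * cinner x x)"
    by (metis cinner_commute cinner_scaleC_left cinner_self)
  also have "\<dots> = complex_of_real ((cmod c * norm x)\<^sup>2)"
    unfolding power_mult_distrib of_real_mult complex_norm_square[of c, folded of_real_power]
    by (simp add: cinner_self)
  finally show ?thesis
    by (metis norm_ge_zero of_real_eq_iff power2_eq_imp_eq mult_nonneg_nonneg)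
qed

lemma Cauchy_Schwarz_cinner: "cmod (cinner x y) \<le> norm x * norm (y :: 'a::complex_inner_space)"
proof (cases "y = 0")
  case True
  have "cinner x 0 = cnj (cinner (0 *\<^sub>C 0) x)"
    by (metis cinner_commute of_real_0 scaleC_of_real scaleR_zero_left)
  then show ?thesis using True by (simp add: cinner_scaleC_left)
next
  case False
  define c where "c = cinner x y"
  define s where "s = - c / complex_of_real ((norm y)\<^sup>2)"
  have Y: "(norm y)\<^sup>2 > 0" using False by simp
  have add_right: "cinner u (v + w) = cinner u v + cinner u w" for u v w :: 'a
    by (metis cinner_add_left cinner_commute complex_cnj_add)
  have scale_right: "cinner u (d *\<^sub>C v) = cnj d * cinner u v" for u v :: 'a and d
    by (metis cinner_commute cinner_scaleC_left complex_cnj_mult)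
  have yx: "cinner y x = cnj c" unfolding c_def by (rule cinner_commute)
  have cc: "c * cnj c = complex_of_real ((cmod c)\<^sup>2)" by (rule complex_norm_square[symmetric])
  have "complex_of_real ((norm (x + s *\<^sub>C y))\<^sup>2)
      = cinner x x + cnj s * c + s * (cnj c + cnj s * cinner y y)"
    by (simp only: cinner_self[symmetric] add_right scale_right cinner_add_left
        cinner_scaleC_left yx c_def[symmetric]) (simp add: algebra_simps)
  also have "\<dots> = complex_of_real ((norm x)\<^sup>2) - c * cnj c / complex_of_real ((norm y)\<^sup>2)"
    using Y unfolding cinner_self s_def by (simp add: field_simps)
  also have "\<dots> = complex_of_real ((norm x)\<^sup>2 - (cmod c)\<^sup>2 / (norm y)\<^sup>2)"
    unfolding cc by simp
  finally have "(norm (x + s *\<^sub>C y))\<^sup>2 = (norm x)\<^sup>2 - (cmod c)\<^sup>2 / (norm y)\<^sup>2"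
    by (simp only: of_real_eq_iff)
  then have "(cmod c)\<^sup>2 / (norm y)\<^sup>2 \<le> (norm x)\<^sup>2"
    by (metis diff_ge_0_iff_ge zero_le_power2)
  then have "(cmod c)\<^sup>2 \<le> (norm x * norm y)\<^sup>2"
    using Y by (simp add: pos_divide_le_eq power_mult_distrib)
  then show ?thesis unfolding c_def by (rule power2_le_imp_le) simp
qed

lemma summable_cinner:
  fixes f g :: "nat \<Rightarrow> 'a::complex_inner_space"
  assumes "summable (\<lambda>n. (norm (f n))\<^sup>2)" "summable (\<lambda>n. (norm (g n))\<^sup>2)"
  shows "summable (\<lambda>n. cinner (f n) (g n))"
proof (rule summable_comparison_test')
  show "summable (\<lambda>n. (norm (f n))\<^sup>2 + (norm (g n))\<^sup>2)" by (intro summable_add assms)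
  fix n
  have "2 * (norm (f n) * norm (g n)) \<le> (norm (f n))\<^sup>2 + (norm (g n))\<^sup>2"
    using sum_squares_bound[of "norm (f n)" "norm (g n)"] by simp
  moreover have "0 \<le> norm (f n) * norm (g n)" by simp
  ultimately show "norm (cinner (f n) (g n)) \<le> (norm (f n))\<^sup>2 + (norm (g n))\<^sup>2"
    using Cauchy_Schwarz_cinner[of "f n" "g n"] by linarith
qed

instantiation l2_seq :: (complex_inner_space) complex_inner_space
begin

lift_definition scaleC_l2_seq :: "complex \<Rightarrow> 'a l2_seq \<Rightarrow> 'a l2_seq" is "\<lambda>c f n. c *\<^sub>C f n"
  by (simp add: norm_scaleC power_mult_distrib summable_mult)

lift_definition cinner_l2_seq :: "'a l2_seq \<Rightarrow> 'a l2_seq \<Rightarrow> complex" is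
  "\<lambda>f g. \<Sum>n. cinner (f n) (g n)" .

instance
proof
  fix x y z :: "'a l2_seq" and c d :: complex and r :: real
  show "c *\<^sub>C (x + y) = c *\<^sub>C x + c *\<^sub>C y" "(c + d) *\<^sub>C x = c *\<^sub>C x + d *\<^sub>C x"
    "c *\<^sub>C d *\<^sub>C x = (c * d) *\<^sub>C x" "complex_of_real r *\<^sub>C x = r *\<^sub>R x"
    by (transfer; simp add: scaleC_add_right scaleC_add_left scaleC_scaleC scaleC_of_real)+
  show "cinner x y = cnj (cinner y x)"
  proof transfer
    fix x y :: "nat \<Rightarrow> 'a"
    assume "summable (\<lambda>n. (norm (x n))\<^sup>2)" "summable (\<lambda>n. (norm (y n))\<^sup>2)"
    from summable_sums[OF summable_cinner[OF this(2,1)]]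
    have "(\<lambda>n. cnj (cinner (y n) (x n))) sums cnj (\<Sum>n. cinner (y n) (x n))"
      by (simp add: sums_cnj)
    then show "(\<Sum>n. cinner (x n) (y n)) = cnj (\<Sum>n. cinner (y n) (x n))"
      by (metis (no_types, lifting) cinner_commute sums_unique suminf_cong)
  qed
  show "cinner (x + y) z = cinner x z + cinner y z"
    by transfer (simp add: cinner_add_left suminf_add summable_cinner)
  show "cinner (c *\<^sub>C x) y = c * cinner x y"
    by transfer (simp add: cinner_scaleC_left suminf_mult summable_cinner)
  show "cinner x x = complex_of_real ((norm x)\<^sup>2)"
    by transfer (simp add: cinner_self suminf_nonneg suminf_of_real flip: of_real_power)
qed

end

instance l2_seq :: (chilbert_space) chilbert_space ..


section \<open>Operators\<close>

text \<open>Library bounded linear maps are only real-linear, so complex linearity is stated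
  separately.\<close>

definition complex_linear ::
  "('a::complex_inner_space \<Rightarrow>\<^sub>L 'b::complex_inner_space) \<Rightarrow> bool" where
  "complex_linear T \<longleftrightarrow> (\<forall>c x. T (c *\<^sub>C x) = c *\<^sub>C T x)"

text \<open>For complex-linear \<open>T\<close> the adjoint exists, by the Riesz representation theorem, and is
  unique. Its value on other maps is irrelevant.\<close>

definition hadjoint :: "('a::chilbert_space \<Rightarrow>\<^sub>L 'b::chilbert_space) \<Rightarrow> 'b \<Rightarrow>\<^sub>L 'a" where
  "hadjoint T = (THE S :: 'b \<Rightarrow>\<^sub>L 'a. \<forall>x y. cinner (T x) y = cinner x (S y))"

definition normal_op :: "('a::chilbert_space \<Rightarrow>\<^sub>L 'a) \<Rightarrow> bool" where
  "normal_op T \<longleftrightarrow> complex_linear T \<and> hadjoint T o\<^sub>L T = T o\<^sub>L hadjoint T"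

definition unitary_op :: "('a::chilbert_space \<Rightarrow>\<^sub>L 'a) \<Rightarrow> bool" where
  "unitary_op T \<longleftrightarrow>
     complex_linear T \<and> hadjoint T o\<^sub>L T = id_blinfun \<and> T o\<^sub>L hadjoint T = id_blinfun"

lift_definition block_op ::
  "('a::chilbert_space \<Rightarrow>\<^sub>L 'a) \<Rightarrow> ('a \<Rightarrow>\<^sub>L 'a) \<Rightarrow> ('a \<Rightarrow>\<^sub>L 'a) \<Rightarrow> ('a \<Rightarrow>\<^sub>L 'a) \<Rightarrow> ('a \<times> 'a) \<Rightarrow>\<^sub>L ('a \<times> 'a)"
  is "\<lambda>A B C D p. (A (fst p) + B (snd p), C (fst p) + D (snd p))"
  by (intro bounded_linear_Pair bounded_linear_add;
      erule bounded_linear_compose[OF _ bounded_linear_fst]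
        bounded_linear_compose[OF _ bounded_linear_snd])

text \<open>Up to unitary equivalence, a Hilbert space containing \<open>'a\<close> as a closed subspace is an
  orthogonal sum \<open>'a \<oplus> 'k\<close>, with \<open>'a\<close> embedded as \<open>'a \<oplus> 0\<close>.\<close>

definition normal_extension_in ::
  "'k::chilbert_space itself \<Rightarrow> ('a::chilbert_space \<Rightarrow>\<^sub>L 'a) \<Rightarrow> bool" where
  "normal_extension_in K T \<longleftrightarrow>
     (\<exists>M :: ('a \<times> 'k) \<Rightarrow>\<^sub>L ('a \<times> 'k). normal_op M \<and> (\<forall>x. M (x, 0) = (T x, 0)))"

text \<open>HOL cannot quantify over the type \<open>'k\<close> inside a formula. The choice of \<open>'k\<close> below loses no
  extension: if \<open>M\<close> is a normal extension of \<open>T\<close>, the closed span of all \<open>(M\<^sup>*)\<^sup>n x\<close> with \<open>x\<close> in \<open>'a\<close>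
  reduces \<open>M\<close>, and the orthogonal complement of \<open>'a\<close> in it has Hilbert dimension at most \<open>\<aleph>\<^sub>0\<close>
  times that of \<open>'a\<close>. It therefore embeds isometrically in \<open>'a l2_seq\<close>, where the restriction of
  \<open>M\<close> can be extended by zero.\<close>

definition subnormal :: "('a::chilbert_space \<Rightarrow>\<^sub>L 'a) \<Rightarrow> bool" where
  "subnormal T \<longleftrightarrow> normal_extension_in TYPE('a l2_seq) T"

definition commuting_tuple :: "('a::chilbert_space \<Rightarrow>\<^sub>L 'a)^'n \<Rightarrow> bool" where
  "commuting_tuple T \<longleftrightarrow>
     (\<forall>i. complex_linear (T $ i)) \<and> (\<forall>i j. T $ i o\<^sub>L T $ j = T $ j o\<^sub>L T $ i)"


section \<open>Taylor joint spectrum\<close>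

text \<open>The Koszul complex of a commuting tuple \<open>T\<close> lives on \<open>'a \<otimes> \<Lambda>(\<complex>\<^sup>n)\<close>. An element
  \<open>\<Sum>\<^sub>S \<xi> S \<otimes> e\<^sub>S\<close>, with \<open>e\<^sub>S\<close> the wedge product of the \<open>e\<^sub>i\<close> with \<open>i \<in> S\<close> in increasing order, is
  represented by \<open>\<xi>\<close>, and the boundary map is \<open>\<xi> \<mapsto> \<Sum>\<^sub>i e\<^sub>i \<wedge> T\<^sub>i \<xi>\<close>.
  As this map is homogeneous of degree one, the complex is exact at every stage iff the kernel
  of the total map equals its range.\<close>

definition koszul_map ::
  "('n::{finite,linorder} \<Rightarrow> 'a \<Rightarrow> 'a) \<Rightarrow> ('n set \<Rightarrow> 'a) \<Rightarrow> 'n set \<Rightarrow> 'a::real_vector" where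
  "koszul_map T \<xi> = (\<lambda>S. \<Sum>i\<in>S. (- 1) ^ card {j \<in> S. j < i} *\<^sub>R T i (\<xi> (S - {i})))"

definition koszul_exact :: "('n::{finite,linorder} \<Rightarrow> 'a \<Rightarrow> 'a::real_vector) \<Rightarrow> bool" where
  "koszul_exact T \<longleftrightarrow> {\<xi>. koszul_map T \<xi> = (\<lambda>S. 0)} = range (koszul_map T)"

definition taylor_spectrum ::
  "('a::chilbert_space \<Rightarrow>\<^sub>L 'a, 'n::{finite,linorder}) vec \<Rightarrow> (complex, 'n) vec set" where
  "taylor_spectrum T = {l. \<not> koszul_exact (\<lambda>i x. (T $ i) x - l $ i *\<^sub>C x)}"


section \<open>Distinguished boundary\<close>

definition holomorphic_in :: "(complex^'n \<Rightarrow> complex) \<Rightarrow> (complex^'n) set \<Rightarrow> bool" where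
  "holomorphic_in f \<Omega> \<longleftrightarrow>
     (\<forall>z\<in>\<Omega>. \<exists>f'. (f has_derivative f') (at z) \<and> (\<forall>c v. f' (c *s v) = c * f' v))"

definition max_modulus_set :: "(complex^'n) set \<Rightarrow> (complex^'n) set \<Rightarrow> bool" where
  "max_modulus_set \<Omega> B \<longleftrightarrow> closed B \<and> B \<subseteq> closure \<Omega> \<and>
     (\<forall>f. continuous_on (closure \<Omega>) f \<and> holomorphic_in f \<Omega> \<longrightarrow>
        (\<exists>b\<in>B. \<forall>z\<in>closure \<Omega>. cmod (f z) \<le> cmod (f b)))"

definition distinguished_boundary :: "(complex^'n) set \<Rightarrow> (complex^'n) set" where
  "distinguished_boundary \<Omega> = (LEAST B. max_modulus_set \<Omega> B)"

definition domain_unitary ::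
  "(complex, 'n::{finite,linorder}) vec set \<Rightarrow> ('a::chilbert_space \<Rightarrow>\<^sub>L 'a, 'n) vec \<Rightarrow> bool" where
  "domain_unitary \<Omega> T \<longleftrightarrow> commuting_tuple T \<and> (\<forall>i. normal_op (T $ i)) \<and>
     taylor_spectrum T \<subseteq> distinguished_boundary \<Omega>"


section \<open>The domains\<close>

text \<open>The index \<open>4\<close> of the four-element type is its \<open>0\<close>, and likewise for \<open>3\<close>; entries of
  \<^term>\<open>vector\<close> are nevertheless counted from \<open>1\<close>.\<close>

lemma vector_4:
  fixes w x y z :: "'a::zero"
  shows "(vector [w, x, y, z] :: 'a^4) $ 1 = w" "(vector [w, x, y, z] :: 'a^4) $ 2 = x"
    "(vector [w, x, y, z] :: 'a^4) $ 3 = y" "(vector [w, x, y, z] :: 'a^4) $ 4 = z"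
  unfolding vector_def by simp_all

definition tetrablock :: "(complex^3) set" where
  "tetrablock = {x. \<forall>z1 z2. cmod z1 \<le> 1 \<and> cmod z2 \<le> 1 \<longrightarrow>
     1 - x$1 * z1 - x$2 * z2 + x$3 * z1 * z2 \<noteq> 0}"

text \<open>The real supremum is meaningful: for a point of the tetrablock the denominator is bounded
  away from \<open>0\<close> on the closed bidisc.\<close>

definition hexablock :: "(complex^4) set" where
  "hexablock = {vector [a, x1, x2, x3] | a x1 x2 x3.
     vector [x1, x2, x3] \<in> tetrablock \<and>
     (SUP (z1, z2) \<in> ball 0 1 \<times> ball 0 1.
        cmod (a * complex_of_real (sqrt ((1 - (cmod z1)\<^sup>2) * (1 - (cmod z2)\<^sup>2))) /
          (1 - x1 * z1 - x2 * z2 + x3 * z1 * z2))) < 1}"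

abbreviation unit_ball2 :: "(complex^2) set" where
  "unit_ball2 \<equiv> ball 0 1"

end

theory Submission
  imports Defs "HOL-Complex_Analysis.Conformal_Mappings"
begin

text \<open>For all three domains, being a unitary tuple turns out to be a list of operator identities, and the
  theorem is then algebra with these identities.

  The distinguished boundaries of the tetrablock and the hexablock are

    \<open>bE = {x. \<bar>x3\<bar> = 1, x1 = cnj x2 x3, \<bar>x2\<bar> \<le> 1}\<close>,
    \<open>bH = {(a, x). \<bar>x3\<bar> = 1, x1 = cnj x2 x3, \<bar>a\<bar>\<^sup>2 + \<bar>x1\<bar>\<^sup>2 = 1}\<close>,

  and that of the ball is the unit sphere. Every point of each domain is the centre of an analytic disc
  whose boundary lies in the respective set, so these sets carry the maximum modulus
  (\<open>distinguished_boundary_eqI\<close>). For the tetrablock and the hexablock the discs come from moving a point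
  by an automorphism to \<open>(0, 0, w)\<close>, respectively \<open>(b, 0, 0, w)\<close>, in which position \<open>b\<close> and \<open>w\<close> range
  over a bidisc; the parameters of the automorphism form a fixed point, found by Brouwer's theorem
  (\<open>tetrablock_param\<close>). The sets are minimal because polynomials peak at each of their points.

  For a commuting tuple of normal operators, the Taylor spectrum is the joint approximate point
  spectrum (\<open>taylor_spectrum_normal_iff\<close>). One inclusion is a uniform boundedness argument. The
  other one inverts \<open>\<Sum>\<^sub>i (N\<^sub>i - l\<^sub>i)\<^sup>* (N\<^sub>i - l\<^sub>i)\<close> and contracts the Koszul complex, where Fuglede's
  theorem provides the commutation relations. If a polynomial \<open>D\<close> in the \<open>N\<^sub>i\<close> and \<open>N\<^sub>i\<^sup>*\<close> is nonzero,
  some point of the joint spectrum gives it a value of modulus \<open>\<parallel>D\<parallel>\<close> (\<open>spectrum_attains_norm\<close>): start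
  with approximate eigenvectors of \<open>D\<^sup>* D\<close> for \<open>\<parallel>D\<parallel>\<^sup>2\<close> and refine them, one real or imaginary part of an
  \<open>N\<^sub>i\<close> at a time, by maximising the quadratic form of that part (\<open>approx_null_extend\<close>). This takes the
  place of the spectral theorem. Hence a polynomial vanishes on the spectrum iff the corresponding
  operator is zero, and the tuples in question are characterised by \<open>N3\<^sup>* N3 = I\<close>, \<open>N1 = N2\<^sup>* N3\<close> and
  \<open>\<parallel>N2\<parallel> \<le> 1\<close>, respectively \<open>N0\<^sup>* N0 + N1\<^sup>* N1 = I\<close>.

  With these identities, all conditions except the one on block matrices and the one on subnormality
  are equivalent by inspection. As for block matrices, a unitary \<open>2 \<times> 2\<close>
  matrix \<open>A\<close> with commuting entries satisfies Cramer's rule \<open>A\<^sup>* det A = adj A\<close>, whose entries are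
  the relations for the hexablock, and which leaves \<open>A12 = - A21\<^sup>* det A\<close> as the only possible choice of
  the missing entry. As for subnormality, \<open>N0\<close> commutes with \<open>N0\<^sup>* N0 = I - N1\<^sup>* N1\<close>, so it is quasinormal, and its
  adjoint is subnormal; the two one-sided estimates that follow make it normal.\<close>

section \<open>The inner product\<close>

lemma cinner_add_right: "cinner x (y + z) = cinner x y + cinner x (z :: 'a::complex_inner_space)"
  by (metis cinner_add_left cinner_commute complex_cnj_add)

lemma cinner_scaleC_right: "cinner x (c *\<^sub>C y) = cnj c * cinner x (y :: 'a::complex_inner_space)"
  by (metis cinner_commute cinner_scaleC_left complex_cnj_mult)

lemma cinner_scaleR_left: "cinner (r *\<^sub>R x) y = of_real r * cinner x (y :: 'a::complex_inner_space)"
  by (metis cinner_scaleC_left scaleC_of_real)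

lemma cinner_scaleR_right: "cinner x (r *\<^sub>R y) = of_real r * cinner x (y :: 'a::complex_inner_space)"
  by (metis cinner_scaleC_right scaleC_of_real complex_cnj_complex_of_real)

lemma cinner_zero_left [simp]: "cinner 0 (y :: 'a::complex_inner_space) = 0"
  using cinner_scaleR_left[of 0 0 y] by simp

lemma cinner_zero_right [simp]: "cinner (x :: 'a::complex_inner_space) 0 = 0"
  using cinner_scaleR_right[of x 0 0] by simp

lemma cinner_minus_left: "cinner (- x) y = - cinner x (y :: 'a::complex_inner_space)"
  using cinner_scaleR_left[of "-1" x y] by simp

lemma cinner_minus_right: "cinner x (- y) = - cinner x (y :: 'a::complex_inner_space)"
  using cinner_scaleR_right[of x "-1" y] by simp

lemma cinner_diff_left: "cinner (x - y) z = cinner x z - cinner y (z :: 'a::complex_inner_space)"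
  using cinner_add_left[of x "- y" z] by (simp add: cinner_minus_left)

lemma cinner_diff_right: "cinner x (y - z) = cinner x y - cinner x (z :: 'a::complex_inner_space)"
  using cinner_add_right[of x y "- z"] by (simp add: cinner_minus_right)

lemmas cinner_simps = cinner_add_left cinner_add_right cinner_diff_left cinner_diff_right
  cinner_minus_left cinner_minus_right cinner_scaleC_left cinner_scaleC_right
  cinner_scaleR_left cinner_scaleR_right

lemma scaleC_one [simp]: "1 *\<^sub>C x = (x :: 'a::complex_inner_space)"
  using scaleC_of_real[of 1 x] by simp

lemma scaleC_zero_left [simp]: "0 *\<^sub>C x = (0 :: 'a::complex_inner_space)"
  using scaleC_of_real[of 0 x] by simp

lemma scaleC_zero_right [simp]: "c *\<^sub>C 0 = (0 :: 'a::complex_inner_space)"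
  using norm_scaleC[of c 0] by simp

lemma scaleC_minus_left: "(- c) *\<^sub>C x = - (c *\<^sub>C (x :: 'a::complex_inner_space))"
  using scaleC_add_left[of c "- c" x] by (simp add: eq_neg_iff_add_eq_0 add.commute)

lemma scaleC_diff_left: "(c - d) *\<^sub>C x = c *\<^sub>C x - d *\<^sub>C (x :: 'a::complex_inner_space)"
  using scaleC_add_left[of c "- d" x] by (simp add: scaleC_minus_left)

lemma scaleC_minus_right: "c *\<^sub>C (- x) = - (c *\<^sub>C (x :: 'a::complex_inner_space))"
  using scaleC_add_right[of c x "- x"] by (simp add: eq_neg_iff_add_eq_0 add.commute)

lemma scaleC_diff_right: "c *\<^sub>C (x - y) = c *\<^sub>C x - c *\<^sub>C (y :: 'a::complex_inner_space)"
  using scaleC_add_right[of c x "- y"] by (simp add: scaleC_minus_right)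

lemma scaleC_scaleR: "c *\<^sub>C (r *\<^sub>R x) = r *\<^sub>R (c *\<^sub>C (x :: 'a::complex_inner_space))"
  by (metis mult.commute scaleC_of_real scaleC_scaleC)

lemma Re_cinner_commute: "Re (cinner x y) = Re (cinner y (x :: 'a::complex_inner_space))"
  by (subst cinner_commute) simp

lemma Re_cinner_self: "Re (cinner x x) = (norm (x :: 'a::complex_inner_space))\<^sup>2"
  by (simp add: cinner_self)

lemma norm_add_square:
  "(norm (x + y))\<^sup>2 = (norm x)\<^sup>2 + 2 * Re (cinner x y) + (norm (y :: 'a::complex_inner_space))\<^sup>2"
  unfolding Re_cinner_self[symmetric] by (simp add: cinner_simps Re_cinner_commute[of y x])

lemma norm_diff_square:
  "(norm (x - y))\<^sup>2 = (norm x)\<^sup>2 - 2 * Re (cinner x y) + (norm (y :: 'a::complex_inner_space))\<^sup>2"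
  unfolding Re_cinner_self[symmetric] by (simp add: cinner_simps Re_cinner_commute[of y x])

lemma Re_cinner_le: "\<bar>Re (cinner x y)\<bar> \<le> norm x * norm (y :: 'a::complex_inner_space)"
  using Cauchy_Schwarz_cinner[of x y] abs_Re_le_cmod[of "cinner x y"] by linarith

lemma cinner_eqI:
  assumes "\<And>x. cinner x y = cinner x (z :: 'a::complex_inner_space)"
  shows "y = z"
proof -
  have "cinner (y - z) (y - z) = 0" by (simp add: cinner_diff_right assms)
  then show ?thesis by (simp add: cinner_self)
qed

lemma bounded_linear_cinner_left: "bounded_linear (\<lambda>x. cinner x (y :: 'a::complex_inner_space))"
  by (rule bounded_linear_intro[of _ "norm y"])
    (simp_all add: cinner_simps Cauchy_Schwarz_cinner scaleR_conv_of_real)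

lemma bounded_linear_cinner_right: "bounded_linear (\<lambda>y. cinner (x :: 'a::complex_inner_space) y)"
  by (rule bounded_linear_intro[of _ "norm x"])
    (simp_all add: cinner_simps scaleR_conv_of_real mult.commute[of _ "norm x"]
      Cauchy_Schwarz_cinner)

section \<open>Adjoints\<close>

text \<open>The representing vector minimises \<open>\<parallel>x\<parallel>\<^sup>2 - 2 Re \<phi> x\<close>. By the parallelogram law a minimising
  sequence is Cauchy, and the first variation at its limit gives the representation.\<close>

lemma Riesz_representation:
  fixes \<phi> :: "'a::chilbert_space \<Rightarrow> complex"
  assumes bl: "bounded_linear \<phi>" and C: "\<And>c x. \<phi> (c *\<^sub>C x) = c * \<phi> x"
  shows "\<exists>z. \<forall>x. \<phi> x = cinner x z"
proof -
  interpret bounded_linear \<phi> by (rule bl)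
  define J where "J x = (norm x)\<^sup>2 - 2 * Re (\<phi> x)" for x
  obtain K where K: "\<And>x. norm (\<phi> x) \<le> norm x * K" using bounded by blast
  have below: "- K\<^sup>2 \<le> J x" for x
  proof -
    have "Re (\<phi> x) \<le> norm x * K" using K[of x] abs_Re_le_cmod[of "\<phi> x"] by linarith
    moreover have "0 \<le> (norm x - K)\<^sup>2" by simp
    ultimately show ?thesis unfolding J_def power2_diff by linarith
  qed
  define m where "m = Inf (range J)"
  have bdd: "bdd_below (range J)" using below by (auto intro!: bdd_belowI)
  have m_le: "m \<le> J x" for x unfolding m_def by (rule cInf_lower[OF _ bdd]) simp
  have "\<exists>x. J x < m + inverse (Suc n)" for n
    using cInf_lessD[of "range J" "m + inverse (Suc n)"] unfolding m_def by auto
  then obtain X where X: "\<And>n. J (X n) < m + inverse (real (Suc n))" by metis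
  have par: "(norm (x - y))\<^sup>2 \<le> 2 * (J x - m) + 2 * (J y - m)" for x y
  proof -
    have "m \<le> J ((1/2) *\<^sub>R (x + y))" by (rule m_le)
    also have "\<dots> = (norm (x + y))\<^sup>2 / 4 - Re (\<phi> x) - Re (\<phi> y)"
      unfolding J_def scale norm_scaleR add by (simp add: power_divide field_simps)
    finally have "4 * m \<le> (norm (x + y))\<^sup>2 - 4 * Re (\<phi> x) - 4 * Re (\<phi> y)" by simp
    then show ?thesis unfolding J_def norm_add_square norm_diff_square by (simp add: algebra_simps)
  qed
  have "Cauchy X"
  proof (rule CauchyI)
    fix e :: real assume e: "0 < e"
    obtain M where M: "inverse (real (Suc M)) < e\<^sup>2 / 4"
      using reals_Archimedean[of "e\<^sup>2 / 4"] e by auto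
    have "norm (X p - X q) < e" if "p \<ge> M" "q \<ge> M" for p q
    proof -
      have i: "inverse (real (Suc k)) \<le> inverse (real (Suc M))" if "k \<ge> M" for k
        using that by (simp add: field_simps)
      have "(norm (X p - X q))\<^sup>2 < e\<^sup>2"
        using par[of "X p" "X q"] X[of p] X[of q] i[OF that(1)] i[OF that(2)] M
        by (simp only: right_diff_distrib)
      then show ?thesis using e by (simp add: power2_less_imp_less)
    qed
    then show "\<exists>M. \<forall>p\<ge>M. \<forall>q\<ge>M. norm (X p - X q) < e" by blast
  qed
  then obtain z where z: "X \<longlonglongrightarrow> z" by (metis Cauchy_convergent_iff convergent_def)
  have "(\<lambda>n. J (X n)) \<longlonglongrightarrow> J z"
    unfolding J_def by (intro tendsto_intros z tendsto)
  moreover have "(\<lambda>n. m + inverse (real (Suc n))) \<longlonglongrightarrow> m + 0"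
    by (intro tendsto_intros LIMSEQ_inverse_real_of_nat)
  ultimately have "J z \<le> m + 0"
    by (rule LIMSEQ_le) (use X less_imp_le in blast)
  then have min: "J z \<le> J x" for x using m_le[of x] by simp
  have re: "Re (\<phi> x) = Re (cinner x z)" for x
  proof -
    define d where "d = Re (cinner x z) - Re (\<phi> x)"
    have q: "0 \<le> t\<^sup>2 * (norm x)\<^sup>2 + 2 * t * d" for t :: real
      using min[of "z + t *\<^sub>R x"] Re_cinner_commute[of x z]
      unfolding J_def norm_add_square d_def
      by (simp add: add scale cinner_simps power_mult_distrib algebra_simps)
    have "d = 0"
    proof (cases "norm x = 0")
      case True then show ?thesis by (simp add: d_def zero)
    next
      case False
      define N where "N = (norm x)\<^sup>2"
      have N: "N > 0" using False by (simp add: N_def)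
      have "0 \<le> (- d / N)\<^sup>2 * N + 2 * (- d / N) * d" using q[of "- d / N"] by (simp add: N_def)
      also have "\<dots> = - (d\<^sup>2 / N)" using N by (simp add: power2_eq_square field_simps)
      finally have "d\<^sup>2 / N \<le> 0" by simp
      then show ?thesis using N by (simp add: divide_le_0_iff)
    qed
    then show ?thesis by (simp add: d_def)
  qed
  have "\<phi> x = cinner x z" for x
  proof (rule complex_eqI[OF re])
    show "Im (\<phi> x) = Im (cinner x z)" using re[of "\<i> *\<^sub>C x"] by (simp add: C cinner_simps)
  qed
  then show ?thesis by blast
qed

lemma blinfun_cinner_eqI:
  fixes S T :: "'a::real_normed_vector \<Rightarrow>\<^sub>L 'b::complex_inner_space"
  assumes "\<And>x y. cinner y (S x) = cinner y (T x)"
  shows "S = T"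
  by (rule blinfun_eqI, rule cinner_eqI, rule assms)

lemma hadjoint_exists:
  fixes T :: "'a::chilbert_space \<Rightarrow>\<^sub>L 'b::chilbert_space"
  assumes T: "complex_linear T"
  shows "\<exists>S :: 'b \<Rightarrow>\<^sub>L 'a. \<forall>x y. cinner (T x) y = cinner x (S y)"
proof -
  have "\<exists>z. \<forall>x. cinner (T x) y = cinner x z" for y
  proof (rule Riesz_representation)
    show "bounded_linear (\<lambda>x. cinner (T x) y)"
      by (rule bounded_linear_compose[OF bounded_linear_cinner_left blinfun.bounded_linear_right])
    show "cinner (T (c *\<^sub>C x)) y = c * cinner (T x) y" for c x
      using T by (simp add: complex_linear_def cinner_simps)
  qed
  then obtain s where s: "\<And>x y. cinner (T x) y = cinner x (s y)" by metis
  have "bounded_linear s"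
  proof (rule bounded_linear_intro[of _ "norm T"])
    show "s (x + y) = s x + s y" for x y
      by (rule cinner_eqI) (simp add: cinner_add_right flip: s)
    show "s (r *\<^sub>R x) = r *\<^sub>R s x" for r x
      by (rule cinner_eqI) (simp add: cinner_scaleR_right flip: s)
    show "norm (s y) \<le> norm y * norm T" for y
    proof (cases "s y = 0")
      case False
      have "(norm (s y))\<^sup>2 = Re (cinner (T (s y)) y)" unfolding s by (rule Re_cinner_self[symmetric])
      also have "\<dots> \<le> norm (T (s y)) * norm y" using Re_cinner_le[of "T (s y)" y] by linarith
      also have "\<dots> \<le> (norm T * norm (s y)) * norm y" by (intro mult_right_mono norm_blinfun) simp
      finally have "norm (s y) * norm (s y) \<le> norm (s y) * (norm y * norm T)"
        by (simp add: power2_eq_square mult_ac)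
      then show ?thesis using False by simp
    qed simp
  qed
  then show ?thesis using s by (intro exI[of _ "Blinfun s"]) (simp add: bounded_linear_Blinfun_apply)
qed

lemma cinner_hadjoint:
  fixes T :: "'a::chilbert_space \<Rightarrow>\<^sub>L 'b::chilbert_space"
  assumes "complex_linear T"
  shows "cinner x (hadjoint T y) = cinner (T x) y"
proof -
  have "\<exists>!S :: 'b \<Rightarrow>\<^sub>L 'a. \<forall>x y. cinner (T x) y = cinner x (S y)"
  proof (rule ex_ex1I[OF hadjoint_exists[OF assms]])
    fix S S' :: "'b \<Rightarrow>\<^sub>L 'a"
    assume "\<forall>x y. cinner (T x) y = cinner x (S y)" "\<forall>x y. cinner (T x) y = cinner x (S' y)"
    then show "S = S'" by - (rule blinfun_cinner_eqI, simp)
  qed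
  then have "\<forall>x y. cinner (T x) y = cinner x (hadjoint T y)" unfolding hadjoint_def by (rule theI')
  then show ?thesis by metis
qed

lemma cinner_hadjoint_left:
  fixes T :: "'a::chilbert_space \<Rightarrow>\<^sub>L 'b::chilbert_space"
  assumes "complex_linear T"
  shows "cinner (hadjoint T y) x = cinner y (T x)"
  by (metis assms cinner_commute cinner_hadjoint)

lemma hadjoint_eqI:
  fixes T :: "'a::chilbert_space \<Rightarrow>\<^sub>L 'b::chilbert_space" and S :: "'b \<Rightarrow>\<^sub>L 'a"
  assumes "complex_linear T" "\<And>x y. cinner (T x) y = cinner x (S y)"
  shows "hadjoint T = S"
  by (rule blinfun_cinner_eqI) (simp add: assms cinner_hadjoint)

lemma complex_linearD: "complex_linear T \<Longrightarrow> T (c *\<^sub>C x) = c *\<^sub>C T x"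
  by (simp add: complex_linear_def)

lemma complex_linear_add: "complex_linear S \<Longrightarrow> complex_linear T \<Longrightarrow> complex_linear (S + T)"
  by (simp add: complex_linear_def blinfun.add_left scaleC_add_right)

lemma complex_linear_diff: "complex_linear S \<Longrightarrow> complex_linear T \<Longrightarrow> complex_linear (S - T)"
  by (simp add: complex_linear_def blinfun.diff_left scaleC_diff_right)

lemma complex_linear_minus: "complex_linear T \<Longrightarrow> complex_linear (- T)"
  by (simp add: complex_linear_def blinfun.minus_left scaleC_minus_right)

lemma complex_linear_compose: "complex_linear S \<Longrightarrow> complex_linear T \<Longrightarrow> complex_linear (S o\<^sub>L T)"
  by (simp add: complex_linear_def)

lemma complex_linear_id: "complex_linear id_blinfun"
  by (simp add: complex_linear_def)

lemma complex_linear_hadjoint: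
  fixes T :: "'a::chilbert_space \<Rightarrow>\<^sub>L 'b::chilbert_space"
  assumes "complex_linear T"
  shows "complex_linear (hadjoint T)"
  unfolding complex_linear_def
  by (rule allI, rule allI, rule cinner_eqI) (simp add: cinner_simps cinner_hadjoint assms)

lemmas complex_linear_intros = complex_linear_add complex_linear_diff complex_linear_minus
  complex_linear_compose complex_linear_id complex_linear_hadjoint

lemma hadjoint_hadjoint [simp]:
  fixes T :: "'a::chilbert_space \<Rightarrow>\<^sub>L 'b::chilbert_space"
  assumes "complex_linear T"
  shows "hadjoint (hadjoint T) = T"
  by (rule hadjoint_eqI) (simp_all add: assms complex_linear_hadjoint cinner_hadjoint_left)

lemma hadjoint_add:
  fixes S T :: "'a::chilbert_space \<Rightarrow>\<^sub>L 'b::chilbert_space"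
  assumes "complex_linear S" "complex_linear T"
  shows "hadjoint (S + T) = hadjoint S + hadjoint T"
  by (rule hadjoint_eqI)
    (simp_all add: assms complex_linear_add blinfun.add_left cinner_simps cinner_hadjoint)

lemma hadjoint_diff:
  fixes S T :: "'a::chilbert_space \<Rightarrow>\<^sub>L 'b::chilbert_space"
  assumes "complex_linear S" "complex_linear T"
  shows "hadjoint (S - T) = hadjoint S - hadjoint T"
  by (rule hadjoint_eqI)
    (simp_all add: assms complex_linear_diff blinfun.diff_left cinner_simps cinner_hadjoint)

lemma hadjoint_minus:
  fixes T :: "'a::chilbert_space \<Rightarrow>\<^sub>L 'b::chilbert_space"
  assumes "complex_linear T"
  shows "hadjoint (- T) = - hadjoint T"
  by (rule hadjoint_eqI)
    (simp_all add: assms complex_linear_minus blinfun.minus_left cinner_simps cinner_hadjoint)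

lemma hadjoint_compose:
  fixes S :: "'b::chilbert_space \<Rightarrow>\<^sub>L 'c::chilbert_space"
    and T :: "'a::chilbert_space \<Rightarrow>\<^sub>L 'b::chilbert_space"
  assumes "complex_linear S" "complex_linear T"
  shows "hadjoint (S o\<^sub>L T) = hadjoint T o\<^sub>L hadjoint S"
  by (rule hadjoint_eqI) (simp_all add: assms complex_linear_compose cinner_hadjoint)

lemma norm_hadjoint_normal:
  fixes T :: "'a::chilbert_space \<Rightarrow>\<^sub>L 'a"
  assumes "normal_op T"
  shows "norm (hadjoint T x) = norm (T x)"
proof -
  have c: "complex_linear T" and n: "hadjoint T o\<^sub>L T = T o\<^sub>L hadjoint T"
    using assms by (auto simp: normal_op_def)
  have "(norm (hadjoint T x))\<^sup>2 = Re (cinner (T (hadjoint T x)) x)"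
    unfolding Re_cinner_self[symmetric] by (simp add: cinner_hadjoint c)
  also have "T (hadjoint T x) = hadjoint T (T x)"
    by (metis n blinfun_apply_blinfun_compose)
  also have "Re (cinner (hadjoint T (T x)) x) = (norm (T x))\<^sup>2"
    unfolding Re_cinner_self[symmetric] by (simp add: cinner_hadjoint_left c)
  finally show ?thesis by (simp add: power2_eq_iff_nonneg)
qed

text \<open>Bounded linear maps form only a real vector space, so the complex multiples of the identity need
  a constant of their own.\<close>

lift_definition scalar_op :: "complex \<Rightarrow> 'a::complex_inner_space \<Rightarrow>\<^sub>L 'a" is "\<lambda>c x. c *\<^sub>C x"
  subgoal for c
    by (rule bounded_linear_intro[of _ "cmod c"])
      (simp_all add: scaleC_add_right scaleC_scaleR norm_scaleC)
  done

declare scalar_op.rep_eq [simp]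

lemma complex_linear_scalar_op: "complex_linear (scalar_op c)"
  by (simp add: complex_linear_def scaleC_scaleC mult.commute)

lemma hadjoint_scalar_op: "hadjoint (scalar_op c :: 'a::chilbert_space \<Rightarrow>\<^sub>L 'a) = scalar_op (cnj c)"
  by (rule hadjoint_eqI) (simp_all add: complex_linear_scalar_op cinner_simps)

lemma normal_op_diff_scalar:
  fixes T :: "'a::chilbert_space \<Rightarrow>\<^sub>L 'a"
  assumes "normal_op T"
  shows "normal_op (T - scalar_op c)"
proof -
  have c: "complex_linear T" and n: "hadjoint T o\<^sub>L T = T o\<^sub>L hadjoint T"
    using assms by (auto simp: normal_op_def)
  have n': "hadjoint T (T x) = T (hadjoint T x)" for x
    by (metis n blinfun_apply_blinfun_compose)
  show ?thesis unfolding normal_op_def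
    by (intro conjI blinfun_eqI)
      (simp_all add: c complex_linear_intros complex_linear_scalar_op hadjoint_diff
        hadjoint_scalar_op blinfun.diff_left blinfun.diff_right n' complex_linearD
        scaleC_diff_right scaleC_scaleC mult.commute)
qed

section \<open>Fuglede's theorem\<close>

text \<open>The operators on \<open>'a \<oplus> \<complex>\<close> as a unital Banach algebra. The summand \<open>\<complex>\<close> keeps the space
  nonzero, so that the identity has norm one and the exponential series becomes available.\<close>

typedef (overloaded) 'a aug_op =
  "UNIV :: (('a::chilbert_space \<times> complex) \<Rightarrow>\<^sub>L ('a \<times> complex)) set"
  morphisms aug_rep Aug by simp

setup_lifting type_definition_aug_op

instantiation aug_op :: (chilbert_space) real_normed_algebra_1
begin

lift_definition zero_aug_op :: "'a aug_op" is 0 .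
lift_definition one_aug_op :: "'a aug_op" is id_blinfun .
lift_definition plus_aug_op :: "'a aug_op \<Rightarrow> 'a aug_op \<Rightarrow> 'a aug_op" is "(+)" .
lift_definition minus_aug_op :: "'a aug_op \<Rightarrow> 'a aug_op \<Rightarrow> 'a aug_op" is "(-)" .
lift_definition uminus_aug_op :: "'a aug_op \<Rightarrow> 'a aug_op" is "uminus" .
lift_definition times_aug_op :: "'a aug_op \<Rightarrow> 'a aug_op \<Rightarrow> 'a aug_op" is "(o\<^sub>L)" .
lift_definition scaleR_aug_op :: "real \<Rightarrow> 'a aug_op \<Rightarrow> 'a aug_op" is "scaleR" .
lift_definition norm_aug_op :: "'a aug_op \<Rightarrow> real" is "norm" .

definition sgn_aug_op :: "'a aug_op \<Rightarrow> 'a aug_op" where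
  "sgn_aug_op x = scaleR (inverse (norm x)) x"
definition dist_aug_op :: "'a aug_op \<Rightarrow> 'a aug_op \<Rightarrow> real" where "dist_aug_op x y = norm (x - y)"
definition uniformity_aug_op :: "('a aug_op \<times> 'a aug_op) filter" where
  [code del]: "uniformity_aug_op = (INF e\<in>{0 <..}. principal {(x, y). dist x y < e})"
definition open_aug_op :: "'a aug_op set \<Rightarrow> bool" where
  [code del]: "open_aug_op S = (\<forall>x\<in>S. \<forall>\<^sub>F (x', y) in uniformity. x' = x \<longrightarrow> y \<in> S)"

instance
proof
  fix x y z :: "'a aug_op" and a b :: real
  show "x + y + z = x + (y + z)" "x + y = y + x" "0 + x = x" "- x + x = 0" "x - y = x + - y"
    "a *\<^sub>R (x + y) = a *\<^sub>R x + a *\<^sub>R y" "(a + b) *\<^sub>R x = a *\<^sub>R x + b *\<^sub>R x"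
    "a *\<^sub>R b *\<^sub>R x = (a * b) *\<^sub>R x" "1 *\<^sub>R x = x"
    by (transfer; simp add: algebra_simps)+
  show "x * y * z = x * (y * z)" "1 * x = x" "x * 1 = x"
    by (transfer; rule blinfun_eqI; simp)+
  show "(x + y) * z = x * z + y * z" "x * (y + z) = x * y + x * z"
    "a *\<^sub>R x * y = a *\<^sub>R (x * y)" "x * a *\<^sub>R y = a *\<^sub>R (x * y)"
    by (transfer; rule blinfun_eqI; simp add: blinfun.bilinear_simps)+
  have one: "norm (1 :: 'a aug_op) = 1"
  proof transfer
    show "norm (id_blinfun :: ('a \<times> complex) \<Rightarrow>\<^sub>L ('a \<times> complex)) = 1"
    proof (rule antisym)
      show "norm (id_blinfun :: ('a \<times> complex) \<Rightarrow>\<^sub>L ('a \<times> complex)) \<le> 1"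
        by (rule norm_blinfun_bound) simp_all
      show "1 \<le> norm (id_blinfun :: ('a \<times> complex) \<Rightarrow>\<^sub>L ('a \<times> complex))"
        using norm_blinfun[of id_blinfun "(0 :: 'a, 1 :: complex)"] by (simp add: norm_prod_def)
    qed
  qed
  show "norm (1 :: 'a aug_op) = 1" by (rule one)
  have "norm (0 :: 'a aug_op) = 0" by transfer simp
  with one show "(0 :: 'a aug_op) \<noteq> 1" by force
  show "norm (x + y) \<le> norm x + norm y" by transfer (rule norm_triangle_ineq)
  show "norm (x * y) \<le> norm x * norm y" by transfer (rule norm_blinfun_compose)
  show "norm (a *\<^sub>R x) = \<bar>a\<bar> * norm x" by transfer simp
  show "(norm x = 0) = (x = 0)" by transfer simp
qed (simp_all add: sgn_aug_op_def dist_aug_op_def uniformity_aug_op_def open_aug_op_def)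

end

instance aug_op :: (chilbert_space) banach
proof
  fix X :: "nat \<Rightarrow> 'a aug_op"
  assume X: "Cauchy X"
  have d: "norm (aug_rep x - aug_rep y) = norm (x - y)" for x y :: "'a aug_op" by transfer simp
  have "Cauchy (\<lambda>n. aug_rep (X n))" using X unfolding Cauchy_def dist_norm d .
  then obtain L where L: "(\<lambda>n. aug_rep (X n)) \<longlonglongrightarrow> L" by (metis Cauchy_convergent_iff convergent_def)
  have "X \<longlonglongrightarrow> Aug L"
    using L unfolding lim_sequentially dist_norm by (simp add: Aug_inverse flip: d)
  then show "convergent X" by (rule convergentI)
qed

lemma exp_mult_commute:
  fixes x y :: "'b::{real_normed_algebra_1,banach}"
  assumes "x * y = y * x"
  shows "exp x * y = y * exp x"
proof -
  have "x ^ n * y = y * x ^ n" for n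
    using assms by (metis power_commuting_commutes)
  then have "(\<lambda>n. (x ^ n /\<^sub>R fact n) * y) = (\<lambda>n. y * (x ^ n /\<^sub>R fact n))" by simp
  moreover have "(\<lambda>n. (x ^ n /\<^sub>R fact n) * y) sums (exp x * y)"
    by (rule bounded_linear.sums[OF bounded_linear_mult_left exp_converges])
  moreover have "(\<lambda>n. y * (x ^ n /\<^sub>R fact n)) sums (y * exp x)"
    by (rule bounded_linear.sums[OF bounded_linear_mult_right exp_converges])
  ultimately show ?thesis by (simp add: sums_unique2)
qed

lemma norm_exp_minus_linear_le:
  fixes x :: "'b::{real_normed_algebra_1,banach}"
  assumes "norm x \<le> 1"
  shows "norm (exp x - 1 - x) \<le> (norm x)\<^sup>2"
proof -
  have s: "summable (\<lambda>n. inverse (fact (n + 2)) *\<^sub>R norm x ^ (n + 2))"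
    using summable_exp_generic[of "norm x"] by (subst summable_iff_shift) (simp add: field_simps)
  have "norm (exp x - 1 - x) = norm (\<Sum>n. inverse (fact (n + 2)) *\<^sub>R x ^ (n + 2))"
    by (subst exp_first_two_terms) simp
  also have "\<dots> \<le> (\<Sum>n. inverse (fact (n + 2)) *\<^sub>R norm x ^ (n + 2))"
  proof (rule norm_suminf_le[OF _ s])
    fix n
    show "norm (inverse (fact (n + 2)) *\<^sub>R x ^ (n + 2)) \<le> inverse (fact (n + 2)) *\<^sub>R norm x ^ (n + 2)"
      using norm_power_ineq[of x "n + 2"] by (simp add: divide_right_mono field_simps)
  qed
  also have "\<dots> = exp (norm x) - 1 - norm x" using exp_first_two_terms[of "norm x"] by simp
  also have "\<dots> \<le> (norm x)\<^sup>2" using exp_bound[of "norm x"] assms by simp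
  finally show ?thesis .
qed

lemma mult_commute_left:
  fixes a m b :: "'b::semigroup_mult"
  assumes "a * b = b * a" "m * b = b * m"
  shows "(a * m) * b = b * (a * m)"
  using assms by (metis mult.assoc)

lemma mult_commute_products:
  fixes a m b n :: "'b::semigroup_mult"
  assumes "a * b = b * a" "a * n = n * a" "m * b = b * m" "m * n = n * m"
  shows "(a * m) * (b * n) = (b * n) * (a * m)"
  using mult_commute_left[of a "b * n" m] mult_commute_left[of b a n] mult_commute_left[of b m n]
    assms by simp

definition aug_adjoint :: "'a::chilbert_space aug_op \<Rightarrow> 'a aug_op \<Rightarrow> bool" where
  "aug_adjoint X Y \<longleftrightarrow> (\<forall>p q. cinner (aug_rep X p) q = cinner p (aug_rep Y q))"

lemma aug_adjointI:
  "(\<And>p q. cinner (aug_rep X p) q = cinner p (aug_rep Y q)) \<Longrightarrow> aug_adjoint X Y"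
  unfolding aug_adjoint_def by blast

lemma aug_adjointD: "aug_adjoint X Y \<Longrightarrow> cinner (aug_rep X p) q = cinner p (aug_rep Y q)"
  unfolding aug_adjoint_def by blast

lemma aug_adjoint_mult:
  "aug_adjoint X Y \<Longrightarrow> aug_adjoint X' Y' \<Longrightarrow> aug_adjoint (X * X') (Y' * Y)"
  by (rule aug_adjointI) (simp add: times_aug_op.rep_eq aug_adjointD)

lemma aug_adjoint_power: "aug_adjoint X Y \<Longrightarrow> aug_adjoint (X ^ n) (Y ^ n)"
proof (induction n)
  case 0 then show ?case by (intro aug_adjointI) (simp add: one_aug_op.rep_eq)
next
  case (Suc n)
  then show ?case using aug_adjoint_mult[of X Y "X ^ n" "Y ^ n"] by (simp flip: power_Suc2)
qed

lemma bounded_linear_aug_apply: "bounded_linear (\<lambda>X. aug_rep X p)"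
proof (rule bounded_linear_intro[of _ "norm p"])
  show "norm (aug_rep X p) \<le> norm X * norm p" for X :: "'a aug_op"
    by transfer (rule norm_blinfun)
qed (transfer; simp add: blinfun.add_left blinfun.scaleR_left)+

lemma aug_adjoint_exp:
  assumes "aug_adjoint X Y"
  shows "aug_adjoint (exp X) (exp Y)"
proof (rule aug_adjointI)
  fix p q
  have "(\<lambda>n. cinner (aug_rep (X ^ n /\<^sub>R fact n) p) q) sums cinner (aug_rep (exp X) p) q"
    by (intro bounded_linear.sums[OF bounded_linear_cinner_left]
        bounded_linear.sums[OF bounded_linear_aug_apply] exp_converges)
  moreover have "(\<lambda>n. cinner p (aug_rep (Y ^ n /\<^sub>R fact n) q)) sums cinner p (aug_rep (exp Y) q)"
    by (intro bounded_linear.sums[OF bounded_linear_cinner_right]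
        bounded_linear.sums[OF bounded_linear_aug_apply] exp_converges)
  moreover have "(\<lambda>n. cinner (aug_rep (X ^ n /\<^sub>R fact n) p) q)
      = (\<lambda>n. cinner p (aug_rep (Y ^ n /\<^sub>R fact n) q))"
    by (simp add: aug_adjointD[OF aug_adjoint_power[OF assms]] scaleR_aug_op.rep_eq blinfun.scaleR_left cinner_simps)
  ultimately show "cinner (aug_rep (exp X) p) q = cinner p (aug_rep (exp Y) q)"
    using sums_unique2 by simp
qed

text \<open>The exponential of a skew-adjoint element is unitary.\<close>

lemma norm_exp_skew_le_one:
  assumes "aug_adjoint Z (- Z)"
  shows "norm (exp Z) \<le> 1"
proof -
  have "norm (aug_rep (exp Z) p) = norm p" for p
  proof -
    have "cinner (aug_rep (exp Z) p) (aug_rep (exp Z) p) = cinner p (aug_rep (exp (- Z) * exp Z) p)"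
      by (subst aug_adjointD[OF aug_adjoint_exp[OF assms]]) (simp add: times_aug_op.rep_eq)
    also have "exp (- Z) * exp Z = 1" using exp_minus_inverse[of "- Z"] by simp
    finally have "(norm (aug_rep (exp Z) p))\<^sup>2 = (norm p)\<^sup>2"
      unfolding Re_cinner_self[symmetric] by (simp add: one_aug_op.rep_eq)
    then show ?thesis by (simp add: power2_eq_iff_nonneg)
  qed
  then show ?thesis unfolding norm_aug_op.rep_eq by (intro norm_blinfun_bound) simp_all
qed

lift_definition aug_scalar :: "complex \<Rightarrow> 'a::chilbert_space aug_op" is scalar_op .

lemma bounded_linear_aug_scalar: "bounded_linear (aug_scalar :: complex \<Rightarrow> 'a::chilbert_space aug_op)"
proof (rule bounded_linear_intro[of _ 1])
  show "aug_scalar (x + y) = aug_scalar x + (aug_scalar y :: 'a aug_op)" for x y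
    by transfer (rule blinfun_eqI, simp add: scaleC_add_left blinfun.add_left)
  show "aug_scalar (r *\<^sub>R x) = r *\<^sub>R (aug_scalar x :: 'a aug_op)" for r x
    by transfer (rule blinfun_eqI,
      simp add: blinfun.scaleR_left scaleR_conv_of_real flip: scaleC_of_real scaleC_scaleC)
  show "norm (aug_scalar x :: 'a aug_op) \<le> norm x * 1" for x
    by transfer (rule norm_blinfun_bound, simp_all add: norm_scaleC)
qed

lift_definition aug :: "('a::chilbert_space \<Rightarrow>\<^sub>L 'a) \<Rightarrow> 'a aug_op" is
  "\<lambda>A. Blinfun (\<lambda>p. (A (fst p), 0))" .

lemma aug_rep_aug [simp]:
  fixes A :: "'a::chilbert_space \<Rightarrow>\<^sub>L 'a"
  shows "aug_rep (aug A) p = (A (fst p), 0)"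
proof -
  have "bounded_linear (\<lambda>p :: 'a \<times> complex. (A (fst p), 0 :: complex))"
    by (intro bounded_linear_Pair bounded_linear_zero
        bounded_linear_compose[OF blinfun.bounded_linear_right bounded_linear_fst])
  then show ?thesis by (simp add: aug.rep_eq bounded_linear_Blinfun_apply)
qed

lemma aug_op_eqI: "(\<And>p. aug_rep X p = aug_rep Y p) \<Longrightarrow> X = Y"
  by transfer (rule blinfun_eqI)

text \<open>Rosenblum's argument. With \<open>N\<close> normal and \<open>T N = N T\<close>, the entire function
  \<open>z \<mapsto> exp (z N\<^sup>*) T exp (- z N\<^sup>*)\<close> equals \<open>U T U\<^sup>-\<^sup>1\<close> for the unitary \<open>U = exp (z N\<^sup>* - cnj z N)\<close>, because
  \<open>T\<close> commutes with \<open>exp (cnj z N)\<close>. It is therefore bounded, hence constant, and its derivative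
  \<open>N\<^sup>* T - T N\<^sup>*\<close> at \<open>0\<close> vanishes.\<close>

theorem Fuglede:
  fixes N T :: "'a::chilbert_space \<Rightarrow>\<^sub>L 'a"
  assumes N: "normal_op N" and T: "complex_linear T" and NT: "N o\<^sub>L T = T o\<^sub>L N"
  shows "hadjoint N o\<^sub>L T = T o\<^sub>L hadjoint N"
proof -
  have cN: "complex_linear N" and nN: "hadjoint N o\<^sub>L N = N o\<^sub>L hadjoint N"
    using N by (auto simp: normal_op_def)
  define n m t where "n = aug N" and "m = aug (hadjoint N)" and "t = aug T"
  have cmul: "aug_scalar c * aug A = aug A * aug_scalar c" if "complex_linear A" for c A
    by (rule aug_op_eqI)
      (simp add: times_aug_op.rep_eq aug_scalar.rep_eq scaleC_prod_def complex_linearD[OF that])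
  have cc: "aug_scalar c * n = n * aug_scalar c" "aug_scalar c * m = m * aug_scalar c"
    "aug_scalar c * t = t * aug_scalar c" for c
    unfolding n_def m_def t_def by (simp_all add: cmul cN T complex_linear_hadjoint)
  have scsc: "aug_scalar c * aug_scalar d = aug_scalar d * (aug_scalar c :: 'a aug_op)" for c d
    by (rule aug_op_eqI) (simp add: times_aug_op.rep_eq aug_scalar.rep_eq scaleC_scaleC mult.commute)
  have augc: "aug A * aug B = aug B * aug A" if "A o\<^sub>L B = B o\<^sub>L A" for A B :: "'a \<Rightarrow>\<^sub>L 'a"
    by (rule aug_op_eqI) (use that in \<open>simp add: times_aug_op.rep_eq\<close>,
      metis blinfun_apply_blinfun_compose)
  have mn: "m * n = n * m" and nt: "n * t = t * n"
    unfolding n_def m_def t_def by (rule augc[OF nN], rule augc[OF NT])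
  define L where "L h = aug_scalar h * m" for h
  define u where "u z = exp (L z) * t * exp (- L z)" for z
  have bL: "bounded_linear L" unfolding L_def
    by (rule bounded_linear_compose[OF bounded_linear_mult_left bounded_linear_aug_scalar])
  interpret L: bounded_linear L by (rule bL)
  have LL: "L h * L k = L k * L h" for h k
    unfolding L_def by (rule mult_commute_products) (simp_all add: cc scsc)
  have bound: "norm (u z) \<le> norm t" for z
  proof -
    define W where "W = aug_scalar (cnj z) * n"
    define Z where "Z = L z - W"
    have "W * t = t * W" unfolding W_def by (rule mult_commute_left[OF cc(3) nt])
    then have "exp (- W) * t = t * exp (- W)" by (intro exp_mult_commute) simp
    then have t: "exp (- W) * t * exp W = t"
      using exp_minus_inverse[of "- W"] by (simp add: mult.assoc)
    have LW: "L z * W = W * L z" unfolding L_def W_def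
      by (rule mult_commute_products) (simp_all add: cc scsc mn)
    have e1: "exp Z = exp (L z) * exp (- W)"
      unfolding Z_def using exp_add_commuting[of "L z" "- W"] LW by simp
    have e2: "exp (- Z) = exp W * exp (- L z)"
      unfolding Z_def using exp_add_commuting[of W "- L z"] LW by simp
    have "exp Z * t * exp (- Z) = exp (L z) * (exp (- W) * t * exp W) * exp (- L z)"
      unfolding e1 e2 by (simp add: mult.assoc)
    then have uZ: "u z = exp Z * t * exp (- Z)" unfolding u_def t by simp
    have skew: "aug_adjoint Z (- Z)"
      unfolding Z_def L_def W_def n_def m_def
      by (intro aug_adjointI) (simp add: minus_aug_op.rep_eq uminus_aug_op.rep_eq times_aug_op.rep_eq aug_scalar.rep_eq
          blinfun.diff_left blinfun.minus_left cinner_simps scaleC_prod_def cinner_prod_def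
          cinner_hadjoint cinner_hadjoint_left cN cinner_complex_def scaleC_complex_def)
    have skew': "aug_adjoint (- Z) (- (- Z))"
      using aug_adjointD[OF skew] by (intro aug_adjointI)
        (simp add: uminus_aug_op.rep_eq blinfun.minus_left cinner_simps)
    have "norm (u z) \<le> norm (exp Z) * norm t * norm (exp (- Z))"
      unfolding uZ by (meson norm_mult_ineq order_trans mult_right_mono norm_ge_zero)
    also have "\<dots> \<le> 1 * norm t * 1"
      by (intro mult_mono norm_exp_skew_le_one skew skew') auto
    finally show ?thesis by simp
  qed
  have der0: "((\<lambda>h. exp (L' h)) has_derivative L') (at 0)" if L': "bounded_linear L'"
    for L' :: "complex \<Rightarrow> 'a aug_op"
  proof -
    obtain K where K: "K > 0" "\<And>h. norm (L' h) \<le> norm h * K"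
      using bounded_linear.pos_bounded[OF L'] by blast
    have L0: "L' 0 = 0" using L' by (simp add: linear_simps)
    show ?thesis
    proof (rule has_derivativeI_sandwich[of "1 / K" _ _ _ _ "\<lambda>h. norm h * K\<^sup>2"])
      fix h :: complex assume h: "h \<noteq> 0" "dist h 0 < 1 / K"
      have "norm (L' h) \<le> 1" using K(2)[of h] h(2) K(1) by (simp add: field_simps)
      from norm_exp_minus_linear_le[OF this]
      have "norm (exp (L' h) - 1 - L' h) \<le> (norm h * K)\<^sup>2"
        using power_mono[OF K(2)[of h], of 2] by simp
      then have "norm (exp (L' h) - 1 - L' h) \<le> norm h * (norm h * K\<^sup>2)"
        by (simp add: power2_eq_square mult_ac)
      then show "norm (exp (L' h) - exp (L' 0) - L' (h - 0)) / norm (h - 0) \<le> norm h * K\<^sup>2"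
        using h(1) by (simp add: L0 pos_divide_le_eq mult_ac)
    next
      show "((\<lambda>h. norm h * K\<^sup>2) \<longlongrightarrow> 0) (at (0 :: complex))"
        by (rule tendsto_eq_intros refl | simp)+
    qed (use K L' in auto)
  qed
  have der: "(u has_derivative (\<lambda>h. L h * u z - u z * L h)) (at z)" for z
  proof -
    \<comment> \<open>A translation reduces the derivative at \<open>z\<close> to one at \<open>0\<close>.\<close>
    have shift: "u (z + h) = exp (L h) * u z * exp (- L h)" for h
    proof -
      have a: "exp (L (z + h)) = exp (L h) * exp (L z)"
        using exp_add_commuting[OF LL, of h z] by (simp add: L.add add.commute)
      have b: "exp (- L (z + h)) = exp (- L z) * exp (- L h)"
        using exp_add_commuting[of "- L z" "- L h"] LL[of z h] by (simp add: L.add)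
      show ?thesis unfolding u_def a b by (simp add: mult.assoc)
    qed
    have L0: "L 0 = 0" by simp
    have "((\<lambda>h. exp (L h) * u z * exp (- L h)) has_derivative (\<lambda>h. L h * u z - u z * L h)) (at 0)"
      by (rule has_derivative_eq_rhs,
          rule has_derivative_mult[OF has_derivative_mult[OF der0[OF bL] has_derivative_const]
            der0[OF bounded_linear_minus[OF bL]]])
        (simp add: fun_eq_iff)
    then have "((\<lambda>h. u (z + h)) has_derivative (\<lambda>h. L h * u z - u z * L h)) (at 0)"
      by (simp add: shift)
    then have d: "((\<lambda>h. u (z + h)) has_derivative (\<lambda>h. L h * u z - u z * L h)) (at (z - z))"
      by simp
    have "((\<lambda>w. w - z) has_derivative (\<lambda>h. h)) (at z)"
      by (auto intro!: derivative_eq_intros)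
    from has_derivative_compose[OF this d] show ?thesis by simp
  qed
  have us: "aug_scalar c * u z = u z * aug_scalar c" for c z
  proof -
    have "L z * aug_scalar c = aug_scalar c * L z" unfolding L_def
      by (rule mult_commute_left) (simp_all add: cc scsc)
    then have "exp (L z) * aug_scalar c = aug_scalar c * exp (L z)"
      "exp (- L z) * aug_scalar c = aug_scalar c * exp (- L z)"
      by (intro exp_mult_commute; simp)+
    then show ?thesis unfolding u_def by (metis cc(3) mult.assoc)
  qed
  have zero: "cinner (aug_rep (m * t - t * m) p) q = 0" for p q
  proof -
    define f where "f z = cinner (aug_rep (u z) p) q" for z
    define f' where "f' z = cinner (aug_rep (m * u z - u z * m) p) q" for z
    have "(f has_field_derivative f' z) (at z)" for z
    proof -
      have "(f has_derivative (\<lambda>h. cinner (aug_rep (L h * u z - u z * L h) p) q)) (at z)"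
        unfolding f_def
        by (intro bounded_linear.has_derivative[OF bounded_linear_cinner_left]
            bounded_linear.has_derivative[OF bounded_linear_aug_apply] der)
      moreover have "cinner (aug_rep (L h * u z - u z * L h) p) q = f' z * h" for h
      proof -
        have "L h * u z - u z * L h = aug_scalar h * (m * u z - u z * m)"
          unfolding L_def by (simp add: algebra_simps) (metis us mult.assoc)
        then show ?thesis
          by (simp add: f'_def times_aug_op.rep_eq aug_scalar.rep_eq cinner_simps)
      qed
      ultimately show ?thesis unfolding has_field_derivative_def by (simp add: fun_eq_iff)
    qed
    note fd = this
    then have "f holomorphic_on UNIV" by (auto simp: holomorphic_on_open)
    moreover have "bounded (range f)"
    proof (rule boundedI)
      fix y assume "y \<in> range f"
      then obtain z where "y = f z" by blast
      moreover have "norm (aug_rep (u z) p) \<le> norm (u z) * norm p"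
        by transfer (rule norm_blinfun)
      then have "norm (aug_rep (u z) p) \<le> norm t * norm p"
        using bound[of z] by (meson mult_right_mono norm_ge_zero order_trans)
      then have "norm (f z) \<le> norm t * norm p * norm q"
        unfolding f_def using Cauchy_Schwarz_cinner[of "aug_rep (u z) p" q]
        by (meson mult_right_mono norm_ge_zero order_trans)
      ultimately show "norm y \<le> norm t * norm p * norm q" by simp
    qed
    ultimately have "f constant_on UNIV" by (rule Liouville_theorem)
    then obtain c where "f = (\<lambda>_. c)" by (auto simp: constant_on_def)
    then have "(f has_field_derivative 0) (at 0)" by simp
    then have "f' 0 = 0" using fd[of 0] DERIV_unique by blast
    moreover have "u 0 = t" by (simp add: u_def)
    ultimately show ?thesis by (simp add: f'_def)
  qed
  show ?thesis
  proof (rule blinfun_cinner_eqI)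
    fix x y
    show "cinner y ((hadjoint N o\<^sub>L T) x) = cinner y ((T o\<^sub>L hadjoint N) x)"
      using zero[of "(x, 0)" "(y, 0)"]
      by (subst (1 2) cinner_commute)
        (simp add: m_def t_def minus_aug_op.rep_eq times_aug_op.rep_eq blinfun.diff_left
          cinner_prod_def cinner_simps)
  qed
qed

section \<open>Joint approximate eigenvectors\<close>

text \<open>For \<open>F = {T\<^sub>i - l\<^sub>i}\<close> this says that \<open>l\<close> lies in the joint approximate point spectrum of \<open>T\<close>.\<close>

definition approx_null :: "('a::real_normed_vector \<Rightarrow>\<^sub>L 'a) set \<Rightarrow> bool" where
  "approx_null F \<longleftrightarrow> (\<forall>e>0. \<exists>x. norm x = 1 \<and> (\<forall>E\<in>F. norm (E x) \<le> e))"

lemma approx_nullD: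
  "approx_null F \<Longrightarrow> e > 0 \<Longrightarrow> \<exists>x. norm x = 1 \<and> (\<forall>E\<in>F. norm (E x) \<le> e)"
  by (simp add: approx_null_def)

lemma approx_null_mono: "approx_null G \<Longrightarrow> F \<subseteq> G \<Longrightarrow> approx_null F"
  unfolding approx_null_def by (meson subsetD)

lemma norm_blinfun_approx_attained:
  fixes T :: "'a::real_normed_vector \<Rightarrow>\<^sub>L 'b::real_normed_vector"
  assumes "r < norm T" "0 \<le> r"
  shows "\<exists>x. norm x = 1 \<and> r < norm (T x)"
proof (rule ccontr)
  assume H: "\<not> ?thesis"
  have "norm T \<le> r"
  proof (rule norm_blinfun_bound[OF assms(2)])
    fix x
    show "norm (T x) \<le> r * norm x"
    proof (cases "x = 0")
      case False
      have "norm (T ((1 / norm x) *\<^sub>R x)) \<le> r" using H False by (auto simp: not_less)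
      then show ?thesis using False by (simp add: blinfun.scaleR_right field_simps)
    qed simp
  qed
  then show False using assms by simp
qed

text \<open>If \<open>x\<close> is a unit vector and \<open>\<parallel>T x\<parallel>\<close> is close to \<open>\<parallel>T\<parallel>\<close>, then expanding the square shows that
  \<open>\<parallel>T\<^sup>* T x - \<parallel>T\<parallel>\<^sup>2 x\<parallel>\<^sup>2\<close> is at most \<open>2 \<parallel>T\<parallel>\<^sup>2 (\<parallel>T\<parallel>\<^sup>2 - \<parallel>T x\<parallel>\<^sup>2)\<close>.\<close>

lemma approx_null_norm_square:
  fixes T :: "'a::chilbert_space \<Rightarrow>\<^sub>L 'a"
  assumes T: "complex_linear T" "T \<noteq> 0"
  shows "approx_null {(hadjoint T o\<^sub>L T) - scalar_op (of_real ((norm T)\<^sup>2))}"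
  unfolding approx_null_def
proof (intro allI impI)
  fix e :: real assume e: "e > 0"
  define m where "m = (norm T)\<^sup>2"
  define P where "P = hadjoint T o\<^sub>L T"
  have m: "m > 0" using T(2) by (simp add: m_def)
  have nh: "norm (hadjoint T y) \<le> norm T * norm y" for y
  proof (cases "hadjoint T y = 0")
    case False
    have "(norm (hadjoint T y))\<^sup>2 = Re (cinner (T (hadjoint T y)) y)"
      by (simp add: cinner_hadjoint T(1) flip: Re_cinner_self)
    also have "\<dots> \<le> norm (T (hadjoint T y)) * norm y"
      using Re_cinner_le[of "T (hadjoint T y)" y] by linarith
    also have "\<dots> \<le> (norm T * norm (hadjoint T y)) * norm y" by (intro mult_right_mono norm_blinfun) simp
    finally have "norm (hadjoint T y) * norm (hadjoint T y) \<le> norm (hadjoint T y) * (norm T * norm y)"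
      by (simp add: power2_eq_square mult_ac)
    then show ?thesis using False by simp
  qed simp
  \<comment> \<open>The value of \<open>\<parallel>T x\<parallel>\<close> for which the bound \<open>2 m (m - \<parallel>T x\<parallel>\<^sup>2)\<close> is \<open>e\<^sup>2\<close>.\<close>
  define r where "r = sqrt (max 0 (m - e\<^sup>2 / (2 * m)))"
  have "r < norm T"
    using m e unfolding r_def m_def by (intro real_less_lsqrt) auto
  then obtain x where x: "norm x = 1" "r < norm (T x)"
    using norm_blinfun_approx_attained[of r T] by (auto simp: r_def)
  have "r\<^sup>2 \<le> (norm (T x))\<^sup>2" using x(2) by (intro power_mono) (auto simp: r_def)
  then have r: "m - e\<^sup>2 / (2 * m) \<le> (norm (T x))\<^sup>2" by (simp add: r_def)
  have "norm (P x) \<le> norm T * norm (T x)" unfolding P_def using nh[of "T x"] by simp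
  also have "\<dots> \<le> norm T * norm T" using norm_blinfun[of T x] x(1) by (intro mult_left_mono) auto
  finally have "norm (P x) \<le> m" by (simp add: m_def power2_eq_square)
  then have P2: "(norm (P x))\<^sup>2 \<le> m\<^sup>2" by (intro power_mono) auto
  have c: "Re (cinner (P x) x) = (norm (T x))\<^sup>2"
    unfolding P_def by (simp add: cinner_hadjoint_left T(1) Re_cinner_self)
  have "(norm (P x - of_real m *\<^sub>C x))\<^sup>2 = (norm (P x))\<^sup>2 - 2 * (m * (norm (T x))\<^sup>2) + m\<^sup>2"
    unfolding norm_diff_square by (simp add: scaleC_of_real cinner_simps c x(1) power_mult_distrib)
  also have "\<dots> \<le> m\<^sup>2 - 2 * (m * (m - e\<^sup>2 / (2 * m))) + m\<^sup>2"
    using P2 mult_left_mono[OF r, of m] m by linarith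
  also have "\<dots> = e\<^sup>2" using m by (simp add: field_simps power2_eq_square)
  finally have "norm (P x - of_real m *\<^sub>C x) \<le> e" using e power2_le_imp_le by fastforce
  then show "\<exists>x. norm x = 1 \<and>
      (\<forall>E\<in>{(hadjoint T o\<^sub>L T) - scalar_op (of_real ((norm T)\<^sup>2))}. norm (E x) \<le> e)"
    using x(1) by (auto simp: P_def m_def blinfun.diff_left)
qed

text \<open>Let \<open>t\<close> be the limit, as \<open>\<epsilon> \<rightarrow> 0\<close>, of the supremum of \<open>\<langle>B x, x\<rangle>\<close> over the unit vectors \<open>x\<close> that
  are null for \<open>F\<close> up to \<open>\<epsilon>\<close>. The form of \<open>C = t - B\<close> is then almost nonnegative on such vectors,
  and they are almost preserved by \<open>1 - s C\<close>, as \<open>B\<close> commutes with \<open>F\<close>. For an almost maximal \<open>x\<close>,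
  nonnegativity of the form at \<open>x - s C x\<close> forces \<open>C x\<close> to be small, as in the proof of the
  Cauchy--Schwarz inequality.\<close>

lemma approx_null_extend:
  fixes B :: "'a::chilbert_space \<Rightarrow>\<^sub>L 'a"
  assumes F: "approx_null F" and B: "complex_linear B" "hadjoint B = B"
    and comm: "\<And>E. E \<in> F \<Longrightarrow> E o\<^sub>L B = B o\<^sub>L E"
  shows "\<exists>t::real. approx_null (insert (B - t *\<^sub>R id_blinfun) F)"
proof -
  define V where "V e = {x. norm x = 1 \<and> (\<forall>E\<in>F. norm (E x) \<le> e)}" for e
  define b where "b x = Re (cinner (B x) x)" for x
  define g where "g e = Sup (b ` V e)" for e
  define t where "t = Inf (g ` {0<..})"
  have Vne: "V e \<noteq> {}" if "e > 0" for e using approx_nullD[OF F that] by (auto simp: V_def)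
  have Vmono: "V d \<subseteq> V e" if "d \<le> e" for d e using that by (force simp: V_def)
  have babs: "\<bar>b x\<bar> \<le> norm B" if "norm x = 1" for x
    using Re_cinner_le[of "B x" x] norm_blinfun[of B x] that by (simp add: b_def)
  have bdd: "bdd_above (b ` V e)" for e
    using babs by (intro bdd_aboveI[of _ "norm B"]) (force simp: V_def)
  have ble: "b x \<le> g e" if "x \<in> V e" for x e
    unfolding g_def using that by (intro cSup_upper bdd) auto
  have gmono: "g d \<le> g e" if "d \<le> e" "d > 0" for d e
    unfolding g_def using that by (intro cSup_subset_mono bdd image_mono Vmono) (use Vne in auto)
  have gbelow: "- norm B \<le> g e" if e: "e > 0" for e
  proof -
    obtain x where x: "x \<in> V e" using Vne[OF e] by blast
    then show ?thesis using babs[of x] ble[OF x] by (auto simp: V_def)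
  qed
  have bddg: "bdd_below (g ` {0<..})" using gbelow by (intro bdd_belowI[of _ "- norm B"]) auto
  have tle: "t \<le> g e" if "e > 0" for e unfolding t_def using that by (intro cInf_lower bddg) auto
  define C where "C = t *\<^sub>R id_blinfun - B"
  have Cx: "C x = t *\<^sub>R x - B x" for x by (simp add: C_def blinfun.diff_left blinfun.scaleR_left)
  have Csym: "cinner (C x) y = cinner x (C y)" for x y
    using cinner_hadjoint[OF B(1), of x y] by (simp add: Cx cinner_simps B(2))
  define c where "c = norm C + 1"
  have c: "c > 0" by (simp add: c_def add_nonneg_pos)
  \<comment> \<open>Small enough that \<open>x - s C x\<close> has norm between \<open>1/2\<close> and \<open>3/2\<close> for unit vectors \<open>x\<close>.\<close>
  define s where "s = 1 / (2 * c)"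
  have s: "s > 0" using c by (simp add: s_def)
  have sC: "s * norm C \<le> 1 / 2" using c by (simp add: s_def c_def field_simps)
  have "\<exists>x. norm x = 1 \<and> (\<forall>E\<in>insert (B - t *\<^sub>R id_blinfun) F. norm (E x) \<le> e)" if e: "e > 0" for e
  proof -
    \<comment> \<open>The estimates below end in \<open>s \<parallel>C x\<parallel>\<^sup>2 \<le> 4 \<eta>\<close>, which is to give \<open>\<parallel>C x\<parallel> \<le> e\<close>.\<close>
    define \<eta> where "\<eta> = e\<^sup>2 / (8 * c)"
    have \<eta>: "\<eta> > 0" using e c by (simp add: \<eta>_def)
    have "Inf (g ` {0<..}) < t + \<eta>" using \<eta> by (simp add: t_def)
    then obtain d0 where d0: "d0 > 0" "g d0 < t + \<eta>"
      using cInf_lessD[of "g ` {0<..}" "t + \<eta>"] by auto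
    define d where "d = min d0 e"
    have d: "d > 0" "d \<le> e" "g d < t + \<eta>"
      using d0 e gmono[of d d0] by (auto simp: d_def)
    have "t - \<eta> < g (d / 3)" using tle[of "d / 3"] d(1) \<eta> by simp
    \<comment> \<open>Passing from \<open>x\<close> to the normalised \<open>x - s C x\<close> costs a factor of at most \<open>3\<close>.\<close>
    then obtain x where x: "x \<in> V (d / 3)" "t - \<eta> < b x"
      using less_cSupD[of "b ` V (d / 3)" "t - \<eta>"] Vne[of "d / 3"] d(1) unfolding g_def by auto
    have nx: "norm x = 1" using x(1) by (simp add: V_def)
    define q where "q = (norm (C x))\<^sup>2"
    define v where "v = x - s *\<^sub>R C x"
    have "norm (s *\<^sub>R C x) \<le> 1 / 2"
    proof -
      have "norm (s *\<^sub>R C x) \<le> s * (norm C * norm x)"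
        using s norm_blinfun[of C x] by (simp add: mult_left_mono)
      then show ?thesis using sC nx by simp
    qed
    then have v: "norm v \<ge> 1 / 2" "norm v \<le> 3 / 2"
      using norm_triangle_ineq2[of x "s *\<^sub>R C x"] norm_triangle_ineq4[of x "s *\<^sub>R C x"] nx
      unfolding v_def by linarith+
    then have v0: "norm v > 0" by linarith
    define w where "w = (1 / norm v) *\<^sub>R v"
    have "w \<in> V d"
      unfolding V_def
    proof (intro CollectI conjI ballI)
      show "norm w = 1" using v0 by (simp add: w_def)
      fix E assume E: "E \<in> F"
      have EC: "E (C x) = C (E x)"
        using comm[OF E] unfolding Cx
        by (simp add: blinfun.diff_right blinfun.scaleR_right) (metis blinfun_apply_blinfun_compose)
      have Ex: "norm (E x) \<le> d / 3" using x(1) E by (simp add: V_def)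
      have "norm (E v) \<le> norm (E x) + s * norm (C (E x))"
        unfolding v_def blinfun.diff_right blinfun.scaleR_right EC
        using norm_triangle_ineq4[of "E x" "s *\<^sub>R C (E x)"] s by simp
      also have "\<dots> \<le> norm (E x) + s * (norm C * norm (E x))"
        using s by (intro add_left_mono mult_left_mono norm_blinfun) auto
      also have "\<dots> \<le> norm (E x) + 1 / 2 * norm (E x)"
        using mult_right_mono[OF sC, of "norm (E x)"] by (simp add: mult_ac)
      also have "\<dots> \<le> d * (1 / 2)" using Ex by simp
      also have "\<dots> \<le> d * norm v" using v(1) d(1) by (intro mult_left_mono) auto
      finally show "norm (E w) \<le> d"
        using v0 by (simp add: w_def blinfun.scaleR_right field_simps)
    qed
    then have bw: "b w < t + \<eta>" using ble d(3) by fastforce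
    have "b w * (norm v)\<^sup>2 = b v"
      using v0 unfolding b_def w_def
      by (simp add: blinfun.scaleR_right cinner_simps power2_eq_square)
    moreover have "b w * (norm v)\<^sup>2 \<le> (t + \<eta>) * (norm v)\<^sup>2"
      using bw by (intro mult_right_mono) auto
    ultimately have "b v \<le> (t + \<eta>) * (norm v)\<^sup>2" by simp
    then have "- (\<eta> * (norm v)\<^sup>2) \<le> Re (cinner (C v) v)"
      by (simp add: Cx cinner_simps b_def Re_cinner_self algebra_simps)
    moreover have "\<eta> * (norm v)\<^sup>2 \<le> \<eta> * 3"
      using power_mono[OF v(2), of 2] \<eta> by (intro mult_left_mono) (auto simp: power2_eq_square)
    ultimately have lower: "- (3 * \<eta>) \<le> Re (cinner (C v) v)" by simp
    have "Re (cinner (C v) v) = Re (cinner (C x) x) - 2 * s * q + s\<^sup>2 * Re (cinner (C (C x)) (C x))"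
      unfolding v_def q_def Re_cinner_self[symmetric]
      by (simp add: blinfun.diff_right blinfun.scaleR_right cinner_simps power2_eq_square
          Csym[of x "C x", symmetric] Csym[of "C x" x] algebra_simps)
    moreover have "Re (cinner (C x) x) \<le> \<eta>"
      using x(2) by (simp add: Cx cinner_simps b_def Re_cinner_self nx)
    moreover have "s\<^sup>2 * Re (cinner (C (C x)) (C x)) \<le> s / 2 * q"
    proof -
      have "Re (cinner (C (C x)) (C x)) \<le> norm (C (C x)) * norm (C x)"
        using Re_cinner_le[of "C (C x)" "C x"] by linarith
      also have "\<dots> \<le> (norm C * norm (C x)) * norm (C x)"
        by (intro mult_right_mono norm_blinfun) simp
      finally have "Re (cinner (C (C x)) (C x)) \<le> norm C * q"
        by (simp add: q_def power2_eq_square mult_ac)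
      then have "s\<^sup>2 * Re (cinner (C (C x)) (C x)) \<le> s\<^sup>2 * (norm C * q)"
        by (intro mult_left_mono) auto
      also have "\<dots> = (s * norm C) * (s * q)" by (simp add: power2_eq_square)
      also have "\<dots> \<le> 1 / 2 * (s * q)" using s by (intro mult_right_mono sC) (auto simp: q_def)
      finally show ?thesis by simp
    qed
    ultimately have "- (3 * \<eta>) \<le> \<eta> - 2 * s * q + s / 2 * q" using lower by linarith
    moreover have "s * q \<ge> 0" using s by (simp add: q_def)
    ultimately have "s * q \<le> 4 * \<eta>" by (simp add: algebra_simps)
    then have "q \<le> e\<^sup>2" using c by (simp add: s_def \<eta>_def field_simps)
    then have "norm (C x) \<le> e" unfolding q_def using e power2_le_imp_le by fastforce
    then have "norm ((B - t *\<^sub>R id_blinfun) x) \<le> e"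
      by (simp add: Cx blinfun.diff_left blinfun.scaleR_left norm_minus_commute)
    moreover have "x \<in> V e" using x(1) Vmono[of "d / 3" e] d by auto
    ultimately show ?thesis by (auto simp: V_def)
  qed
  then show ?thesis unfolding approx_null_def by blast
qed

lemma commute_apply:
  fixes A B :: "'a::real_normed_vector \<Rightarrow>\<^sub>L 'a"
  assumes "A o\<^sub>L B = B o\<^sub>L A"
  shows "A (B x) = B (A x)"
  by (metis assms blinfun_apply_blinfun_compose)

lemma commute_hadjoint:
  fixes A B :: "'a::chilbert_space \<Rightarrow>\<^sub>L 'a"
  assumes "complex_linear A" "complex_linear B" "A o\<^sub>L B = B o\<^sub>L A"
  shows "hadjoint A o\<^sub>L hadjoint B = hadjoint B o\<^sub>L hadjoint A"
  by (metis assms hadjoint_compose)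

text \<open>Adjoin first \<open>N + N\<^sup>*\<close> and then \<open>- \<i> (N - N\<^sup>*)\<close>, which are twice the real and imaginary parts of \<open>N\<close>.\<close>

lemma approx_null_extend_normal:
  fixes N :: "'a::chilbert_space \<Rightarrow>\<^sub>L 'a"
  assumes F: "approx_null F" and N: "normal_op N"
    and lin: "\<And>E. E \<in> F \<Longrightarrow> complex_linear E"
    and comm: "\<And>E. E \<in> F \<Longrightarrow> E o\<^sub>L N = N o\<^sub>L E"
    and comm': "\<And>E. E \<in> F \<Longrightarrow> E o\<^sub>L hadjoint N = hadjoint N o\<^sub>L E"
  shows "\<exists>z. approx_null (insert (N - scalar_op z) F)"
proof -
  have cN: "complex_linear N" and nN: "hadjoint N (N x) = N (hadjoint N x)" for x
    using N by (auto simp: normal_op_def intro: commute_apply)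
  have chN: "complex_linear (hadjoint N)" by (rule complex_linear_hadjoint[OF cN])
  define A where "A = N + hadjoint N"
  define B where "B = scalar_op (-\<i>) o\<^sub>L (N - hadjoint N)"
  have cA: "complex_linear A" and cB: "complex_linear B"
    unfolding A_def B_def by (intro complex_linear_intros complex_linear_scalar_op cN)+
  have hA: "hadjoint A = A"
    unfolding A_def by (simp add: hadjoint_add cN chN add.commute)
  have hB: "hadjoint B = B"
    unfolding B_def
    by (simp add: hadjoint_compose hadjoint_diff complex_linear_scalar_op cN chN complex_linear_diff
        hadjoint_scalar_op)
      (rule blinfun_eqI, simp add: blinfun.diff_left complex_linearD[OF cN] complex_linearD[OF chN]
        scaleC_diff_right scaleC_minus_left)
  have Ec: "E (N x) = N (E x)" "E (hadjoint N x) = hadjoint N (E x)" "E (c *\<^sub>C x) = c *\<^sub>C E x"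
    if "E \<in> F" for E c x
    using comm[OF that] comm'[OF that] lin[OF that]
    by (auto intro: commute_apply complex_linearD)
  have EA: "E o\<^sub>L A = A o\<^sub>L E" if "E \<in> F" for E
    by (rule blinfun_eqI) (simp add: A_def blinfun.add_left blinfun.add_right Ec that)
  obtain t where t: "approx_null (insert (A - t *\<^sub>R id_blinfun) F)"
    using approx_null_extend[OF F cA hA EA] by blast
  have EB: "E o\<^sub>L B = B o\<^sub>L E" if "E \<in> insert (A - t *\<^sub>R id_blinfun) F" for E
  proof (rule blinfun_eqI)
    fix x
    show "(E o\<^sub>L B) x = (B o\<^sub>L E) x"
    proof (cases "E \<in> F")
      case True
      then show ?thesis by (simp add: B_def blinfun.diff_left blinfun.diff_right Ec)
    next
      case False
      with that have "E = A - t *\<^sub>R id_blinfun" by blast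
      then show ?thesis
        by (simp add: A_def B_def blinfun.bilinear_simps complex_linearD[OF cN]
            complex_linearD[OF chN] scaleC_diff_right scaleC_add_right scaleC_scaleR nN scaleR_diff_right)
    qed
  qed
  obtain u where u: "approx_null (insert (B - u *\<^sub>R id_blinfun) (insert (A - t *\<^sub>R id_blinfun) F))"
    using approx_null_extend[OF t cB hB EB] by blast
  define z where "z = (of_real t + \<i> * of_real u) / 2"
  have split: "norm ((N - scalar_op z) x)
      \<le> norm ((A - t *\<^sub>R id_blinfun) x) + norm ((B - u *\<^sub>R id_blinfun) x)" for x
  proof -
    have iB: "\<i> *\<^sub>C B x = N x - hadjoint N x"
      by (simp add: B_def blinfun.diff_left scaleC_scaleC scaleC_diff_right)
    have "2 *\<^sub>R (z *\<^sub>C x) = t *\<^sub>R x + \<i> *\<^sub>C (u *\<^sub>R x)"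
    proof -
      have "complex_of_real 2 * z = of_real t + \<i> * of_real u" by (simp add: z_def)
      then show ?thesis unfolding scaleC_of_real[symmetric] scaleC_scaleC scaleC_add_left[symmetric]
        by simp
    qed
    then have "2 *\<^sub>R (N - scalar_op z) x = (A - t *\<^sub>R id_blinfun) x + \<i> *\<^sub>C (B - u *\<^sub>R id_blinfun) x"
      by (simp add: A_def blinfun.bilinear_simps scaleC_diff_right iB scaleR_diff_right)
        (simp add: scaleR_2)
    then have "2 * norm ((N - scalar_op z) x)
        = norm ((A - t *\<^sub>R id_blinfun) x + \<i> *\<^sub>C (B - u *\<^sub>R id_blinfun) x)"
      by (metis abs_numeral norm_scaleR)
    also have "\<dots> \<le> norm ((A - t *\<^sub>R id_blinfun) x) + norm ((B - u *\<^sub>R id_blinfun) x)"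
      using norm_triangle_ineq[of "(A - t *\<^sub>R id_blinfun) x" "\<i> *\<^sub>C (B - u *\<^sub>R id_blinfun) x"]
      by (simp add: norm_scaleC)
    finally show ?thesis by (smt (verit) norm_ge_zero)
  qed
  have "approx_null (insert (N - scalar_op z) F)"
    unfolding approx_null_def
  proof (intro allI impI)
    fix e :: real assume "e > 0"
    then obtain x where x: "norm x = 1"
      "\<forall>E\<in>insert (B - u *\<^sub>R id_blinfun) (insert (A - t *\<^sub>R id_blinfun) F). norm (E x) \<le> e / 2"
      using approx_nullD[OF u, of "e / 2"] by auto
    have "norm ((N - scalar_op z) x) \<le> e" using split[of x] x(2) by simp
    moreover have "norm (E x) \<le> e" if "E \<in> F" for E
    proof -
      have "norm (E x) \<le> e / 2" using x(2) that by simp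
      then show ?thesis using \<open>e > 0\<close> by simp
    qed
    ultimately show "\<exists>x. norm x = 1 \<and> (\<forall>E\<in>insert (N - scalar_op z) F. norm (E x) \<le> e)"
      using x(1) by blast
  qed
  then show ?thesis by blast
qed

text \<open>Fuglede's theorem ensures that \<open>N\<^sub>i\<^sup>*\<close> commutes with the \<open>N\<^sub>j\<close> that have already been adjoined.\<close>

lemma approx_null_extend_tuple:
  fixes N :: "'n \<Rightarrow> 'a::chilbert_space \<Rightarrow>\<^sub>L 'a"
  assumes fin: "finite I" and F: "approx_null F"
    and normal: "\<And>i. normal_op (N i)"
    and comm: "\<And>i j. N i o\<^sub>L N j = N j o\<^sub>L N i"
    and lin: "\<And>E. E \<in> F \<Longrightarrow> complex_linear E"
    and commF: "\<And>E i. E \<in> F \<Longrightarrow> E o\<^sub>L N i = N i o\<^sub>L E"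
    and commF': "\<And>E i. E \<in> F \<Longrightarrow> E o\<^sub>L hadjoint (N i) = hadjoint (N i) o\<^sub>L E"
  shows "\<exists>l. approx_null (F \<union> (\<lambda>i. N i - scalar_op (l i)) ` I)"
  using fin
proof induction
  case empty then show ?case using F by simp
next
  case (insert i I)
  then obtain l where l: "approx_null (F \<union> (\<lambda>i. N i - scalar_op (l i)) ` I)" by blast
  have cN: "complex_linear (N j)" for j using normal by (simp add: normal_op_def)
  have star: "hadjoint (N i) o\<^sub>L N j = N j o\<^sub>L hadjoint (N i)" for i j
    by (rule Fuglede[OF normal cN comm])
  have ch: "complex_linear (hadjoint (N j))" for j by (rule complex_linear_hadjoint[OF cN])
  have "\<exists>z. approx_null (insert (N i - scalar_op z) (F \<union> (\<lambda>i. N i - scalar_op (l i)) ` I))"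
  proof (rule approx_null_extend_normal[OF l normal])
    fix E assume "E \<in> F \<union> (\<lambda>i. N i - scalar_op (l i)) ` I"
    then consider "E \<in> F" | j where "E = N j - scalar_op (l j)" by blast
    then have "complex_linear E \<and> E o\<^sub>L N i = N i o\<^sub>L E \<and>
      E o\<^sub>L hadjoint (N i) = hadjoint (N i) o\<^sub>L E"
    proof cases
      case 1
      then show ?thesis by (auto intro: lin commF commF')
    next
      case (2 j)
      show ?thesis unfolding 2
      proof (intro conjI)
        show "complex_linear (N j - scalar_op (l j))"
          by (intro complex_linear_diff cN complex_linear_scalar_op)
        show "(N j - scalar_op (l j)) o\<^sub>L N i = N i o\<^sub>L (N j - scalar_op (l j))"
          by (rule blinfun_eqI) (simp add: blinfun.diff_left blinfun.diff_right
              complex_linearD[OF cN] commute_apply[OF comm[of j i]])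
        show "(N j - scalar_op (l j)) o\<^sub>L hadjoint (N i) = hadjoint (N i) o\<^sub>L (N j - scalar_op (l j))"
          by (rule blinfun_eqI) (simp add: blinfun.diff_left blinfun.diff_right
              complex_linearD[OF ch] commute_apply[OF star[of i j]])
      qed
    qed
    then show "complex_linear E" "E o\<^sub>L N i = N i o\<^sub>L E"
      "E o\<^sub>L hadjoint (N i) = hadjoint (N i) o\<^sub>L E" by blast+
  qed
  then obtain z where z: "approx_null (insert (N i - scalar_op z) (F \<union> (\<lambda>i. N i - scalar_op (l i)) ` I))"
    by blast
  have "F \<union> (\<lambda>j. N j - scalar_op ((l(i := z)) j)) ` insert i I
      = insert (N i - scalar_op z) (F \<union> (\<lambda>i. N i - scalar_op (l i)) ` I)"
    using insert.hyps by auto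
  with z show ?case by metis
qed

section \<open>The Taylor spectrum of a commuting tuple of normal operators\<close>

text \<open>The signs are chosen inductively so that the partial sum up to \<open>k\<close> has a large component
  along \<open>x k\<close>, and the remaining terms are too small to spoil it. This gliding hump replaces the
  uniform boundedness principle.\<close>

lemma exists_slowly_orthogonal:
  fixes x :: "nat \<Rightarrow> 'a::chilbert_space"
  assumes x: "\<And>k. norm (x k) = 1"
  shows "\<exists>y. \<forall>k. (1 / 4) ^ k / 2 \<le> cmod (cinner y (x k))"
proof -
  define y where "y = rec_nat 0 (\<lambda>k v. if (1/4) ^ k \<le> cmod (cinner (v + (1/4) ^ k *\<^sub>R x k) (x k))
    then v + (1/4) ^ k *\<^sub>R x k else v - (1/4) ^ k *\<^sub>R x k)"
  define w where "w k = y (Suc k) - y k" for k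
  have ySuc: "y (Suc k) = (if (1/4) ^ k \<le> cmod (cinner (y k + (1/4) ^ k *\<^sub>R x k) (x k))
    then y k + (1/4) ^ k *\<^sub>R x k else y k - (1/4) ^ k *\<^sub>R x k)" for k
    by (simp add: y_def)
  have nw: "norm (w k) = (1/4) ^ k" for k by (simp add: w_def ySuc x)
  have big: "(1/4) ^ k \<le> cmod (cinner (y (Suc k)) (x k))" for k
  proof (cases "(1/4) ^ k \<le> cmod (cinner (y k + (1/4) ^ k *\<^sub>R x k) (x k))")
    case False
    define a where "a = cinner (y k) (x k)"
    define r :: real where "r = (1/4) ^ k"
    have i: "cinner (r *\<^sub>R x k) (x k) = of_real r" by (simp add: cinner_simps cinner_self x)
    have "cmod (a + of_real r) < r" using False by (simp add: cinner_simps(1) i a_def flip: r_def)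
    moreover have "cmod (2 * of_real r) \<le> cmod (a + of_real r) + cmod (a - of_real r)"
      using norm_triangle_ineq4[of "a + of_real r" "a - of_real r"] by simp
    moreover have "r \<ge> 0" by (simp add: r_def)
    ultimately have "r \<le> cmod (a - of_real r)" by (simp add: norm_mult)
    then show ?thesis using False by (simp add: ySuc cinner_simps(3) i a_def flip: r_def)
  qed (simp add: ySuc)
  have y0: "y 0 = 0" by (simp add: y_def)
  have ysum: "y k = (\<Sum>j<k. w j)" for k by (induction k) (simp_all add: y0 w_def)
  have gs: "summable (\<lambda>k. (1/4 :: real) ^ k)" by (rule summable_geometric) simp
  have ws: "summable w" by (rule summable_norm_cancel) (simp add: nw gs)
  define Y where "Y = suminf w"
  have "(1/4) ^ k / 2 \<le> cmod (cinner Y (x k))" for k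
  proof -
    have gs': "summable (\<lambda>j. (1/4 :: real) ^ (j + Suc k))" using gs by (subst summable_iff_shift)
    have "norm (Y - y (Suc k)) = norm (\<Sum>j. w (j + Suc k))"
      unfolding Y_def ysum using suminf_minus_initial_segment[OF ws, of "Suc k"] by simp
    also have "\<dots> \<le> (\<Sum>j. norm (w (j + Suc k)))"
      by (rule summable_norm) (simp only: nw gs')
    also have "\<dots> = (\<Sum>j. (1/4) ^ j * (1/4) ^ Suc k)" by (simp only: nw power_add)
    also have "\<dots> = (\<Sum>j. (1/4) ^ j) * (1/4) ^ Suc k" by (rule suminf_mult2[OF gs, symmetric])
    also have "\<dots> = (1/4) ^ k / 3" by (simp add: suminf_geometric)
    finally have "norm (Y - y (Suc k)) \<le> (1/4) ^ k / 3" .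
    then have "cmod (cinner (Y - y (Suc k)) (x k)) \<le> (1/4) ^ k / 3"
      using Cauchy_Schwarz_cinner[of "Y - y (Suc k)" "x k"] x by simp
    moreover have "cinner (y (Suc k)) (x k) = cinner Y (x k) - cinner (Y - y (Suc k)) (x k)"
      by (simp add: cinner_simps)
    then have "cmod (cinner (y (Suc k)) (x k))
        \<le> cmod (cinner Y (x k)) + cmod (cinner (Y - y (Suc k)) (x k))"
      by (metis norm_triangle_ineq4)
    moreover have "(0::real) \<le> (1/4) ^ k" by simp
    ultimately show ?thesis using big[of k] by linarith
  qed
  then show ?thesis by blast
qed

text \<open>This is exactness at the last stage of the complex, where every element is a cycle.\<close>

lemma koszul_exact_surjective:
  fixes A :: "'n::{finite,linorder} \<Rightarrow> 'a::real_normed_vector \<Rightarrow>\<^sub>L 'a"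
  assumes "koszul_exact (\<lambda>i. blinfun_apply (A i))"
  shows "\<exists>z. y = (\<Sum>i\<in>UNIV. A i (z i))"
proof -
  define \<xi> where "\<xi> S = (if S = UNIV then y else 0)" for S :: "'n set"
  have "koszul_map (\<lambda>i. blinfun_apply (A i)) \<xi> = (\<lambda>S. 0)"
  proof
    fix S :: "'n set"
    have "S - {i} \<noteq> UNIV" for i by blast
    then show "koszul_map (\<lambda>i. blinfun_apply (A i)) \<xi> S = 0"
      by (simp add: koszul_map_def \<xi>_def)
  qed
  then obtain \<zeta> where "\<xi> = koszul_map (\<lambda>i. blinfun_apply (A i)) \<zeta>"
    using assms unfolding koszul_exact_def by blast
  then have "y = koszul_map (\<lambda>i. blinfun_apply (A i)) \<zeta> UNIV"
    by (metis \<xi>_def)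
  also have "\<dots> = (\<Sum>i\<in>UNIV. A i ((-1) ^ card {j. j < i} *\<^sub>R \<zeta> (UNIV - {i})))"
    by (simp add: koszul_map_def blinfun.scaleR_right)
  finally show ?thesis
    by (intro exI[of _ "\<lambda>i. (-1) ^ card {j. j < i} *\<^sub>R \<zeta> (UNIV - {i})"])
qed

text \<open>Take approximate null vectors \<open>x k\<close> with defect \<open>16\<^sup>-\<^sup>k\<close>. Surjectivity writes any \<open>y\<close> as \<open>\<Sum>\<^sub>i A\<^sub>i z\<^sub>i\<close>, and
  moving \<open>A\<^sub>i\<close> to the other side, where normality allows replacing \<open>A\<^sub>i\<^sup>*\<close> by \<open>A\<^sub>i\<close> in norms, bounds
  \<open>\<bar>\<langle>y, x k\<rangle>\<bar>\<close> by a multiple of \<open>16\<^sup>-\<^sup>k\<close>. For some \<open>y\<close> it decays only like \<open>4\<^sup>-\<^sup>k\<close>.\<close>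

lemma koszul_exact_not_approx_null:
  fixes A :: "'n::{finite,linorder} \<Rightarrow> 'a::chilbert_space \<Rightarrow>\<^sub>L 'a"
  assumes normal: "\<And>i. normal_op (A i)" and ex: "koszul_exact (\<lambda>i. blinfun_apply (A i))"
  shows "\<not> approx_null (range A)"
proof
  assume "approx_null (range A)"
  then have "\<exists>x. norm x = 1 \<and> (\<forall>i. norm (A i x) \<le> (1/16) ^ k)" for k
    using approx_nullD[of "range A" "(1/16) ^ k"] by auto
  then obtain x where x: "\<And>k. norm (x k) = 1" "\<And>k i. norm (A i (x k)) \<le> (1/16) ^ k" by metis
  obtain y where y: "\<And>k. (1 / 4) ^ k / 2 \<le> cmod (cinner y (x k))"
    using exists_slowly_orthogonal[of x] x(1) by blast
  obtain z where z: "y = (\<Sum>i\<in>UNIV. A i (z i))" using koszul_exact_surjective[OF ex] by blast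
  define M where "M = (\<Sum>i\<in>UNIV. norm (z i))"
  have up: "cmod (cinner y (x k)) \<le> M * (1/16) ^ k" for k
  proof -
    have "cinner y (x k) = (\<Sum>i\<in>UNIV. cinner (A i (z i)) (x k))"
      unfolding z by (rule linear_sum[OF bounded_linear.linear[OF bounded_linear_cinner_left]])
    also have "\<dots> = (\<Sum>i\<in>UNIV. cinner (z i) (hadjoint (A i) (x k)))"
      using normal by (simp add: cinner_hadjoint normal_op_def)
    finally have "cmod (cinner y (x k)) \<le> (\<Sum>i\<in>UNIV. cmod (cinner (z i) (hadjoint (A i) (x k))))"
      by (simp add: norm_sum)
    also have "\<dots> \<le> (\<Sum>i\<in>UNIV. norm (z i) * (1/16) ^ k)"
    proof (rule sum_mono)
      fix i
      have "cmod (cinner (z i) (hadjoint (A i) (x k))) \<le> norm (z i) * norm (hadjoint (A i) (x k))"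
        by (rule Cauchy_Schwarz_cinner)
      also have "\<dots> \<le> norm (z i) * (1/16) ^ k"
        using x(2)[of i k] by (intro mult_left_mono) (simp_all add: norm_hadjoint_normal normal)
      finally show "cmod (cinner (z i) (hadjoint (A i) (x k))) \<le> norm (z i) * (1/16) ^ k" .
    qed
    finally show ?thesis by (simp add: M_def sum_distrib_right)
  qed
  have "4 ^ k \<le> 2 * M" for k
  proof -
    have "(1/4 :: real) ^ k \<le> 2 * M * (1/16) ^ k" using y[of k] up[of k] by linarith
    then have "(1/4 :: real) ^ k * 16 ^ k \<le> 2 * M * (1/16) ^ k * 16 ^ k" by (rule mult_right_mono) simp
    then show ?thesis by (simp add: mult.assoc flip: power_mult_distrib)
  qed
  moreover obtain k where "2 * M < 4 ^ k" using real_arch_pow[of 4 "2 * M"] by auto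
  ultimately show False by (meson not_less)
qed

text \<open>The Lax--Milgram lemma: \<open>S x = y\<close> is a fixed point equation for \<open>x \<mapsto> x - s (S x - y)\<close>, and this map is a
  contraction for \<open>s = c / L\<^sup>2\<close>, the minimiser of \<open>1 - 2 s c + s\<^sup>2 L\<^sup>2\<close>.\<close>

lemma coercive_bij:
  fixes S :: "'a::chilbert_space \<Rightarrow>\<^sub>L 'a"
  assumes c: "c > 0" and low: "\<And>x. c * (norm x)\<^sup>2 \<le> Re (cinner (S x) x)"
  shows "bij S"
proof (rule bijI)
  show "inj S"
  proof (rule injI)
    fix x y assume "S x = S y"
    then have "c * (norm (x - y))\<^sup>2 \<le> 0" using low[of "x - y"] by (simp add: blinfun.diff_right)
    then show "x = y" using c by (simp add: mult_le_0_iff)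
  qed
  show "surj S"
  proof (rule surjI)
    fix y
    define L where "L = norm S + c"
    have L: "L > 0" "norm S \<le> L" "c \<le> L" using c by (auto simp: L_def add_nonneg_pos)
    define s where "s = c / L\<^sup>2"
    define f where "f x = x - s *\<^sub>R (S x - y)" for x
    define k where "k = sqrt (1 - c\<^sup>2 / L\<^sup>2)"
    have cL: "c\<^sup>2 / L\<^sup>2 \<le> 1" using L c by (simp add: power_mono)
    have k: "0 \<le> k" "k < 1" using cL c L by (auto simp: k_def real_sqrt_less_iff)
    have contr: "dist (f u) (f v) \<le> k * dist u v" for u v
    proof -
      define d where "d = u - v"
      have fd: "f u - f v = d - s *\<^sub>R S d"
        by (simp add: f_def d_def blinfun.diff_right algebra_simps)
      have "(norm (S d))\<^sup>2 \<le> (L * norm d)\<^sup>2"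
        using norm_blinfun[of S d] L(2) by (intro power_mono order_trans[OF norm_blinfun]
          mult_right_mono) auto
      then have Sd: "s\<^sup>2 * (norm (S d))\<^sup>2 \<le> s\<^sup>2 * (L\<^sup>2 * (norm d)\<^sup>2)"
        by (intro mult_left_mono) (auto simp: power_mult_distrib)
      have s: "s > 0" using c L by (simp add: s_def)
      have "(norm (d - s *\<^sub>R S d))\<^sup>2 = (norm d)\<^sup>2 - 2 * (s * Re (cinner (S d) d)) + s\<^sup>2 * (norm (S d))\<^sup>2"
        unfolding norm_diff_square
        by (simp add: cinner_simps power_mult_distrib Re_cinner_commute[of d])
      also have "\<dots> \<le> (norm d)\<^sup>2 - 2 * (s * (c * (norm d)\<^sup>2)) + s\<^sup>2 * (L\<^sup>2 * (norm d)\<^sup>2)"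
        using Sd mult_left_mono[OF low[of d], of s] s by linarith
      also have "\<dots> = (1 - c\<^sup>2 / L\<^sup>2) * (norm d)\<^sup>2"
        using L(1) by (simp add: s_def field_simps power2_eq_square)
      also have "\<dots> = (k * norm d)\<^sup>2"
        using cL by (simp add: k_def power_mult_distrib)
      finally have "norm (d - s *\<^sub>R S d) \<le> k * norm d"
        using k by (auto intro: power2_le_imp_le)
      then show ?thesis unfolding dist_norm fd d_def .
    qed
    obtain x where "f x = x"
      using banach_fix_type[of k f] k contr by blast
    moreover have "s \<noteq> 0" using c L by (simp add: s_def)
    ultimately have "S x = y" by (simp add: f_def)
    then show "S (SOME x. S x = y) = y" by (rule someI)
  qed
qed

definition koszul_sign :: "'n::linorder \<Rightarrow> 'n set \<Rightarrow> real" where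
  "koszul_sign i S = (-1) ^ card {j \<in> S. j < i}"

lemma koszul_sign_sq: "koszul_sign i S * koszul_sign i S = 1"
  by (simp add: koszul_sign_def flip: power_mult_distrib)

lemma koszul_sign_remove_self: "koszul_sign i (S - {i}) = koszul_sign i S"
  unfolding koszul_sign_def by (rule arg_cong[where f = "\<lambda>A. (-1) ^ card A"]) auto

lemma koszul_sign_insert:
  fixes i k :: "'n::{finite,linorder}"
  assumes "k \<notin> S"
  shows "koszul_sign i (insert k S) = (if k < i then - 1 else 1) * koszul_sign i S"
proof -
  have "{j \<in> insert k S. j < i} = (if k < i then insert k {j \<in> S. j < i} else {j \<in> S. j < i})"
    by auto
  then show ?thesis using assms by (simp add: koszul_sign_def)
qed

lemma koszul_sign_remove:
  fixes i k :: "'n::{finite,linorder}"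
  assumes "k \<in> S"
  shows "koszul_sign i S = (if k < i then - 1 else 1) * koszul_sign i (S - {k})"
  using koszul_sign_insert[of k "S - {k}" i] insert_Diff[OF assms] by simp

lemma koszul_sign_anticommute:
  fixes i k :: "'n::{finite,linorder}"
  assumes "i \<in> S" "k \<in> S" "i \<noteq> k"
  shows "koszul_sign i S * koszul_sign k (S - {i}) = - (koszul_sign k S * koszul_sign i (S - {k}))"
proof -
  have "i < k \<and> \<not> k < i \<or> k < i \<and> \<not> i < k" using assms(3) by auto
  then show ?thesis
    unfolding koszul_sign_remove[OF assms(1), of k] koszul_sign_remove[OF assms(2), of i] by auto
qed

text \<open>Contracting the Koszul complex: interior multiplication by \<open>R\<close> is a homotopy between the
  identity and zero.\<close>

lemma koszul_exact_homotopy: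
  fixes T R :: "'n::{finite,linorder} \<Rightarrow> 'a::real_vector \<Rightarrow> 'a"
  assumes T: "\<And>i. linear (T i)" and R: "\<And>i. linear (R i)"
    and TT: "\<And>i j x. T i (T j x) = T j (T i x)"
    and TR: "\<And>i j x. T i (R j x) = R j (T i x)"
    and one: "\<And>x. (\<Sum>i\<in>UNIV. R i (T i x)) = x"
  shows "koszul_exact T"
proof -
  define h where "h \<xi> S = (\<Sum>k\<in>- S. koszul_sign k S *\<^sub>R R k (\<xi> (insert k S)))"
    for \<xi> :: "'n set \<Rightarrow> 'a" and S
  have d: "koszul_map T \<xi> S = (\<Sum>i\<in>S. koszul_sign i S *\<^sub>R T i (\<xi> (S - {i})))" for \<xi> S
    by (simp add: koszul_map_def koszul_sign_def)
  have dd: "koszul_map T (koszul_map T \<xi>) S = 0" for \<xi> S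
  proof -
    define a where "a i k = (if i = k then 0 else
      (koszul_sign i S * koszul_sign k (S - {i})) *\<^sub>R T i (T k (\<xi> (S - {i} - {k}))))" for i k
    have anti: "a i k = - a k i" if "i \<in> S" "k \<in> S" for i k
    proof (cases "i = k")
      case False
      have "koszul_sign i S * koszul_sign k (S - {i}) = - (koszul_sign k S * koszul_sign i (S - {k}))"
        by (rule koszul_sign_anticommute[OF that False])
      moreover have "S - {i} - {k} = S - {k} - {i}" by blast
      ultimately show ?thesis using False unfolding a_def TT[of i k] by simp
    qed (simp add: a_def)
    have "koszul_map T (koszul_map T \<xi>) S = (\<Sum>i\<in>S. \<Sum>k\<in>S - {i}. a i k)"
      unfolding d
      by (intro sum.cong refl)
        (auto simp: linear_sum[OF T] linear_scale[OF T] scaleR_sum_right a_def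
          intro!: sum.cong split: if_splits)
    also have "\<dots> = (\<Sum>i\<in>S. \<Sum>k\<in>S. a i k)"
      by (intro sum.cong refl sum.mono_neutral_left) (auto simp: a_def)
    finally have eq: "koszul_map T (koszul_map T \<xi>) S = (\<Sum>i\<in>S. \<Sum>k\<in>S. a i k)" .
    have "(\<Sum>i\<in>S. \<Sum>k\<in>S. a i k) = (\<Sum>k\<in>S. \<Sum>i\<in>S. a i k)" by (rule sum.swap)
    also have "\<dots> = - (\<Sum>k\<in>S. \<Sum>i\<in>S. a k i)"
      unfolding sum_negf[symmetric] by (intro sum.cong refl anti)
    finally show ?thesis unfolding eq by (metis eq_neg_iff_add_eq_0 scaleR_2 scaleR_eq_0_iff zero_neq_numeral)
  qed
  have homotopy: "koszul_map T (h \<xi>) S + h (koszul_map T \<xi>) S = \<xi> S" for \<xi> S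
  proof -
    define b where "b i k = (koszul_sign i S * koszul_sign k (S - {i})) *\<^sub>R
      R k (T i (\<xi> (insert k S - {i})))" for i k
    have 1: "koszul_sign i S *\<^sub>R T i (h \<xi> (S - {i})) = R i (T i (\<xi> S)) + (\<Sum>k\<in>- S. b i k)"
      if i: "i \<in> S" for i
    proof -
      have "- (S - {i}) = insert i (- S)" using i by blast
      then have "h \<xi> (S - {i}) = koszul_sign i S *\<^sub>R R i (\<xi> S)
          + (\<Sum>k\<in>- S. koszul_sign k (S - {i}) *\<^sub>R R k (\<xi> (insert k (S - {i}))))"
        using i by (simp add: h_def koszul_sign_remove_self insert_absorb)
      moreover have "insert k (S - {i}) = insert k S - {i}" if "k \<in> - S" for k
        using i that by blast
      ultimately have "h \<xi> (S - {i}) = koszul_sign i S *\<^sub>R R i (\<xi> S)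
          + (\<Sum>k\<in>- S. koszul_sign k (S - {i}) *\<^sub>R R k (\<xi> (insert k S - {i})))" by simp
      then show ?thesis
        by (simp only: linear_add[OF T] linear_scale[OF T] linear_sum[OF T] scaleR_add_right
            scaleR_sum_right scaleR_scaleR koszul_sign_sq TR b_def scaleR_one)
    qed
    have 2: "koszul_sign k S *\<^sub>R R k (koszul_map T \<xi> (insert k S))
        = R k (T k (\<xi> S)) - (\<Sum>i\<in>S. b i k)" if k: "k \<in> - S" for k
    proof -
      have kk: "koszul_sign k S * koszul_sign k (insert k S) = 1"
        using k by (simp add: koszul_sign_insert koszul_sign_sq)
      have ik: "koszul_sign k S * koszul_sign i (insert k S)
          = - (koszul_sign i S * koszul_sign k (S - {i}))" if "i \<in> S" for i
      proof -
        have ne: "i \<noteq> k" using k that by blast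
        have e1: "koszul_sign i (insert k S) = (if k < i then -1 else 1) * koszul_sign i S"
          using k by (intro koszul_sign_insert) simp
        have e2: "koszul_sign k S = (if i < k then -1 else 1) * koszul_sign k (S - {i})"
          by (rule koszul_sign_remove[OF that])
        have "i < k \<and> \<not> k < i \<or> k < i \<and> \<not> i < k" using ne by auto
        then show ?thesis unfolding e1 by (subst e2) (elim disjE; simp)
      qed
      have "koszul_map T \<xi> (insert k S) = koszul_sign k (insert k S) *\<^sub>R T k (\<xi> S)
          + (\<Sum>i\<in>S. koszul_sign i (insert k S) *\<^sub>R T i (\<xi> (insert k S - {i})))"
        using k by (simp add: d)
      then have "koszul_sign k S *\<^sub>R R k (koszul_map T \<xi> (insert k S)) = R k (T k (\<xi> S))
          + (\<Sum>i\<in>S. (koszul_sign k S * koszul_sign i (insert k S)) *\<^sub>R R k (T i (\<xi> (insert k S - {i}))))"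
        by (simp only: linear_add[OF R] linear_scale[OF R] linear_sum[OF R] scaleR_add_right
            scaleR_sum_right scaleR_scaleR kk scaleR_one)
      also have "(\<Sum>i\<in>S. (koszul_sign k S * koszul_sign i (insert k S)) *\<^sub>R R k (T i (\<xi> (insert k S - {i}))))
          = (\<Sum>i\<in>S. - b i k)"
        by (intro sum.cong refl) (simp add: ik b_def)
      finally show ?thesis by (simp add: sum_negf)
    qed
    have "koszul_map T (h \<xi>) S = (\<Sum>i\<in>S. R i (T i (\<xi> S))) + (\<Sum>i\<in>S. \<Sum>k\<in>- S. b i k)"
      unfolding d by (simp add: 1 sum.distrib)
    moreover have "h (koszul_map T \<xi>) S = (\<Sum>k\<in>- S. R k (T k (\<xi> S))) - (\<Sum>k\<in>- S. \<Sum>i\<in>S. b i k)"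
      unfolding h_def by (simp add: 2 sum_subtractf)
    moreover have "(\<Sum>k\<in>- S. \<Sum>i\<in>S. b i k) = (\<Sum>i\<in>S. \<Sum>k\<in>- S. b i k)" by (rule sum.swap)
    moreover have "(\<Sum>i\<in>S. R i (T i (\<xi> S))) + (\<Sum>k\<in>- S. R k (T k (\<xi> S))) = \<xi> S"
      by (subst sum.union_disjoint[symmetric]) (auto simp: one)
    ultimately show ?thesis by simp
  qed
  show ?thesis
    unfolding koszul_exact_def
  proof (intro equalityI subsetI)
    fix \<xi> assume "\<xi> \<in> {\<xi>. koszul_map T \<xi> = (\<lambda>S. 0)}"
    then have "koszul_map T \<xi> = (\<lambda>S. 0)" by simp
    moreover have "h (\<lambda>S. 0) S = 0" for S by (simp add: h_def linear_0[OF R])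
    ultimately have "\<xi> S = koszul_map T (h \<xi>) S" for S using homotopy[of \<xi> S] by simp
    then show "\<xi> \<in> range (koszul_map T)" by blast
  next
    fix \<xi> assume "\<xi> \<in> range (koszul_map T)"
    then show "\<xi> \<in> {\<xi>. koszul_map T \<xi> = (\<lambda>S. 0)}" using dd by auto
  qed
qed

text \<open>If no approximate joint null vectors exist, \<open>S = \<Sum>\<^sub>i A\<^sub>i\<^sup>* A\<^sub>i\<close> is coercive, hence invertible, and
  \<open>R\<^sub>i = S\<^sup>-\<^sup>1 A\<^sub>i\<^sup>*\<close> contracts the Koszul complex. That \<open>R\<^sub>i\<close> commutes with \<open>A\<^sub>j\<close> is Fuglede's theorem.\<close>

lemma not_approx_null_koszul_exact:
  fixes A :: "'n::{finite,linorder} \<Rightarrow> 'a::chilbert_space \<Rightarrow>\<^sub>L 'a"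
  assumes normal: "\<And>i. normal_op (A i)" and comm: "\<And>i j. A i o\<^sub>L A j = A j o\<^sub>L A i"
    and na: "\<not> approx_null (range A)"
  shows "koszul_exact (\<lambda>i. blinfun_apply (A i))"
proof -
  have cA: "complex_linear (A i)" for i using normal by (simp add: normal_op_def)
  have AA: "A i (A j x) = A j (A i x)" for i j x by (rule commute_apply[OF comm])
  have hA: "hadjoint (A i) (A j x) = A j (hadjoint (A i) x)" for i j x
    by (rule commute_apply[OF Fuglede[OF normal cA comm]])
  obtain e where e: "e > 0" "\<And>x. norm x = 1 \<Longrightarrow> \<exists>i. e < norm (A i x)"
    using na unfolding approx_null_def by (force simp: not_le)
  define S where "S = (\<Sum>i\<in>UNIV. hadjoint (A i) o\<^sub>L A i)"
  have S: "S x = (\<Sum>i\<in>UNIV. hadjoint (A i) (A i x))" for x by (simp add: S_def blinfun.sum_left)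
  have low: "e\<^sup>2 * (norm x)\<^sup>2 \<le> Re (cinner (S x) x)" for x
  proof -
    have "\<exists>i. e * norm x \<le> norm (A i x)"
    proof (cases "x = 0")
      case False
      obtain i where "e < norm (A i ((1 / norm x) *\<^sub>R x))" using e(2)[of "(1 / norm x) *\<^sub>R x"] False by auto
      then have "e * norm x \<le> norm (A i x)" using False by (simp add: blinfun.scaleR_right field_simps)
      then show ?thesis by blast
    qed simp
    then obtain i where "e * norm x \<le> norm (A i x)" by blast
    then have "(e * norm x)\<^sup>2 \<le> (norm (A i x))\<^sup>2" using e(1) by (intro power_mono) auto
    also have "\<dots> \<le> (\<Sum>i\<in>UNIV. (norm (A i x))\<^sup>2)" by (rule member_le_sum) auto
    also have "\<dots> = (\<Sum>i\<in>UNIV. Re (cinner (hadjoint (A i) (A i x)) x))"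
      by (simp add: cinner_hadjoint_left cA Re_cinner_self)
    also have "\<dots> = Re (cinner (S x) x)"
      unfolding S linear_sum[OF bounded_linear.linear[OF bounded_linear_cinner_left]] by simp
    finally show ?thesis by (simp add: power_mult_distrib)
  qed
  have bS: "bij S" by (rule coercive_bij[OF _ low]) (use e(1) in simp)
  define G where "G = inv S"
  have SG: "S (G x) = x" and GS: "G (S x) = x" for x
    using bS by (simp_all add: G_def bij_is_surj surj_f_inv_f bij_is_inj)
  have SA: "S (A j x) = A j (S x)" for j x
    by (simp add: S blinfun.sum_right hA AA[of j])
  have GA: "G (A j x) = A j (G x)" for j x by (metis GS SA SG)
  have "linear G" by (rule linearI) (metis GS SG blinfun.add_right, metis GS SG blinfun.scaleR_right)
  then have lR: "linear (\<lambda>x. G (hadjoint (A i) x))" for i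
    using linear_compose[of "blinfun_apply (hadjoint (A i))" G] bounded_linear.linear
      blinfun.bounded_linear_right unfolding o_def by blast
  show ?thesis
  proof (rule koszul_exact_homotopy[where R = "\<lambda>i x. G (hadjoint (A i) x)"])
    show "(\<Sum>i\<in>UNIV. G (hadjoint (A i) (A i x))) = x" for x
      using linear_sum[OF \<open>linear G\<close>, of "\<lambda>i. hadjoint (A i) (A i x)" UNIV] GS[of x] by (simp add: S)
    show "A i (G (hadjoint (A j) x)) = G (hadjoint (A j) (A i x))" for i j x
      by (simp add: GA hA)
  qed (simp_all add: lR AA bounded_linear.linear blinfun.bounded_linear_right)
qed

theorem taylor_spectrum_normal_iff:
  fixes T :: "('a::chilbert_space \<Rightarrow>\<^sub>L 'a, 'n::{finite,linorder}) vec"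
  assumes comm: "commuting_tuple T" and normal: "\<And>i. normal_op (T $ i)"
  shows "l \<in> taylor_spectrum T \<longleftrightarrow> approx_null (range (\<lambda>i. T $ i - scalar_op (l $ i)))"
proof -
  define A where "A i = T $ i - scalar_op (l $ i)" for i
  have cT: "complex_linear (T $ i)" for i using normal by (simp add: normal_op_def)
  have TT: "T $ i o\<^sub>L T $ j = T $ j o\<^sub>L T $ i" for i j using comm by (simp add: commuting_tuple_def)
  have nA: "normal_op (A i)" for i unfolding A_def by (rule normal_op_diff_scalar[OF normal])
  have cA: "A i o\<^sub>L A j = A j o\<^sub>L A i" for i j
    by (rule blinfun_eqI) (simp add: A_def blinfun.diff_left blinfun.diff_right complex_linearD[OF cT]
        scaleC_diff_right scaleC_scaleC commute_apply[OF TT[of i j]] mult.commute[of "l $ i"])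
  have "l \<in> taylor_spectrum T \<longleftrightarrow> \<not> koszul_exact (\<lambda>i. blinfun_apply (A i))"
  proof -
    have "(\<lambda>i. blinfun_apply (A i)) = (\<lambda>i x. (T $ i) x - l $ i *\<^sub>C x)"
      by (intro ext) (simp add: A_def blinfun.diff_left)
    then show ?thesis by (simp add: taylor_spectrum_def)
  qed
  also have "\<dots> \<longleftrightarrow> approx_null (range A)"
    using koszul_exact_not_approx_null[of A, OF nA] not_approx_null_koszul_exact[of A, OF nA cA] by blast
  finally show ?thesis unfolding A_def .
qed

section \<open>Distinguished boundaries from discs and peak functions\<close>

lemma holomorphic_in_const: "holomorphic_in (\<lambda>_. c) \<Omega>"
  unfolding holomorphic_in_def by (auto intro!: exI[of _ "\<lambda>_. 0"])

lemma holomorphic_in_component: "holomorphic_in (\<lambda>z. z $ i) \<Omega>"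
  unfolding holomorphic_in_def
  by (auto intro!: exI[of _ "\<lambda>v. v $ i"] bounded_linear_imp_has_derivative bounded_linear_vec_nth)

lemma holomorphic_in_add:
  "holomorphic_in f \<Omega> \<Longrightarrow> holomorphic_in g \<Omega> \<Longrightarrow> holomorphic_in (\<lambda>z. f z + g z) \<Omega>"
  unfolding holomorphic_in_def
proof (intro ballI, goal_cases)
  case (1 z)
  then obtain f' g' where "(f has_derivative f') (at z)" "\<And>c v. f' (c *s v) = c * f' v"
    "(g has_derivative g') (at z)" "\<And>c v. g' (c *s v) = c * g' v" by metis
  then show ?case
    by (intro exI[of _ "\<lambda>h. f' h + g' h"]) (auto intro!: has_derivative_add simp: algebra_simps)
qed

lemma holomorphic_in_mult:
  "holomorphic_in f \<Omega> \<Longrightarrow> holomorphic_in g \<Omega> \<Longrightarrow> holomorphic_in (\<lambda>z. f z * g z) \<Omega>"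
  unfolding holomorphic_in_def
proof (intro ballI, goal_cases)
  case (1 z)
  then obtain f' g' where "(f has_derivative f') (at z)" "\<And>c v. f' (c *s v) = c * f' v"
    "(g has_derivative g') (at z)" "\<And>c v. g' (c *s v) = c * g' v" by metis
  then show ?case
    by (intro exI[of _ "\<lambda>h. f z * g' h + f' h * g z"])
      (auto intro!: has_derivative_mult simp: algebra_simps)
qed

lemma holomorphic_in_diff:
  "holomorphic_in f \<Omega> \<Longrightarrow> holomorphic_in g \<Omega> \<Longrightarrow> holomorphic_in (\<lambda>z. f z - g z) \<Omega>"
  using holomorphic_in_add[of f \<Omega> "\<lambda>z. (- 1) * g z"]
    holomorphic_in_mult[OF holomorphic_in_const[of "- 1"], of g \<Omega>] by simp

lemma holomorphic_in_divide_const: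
  "holomorphic_in f \<Omega> \<Longrightarrow> holomorphic_in (\<lambda>z. f z / c) \<Omega>"
  using holomorphic_in_mult[OF _ holomorphic_in_const[of "1 / c"], of f \<Omega>] by simp

lemma holomorphic_in_power:
  "holomorphic_in f \<Omega> \<Longrightarrow> holomorphic_in (\<lambda>z. f z ^ n) \<Omega>"
  by (induction n) (simp_all add: holomorphic_in_const holomorphic_in_mult)

lemmas holomorphic_in_intros = holomorphic_in_const holomorphic_in_component holomorphic_in_add
  holomorphic_in_diff holomorphic_in_mult holomorphic_in_divide_const

text \<open>Decomposing \<open>\<phi>\<close> along the coordinate axes gives its derivative \<open>h \<mapsto> h v\<close> with a complex vector \<open>v\<close>, and
  the chain rule applies.\<close>

lemma holomorphic_in_compose_disc:
  fixes \<phi> :: "complex \<Rightarrow> complex ^ 'n"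
  assumes f: "holomorphic_in f \<Omega>"
    and \<phi>: "\<And>i. (\<lambda>z. \<phi> z $ i) holomorphic_on ball 0 1" "\<phi> ` ball 0 1 \<subseteq> \<Omega>"
  shows "(\<lambda>z. f (\<phi> z)) holomorphic_on ball 0 1"
  unfolding holomorphic_on_open[OF open_ball]
proof
  fix z :: complex assume z: "z \<in> ball 0 1"
  have "\<exists>v. ((\<lambda>z. \<phi> z $ i) has_field_derivative v) (at z)" for i
    using \<phi>(1)[of i] z by (auto simp: holomorphic_on_open)
  then obtain v where v: "\<And>i. ((\<lambda>z. \<phi> z $ i) has_field_derivative v i) (at z)" by metis
  have ax: "bounded_linear (axis i :: complex \<Rightarrow> complex ^ 'n)" for i
    unfolding linear_conv_bounded_linear[symmetric]
    by (rule linearI) (auto simp: axis_def vec_eq_iff)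
  have "((\<lambda>z. \<Sum>i\<in>UNIV. axis i (\<phi> z $ i)) has_derivative (\<lambda>h. \<Sum>i\<in>UNIV. axis i (v i * h))) (at z)"
    by (intro has_derivative_sum bounded_linear.has_derivative[OF ax])
      (use v in \<open>simp add: has_field_derivative_def\<close>)
  moreover have "(\<Sum>i\<in>UNIV. axis i (x $ i)) = x" for x :: "complex ^ 'n"
    by (simp add: vec_eq_iff axis_def)
  moreover have "(\<Sum>i\<in>UNIV. axis i (v i * h)) = h *s (\<chi> i. v i)" for h
    by (simp add: vec_eq_iff axis_def)
  ultimately have d: "(\<phi> has_derivative (\<lambda>h. h *s (\<chi> i. v i))) (at z)" by simp
  obtain f' where f': "(f has_derivative f') (at (\<phi> z))" "\<And>c v. f' (c *s v) = c * f' v"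
    using f \<phi>(2) z unfolding holomorphic_in_def by blast
  have "((\<lambda>z. f (\<phi> z)) has_derivative (\<lambda>h. f' (h *s (\<chi> i. v i)))) (at z)"
    by (rule has_derivative_compose[OF d f'(1)])
  moreover have "(\<lambda>h. f' (h *s (\<chi> i. v i))) = (*) (f' (\<chi> i. v i))"
    unfolding f'(2) by (rule ext) (rule mult.commute)
  ultimately have "((\<lambda>z. f (\<phi> z)) has_field_derivative f' (\<chi> i. v i)) (at z)"
    unfolding has_field_derivative_def by simp
  then show "\<exists>f'. ((\<lambda>z. f (\<phi> z)) has_field_derivative f') (at z)" by blast
qed

definition disc_through :: "(complex ^ 'n) set \<Rightarrow> (complex ^ 'n) set \<Rightarrow> complex ^ 'n \<Rightarrow> bool" where
  "disc_through \<Omega> B z \<longleftrightarrow>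
    (\<exists>\<phi>. \<phi> 0 = z \<and> (\<forall>i. (\<lambda>\<zeta>. \<phi> \<zeta> $ i) holomorphic_on ball 0 1) \<and>
      (\<forall>i. continuous_on (cball 0 1) (\<lambda>\<zeta>. \<phi> \<zeta> $ i)) \<and> \<phi> ` ball 0 1 \<subseteq> \<Omega> \<and> \<phi> ` sphere 0 1 \<subseteq> B)"

text \<open>The factor \<open>h\<close> peaks on a set that contains \<open>p\<close>, and \<open>G\<close>, which may be large elsewhere, peaks
  at \<open>p\<close> within that set. This is weaker than a single peak function at \<open>p\<close>, and polynomials suffice
  for it.\<close>

definition two_stage_peak :: "(complex ^ 'n) set \<Rightarrow> complex ^ 'n \<Rightarrow> bool" where
  "two_stage_peak \<Omega> p \<longleftrightarrow>
    (\<exists>h G. continuous_on (closure \<Omega>) h \<and> holomorphic_in h \<Omega> \<and>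
      continuous_on (closure \<Omega>) G \<and> holomorphic_in G \<Omega> \<and> (\<forall>z\<in>closure \<Omega>. cmod (h z) \<le> 1) \<and>
      cmod (h p) = 1 \<and> cmod (G p) = 1 \<and>
      (\<forall>z\<in>closure \<Omega>. 1 \<le> cmod (h z) \<longrightarrow> 1 \<le> cmod (G z) \<longrightarrow> z = p))"

text \<open>The maximum principle on the discs shows that \<open>B\<close> carries the maximum modulus. For minimality,
  a high power of \<open>h\<close> times \<open>G\<close> has modulus below one on any given closed subset of the closure
  that misses \<open>p\<close>, so no such set carries the maximum modulus.\<close>

lemma distinguished_boundary_eqI:
  fixes \<Omega> B :: "(complex ^ 'n) set"
  assumes bounded: "bounded \<Omega>" and clB: "closed B" and sub: "B \<subseteq> closure \<Omega>" and ne: "B \<noteq> {}"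
    and disc: "\<And>z. z \<in> \<Omega> \<Longrightarrow> disc_through \<Omega> B z"
    and peak: "\<And>p. p \<in> B \<Longrightarrow> two_stage_peak \<Omega> p"
  shows "distinguished_boundary \<Omega> = B"
  unfolding distinguished_boundary_def
proof (rule Least_equality)
  have cpt: "compact (closure \<Omega>)" using bounded by (simp add: compact_closure)
  then have cB: "compact B" using clB sub by (metis compact_Int_closed inf.absorb_iff2)
  show "max_modulus_set \<Omega> B"
    unfolding max_modulus_set_def
  proof (intro conjI clB sub allI impI)
    fix f assume "continuous_on (closure \<Omega>) f \<and> holomorphic_in f \<Omega>"
    then have cf: "continuous_on (closure \<Omega>) f" and hf: "holomorphic_in f \<Omega>" by auto
    have "continuous_on B (\<lambda>z. cmod (f z))"
      by (intro continuous_on_norm continuous_on_subset[OF cf sub])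
    then obtain b where b: "b \<in> B" "\<And>z. z \<in> B \<Longrightarrow> cmod (f z) \<le> cmod (f b)"
      using continuous_attains_sup[OF cB ne] by blast
    have "cmod (f z) \<le> cmod (f b)" if z: "z \<in> \<Omega>" for z
    proof -
      obtain \<phi> where \<phi>: "\<phi> 0 = z" "\<And>i. (\<lambda>\<zeta>. \<phi> \<zeta> $ i) holomorphic_on ball 0 1"
        "\<And>i. continuous_on (cball 0 1) (\<lambda>\<zeta>. \<phi> \<zeta> $ i)" "\<phi> ` ball 0 1 \<subseteq> \<Omega>" "\<phi> ` sphere 0 1 \<subseteq> B"
        using disc[OF z] unfolding disc_through_def by blast
      have "continuous_on (cball 0 1) (\<lambda>\<zeta>. \<chi> i. \<phi> \<zeta> $ i)"
        by (intro continuous_on_vec_lambda \<phi>(3))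
      then have c\<phi>: "continuous_on (cball 0 1) \<phi>" by simp
      have im: "\<phi> ` cball 0 1 \<subseteq> closure \<Omega>"
      proof (rule image_subsetI)
        fix \<zeta> :: complex assume "\<zeta> \<in> cball 0 1"
        then have "\<zeta> \<in> ball 0 1 \<or> \<zeta> \<in> sphere 0 1" by auto
        then have "\<phi> \<zeta> \<in> \<Omega> \<union> B" using \<phi>(4,5) by blast
        then show "\<phi> \<zeta> \<in> closure \<Omega>" using sub closure_subset[of \<Omega>] by blast
      qed
      have "norm (f (\<phi> 0)) \<le> cmod (f b)"
      proof (rule maximum_modulus_frontier[of "\<lambda>\<zeta>. f (\<phi> \<zeta>)" "cball 0 1"])
        show "(\<lambda>\<zeta>. f (\<phi> \<zeta>)) holomorphic_on interior (cball 0 1)"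
          using holomorphic_in_compose_disc[OF hf \<phi>(2,4)] by simp
        show "continuous_on (closure (cball 0 1)) (\<lambda>\<zeta>. f (\<phi> \<zeta>))"
          using continuous_on_compose2[OF cf c\<phi> im] by simp
        show "norm (f (\<phi> \<zeta>)) \<le> cmod (f b)" if "\<zeta> \<in> frontier (cball 0 1)" for \<zeta>
        proof -
          have "\<zeta> \<in> sphere 0 1" using that by simp
          then have "\<phi> \<zeta> \<in> B" using \<phi>(5) by blast
          then show ?thesis by (rule b(2))
        qed
      qed auto
      then show ?thesis by (simp add: \<phi>(1))
    qed
    then have "\<forall>z\<in>closure \<Omega>. cmod (f z) \<le> cmod (f b)"
      using continuous_on_closure_norm_le[OF cf] by blast
    then show "\<exists>b\<in>B. \<forall>z\<in>closure \<Omega>. cmod (f z) \<le> cmod (f b)" using b(1) by blast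
  qed
  fix B' assume "max_modulus_set \<Omega> B'"
  then have B': "closed B'" "B' \<subseteq> closure \<Omega>"
    and mB': "\<And>f. continuous_on (closure \<Omega>) f \<Longrightarrow> holomorphic_in f \<Omega> \<Longrightarrow>
      \<exists>b\<in>B'. \<forall>z\<in>closure \<Omega>. cmod (f z) \<le> cmod (f b)"
    by (auto simp: max_modulus_set_def)
  have cB': "compact B'" using B' cpt by (metis compact_Int_closed inf.absorb_iff2)
  show "B \<le> B'"
  proof
    fix p assume p: "p \<in> B"
    obtain h G where h: "continuous_on (closure \<Omega>) h" "holomorphic_in h \<Omega>"
      and G: "continuous_on (closure \<Omega>) G" "holomorphic_in G \<Omega>"
      and h1: "\<And>z. z \<in> closure \<Omega> \<Longrightarrow> cmod (h z) \<le> 1" and hp: "cmod (h p) = 1" and Gp: "cmod (G p) = 1"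
      and only: "\<And>z. z \<in> closure \<Omega> \<Longrightarrow> 1 \<le> cmod (h z) \<Longrightarrow> 1 \<le> cmod (G z) \<Longrightarrow> z = p"
      using peak[OF p] unfolding two_stage_peak_def by blast
    show "p \<in> B'"
    proof (rule ccontr)
      assume np: "p \<notin> B'"
      have chB: "continuous_on B' (\<lambda>z. cmod (h z))" and cGB: "continuous_on B' (\<lambda>z. cmod (G z))"
        by (intro continuous_on_norm continuous_on_subset[OF h(1) B'(2)]
            continuous_on_subset[OF G(1) B'(2)])+
      define K where "K = {z \<in> B'. 1 \<le> cmod (G z)}"
      have "closed K" unfolding K_def
        using continuous_on_closed_Collect_le[OF continuous_on_const[of _ 1] cGB B'(1)] .
      then have cK: "compact K" using cB' unfolding K_def
        by (metis (no_types, lifting) compact_Int_closed inf.absorb_iff2 mem_Collect_eq subsetI)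
      have "\<exists>c<1. 0 \<le> c \<and> (\<forall>z\<in>K. cmod (h z) \<le> c)"
      proof (cases "K = {}")
        case False
        have "continuous_on K (\<lambda>z. cmod (h z))" using chB by (rule continuous_on_subset) (auto simp: K_def)
        then obtain k where k: "k \<in> K" "\<And>z. z \<in> K \<Longrightarrow> cmod (h z) \<le> cmod (h k)"
          using continuous_attains_sup[OF cK False] by blast
        have "cmod (h k) < 1"
          using only[of k] k(1) np B'(2) unfolding K_def by (force simp: not_le[symmetric])
        then show ?thesis using k(2) by (intro exI[of _ "cmod (h k)"]) auto
      qed (auto intro!: exI[of _ 0])
      then obtain c where c: "c < 1" "0 \<le> c" "\<And>z. z \<in> K \<Longrightarrow> cmod (h z) \<le> c" by blast
      have "bounded (G ` closure \<Omega>)"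
        by (intro compact_imp_bounded compact_continuous_image G(1) cpt)
      then obtain M where M: "M > 0" "\<And>z. z \<in> closure \<Omega> \<Longrightarrow> cmod (G z) \<le> M"
        unfolding bounded_pos by auto
      have "(\<lambda>n. c ^ n * M) \<longlonglongrightarrow> 0 * M"
        by (intro tendsto_mult tendsto_const LIMSEQ_realpow_zero c)
      then have "\<forall>\<^sub>F n in sequentially. c ^ n * M < 1" by (intro order_tendstoD) auto
      then obtain n where n: "c ^ n * M < 1" by (auto simp: eventually_sequentially)
      have "\<exists>b\<in>B'. \<forall>z\<in>closure \<Omega>. cmod (h z ^ n * G z) \<le> cmod (h b ^ n * G b)"
        by (rule mB') (intro continuous_intros h G, intro holomorphic_in_mult holomorphic_in_power h G)
      then obtain b where b: "b \<in> B'" "cmod (h p ^ n * G p) \<le> cmod (h b ^ n * G b)"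
        using p sub by blast
      then have ge: "1 \<le> cmod (h b) ^ n * cmod (G b)" by (simp add: norm_mult norm_power hp Gp)
      have bcl: "b \<in> closure \<Omega>" using b(1) B'(2) by blast
      show False
      proof (cases "b \<in> K")
        case True
        have "cmod (h b) ^ n * cmod (G b) \<le> c ^ n * M"
          using c True M bcl by (intro mult_mono power_mono) auto
        then show False using ge n by simp
      next
        case False
        then have "cmod (G b) < 1" using b(1) by (simp add: K_def)
        moreover have "cmod (h b) ^ n \<le> 1" using h1[OF bcl] by (simp add: power_le_one)
        then have "cmod (h b) ^ n * cmod (G b) \<le> cmod (G b)" by (simp add: mult_left_le_one_le)
        ultimately show False using ge by simp
      qed
    qed
  qed
qed

lemma eq_one_if_norm_one_plus_ge_two:
  fixes u :: complex
  assumes "cmod u \<le> 1" "2 \<le> cmod (1 + u)"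
  shows "u = 1"
proof -
  have "(cmod u)\<^sup>2 \<le> 1" using assms(1) by (simp add: power_le_one)
  moreover have "2\<^sup>2 \<le> (cmod (1 + u))\<^sup>2" using assms(2) by (intro power_mono) auto
  ultimately have u: "(Re u)\<^sup>2 + (Im u)\<^sup>2 \<le> 1" "4 \<le> (1 + Re u)\<^sup>2 + (Im u)\<^sup>2"
    by (simp_all add: cmod_power2)
  then have "1 \<le> Re u" by (simp add: power2_sum)
  then have "1 \<le> (Re u)\<^sup>2" by simp
  moreover have "0 \<le> (Im u)\<^sup>2" by simp
  ultimately have "(Im u)\<^sup>2 = 0" "(Re u)\<^sup>2 = 1" using u(1) by linarith+
  then show ?thesis using \<open>1 \<le> Re u\<close> by (simp add: complex_eq_iff power2_eq_1_iff)
qed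

text \<open>The equality case of the Cauchy--Schwarz inequality, used for peak functions at points of
  the unit sphere of \<open>\<complex>\<^sup>2\<close>.\<close>

lemma unit_sphere_peak:
  fixes a x p q :: complex
  assumes "(cmod a)\<^sup>2 + (cmod x)\<^sup>2 \<le> 1" "(cmod p)\<^sup>2 + (cmod q)\<^sup>2 = 1"
  shows "cmod (a * cnj p + x * cnj q) \<le> 1"
    and "2 \<le> cmod (1 + (a * cnj p + x * cnj q)) \<Longrightarrow> a = p \<and> x = q"
proof -
  have "cmod (a * cnj p + x * cnj q) \<le> cmod a * cmod p + cmod x * cmod q"
    using norm_triangle_ineq[of "a * cnj p" "x * cnj q"] by (simp add: norm_mult)
  moreover have "0 \<le> (cmod a - cmod p)\<^sup>2 + (cmod x - cmod q)\<^sup>2" by simp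
  ultimately show le: "cmod (a * cnj p + x * cnj q) \<le> 1"
    using assms by (simp add: power2_diff)
  assume "2 \<le> cmod (1 + (a * cnj p + x * cnj q))"
  then have 1: "a * cnj p + x * cnj q = 1" by (rule eq_one_if_norm_one_plus_ge_two[OF le])
  have "(cmod (a - p))\<^sup>2 + (cmod (x - q))\<^sup>2
      = (cmod a)\<^sup>2 + (cmod x)\<^sup>2 + ((cmod p)\<^sup>2 + (cmod q)\<^sup>2) - 2 * Re (a * cnj p + x * cnj q)"
    unfolding cmod_power2 by (simp add: power2_eq_square algebra_simps)
  also have "\<dots> \<le> 0" using assms by (simp add: 1)
  finally have "(cmod (a - p))\<^sup>2 + (cmod (x - q))\<^sup>2 \<le> 0" .
  then show "a = p \<and> x = q" by (simp add: add_nonneg_eq_0_iff order_antisym_conv)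
qed

text \<open>The automorphism of the disc that moves \<open>0\<close> to \<open>c\<close>.\<close>

definition mobius :: "complex \<Rightarrow> complex \<Rightarrow> complex" where
  "mobius c z = (z + c) / (1 + cnj c * z)"

lemma cmod_mobius_identity:
  "(cmod (1 - a * z))\<^sup>2 - (cmod (cnj a - z))\<^sup>2 = (1 - (cmod a)\<^sup>2) * (1 - (cmod z)\<^sup>2)"
  unfolding cmod_power2 by (simp add: power2_eq_square algebra_simps)

lemma one_plus_mult_nonzero: "cmod a < 1 \<Longrightarrow> cmod z \<le> 1 \<Longrightarrow> 1 + a * z \<noteq> 0"
proof
  assume a: "cmod a < 1" "cmod z \<le> 1" and "1 + a * z = 0"
  then have "a * z = - 1" by (simp add: add_eq_0_iff)
  then have "cmod a * cmod z = 1" by (metis norm_minus_cancel norm_mult norm_one)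
  moreover have "cmod a * cmod z \<le> cmod a * 1" using a by (intro mult_left_mono) auto
  ultimately show False using a by simp
qed

lemma mobius_props:
  assumes c: "cmod c < 1"
  shows "mobius c 0 = c"
    and "cmod z < 1 \<Longrightarrow> cmod (mobius c z) < 1"
    and "cmod z = 1 \<Longrightarrow> cmod (mobius c z) = 1"
    and "mobius c holomorphic_on ball 0 1"
    and "continuous_on (cball 0 1) (mobius c)"
proof -
  have nz: "1 + cnj c * z \<noteq> 0" if "cmod z \<le> 1" for z
    using one_plus_mult_nonzero[of "cnj c" z] c that by simp
  have id: "(cmod (1 + cnj c * z))\<^sup>2 - (cmod (z + c))\<^sup>2 = (1 - (cmod c)\<^sup>2) * (1 - (cmod z)\<^sup>2)" for z
    using cmod_mobius_identity[of "- cnj c" z] by (simp add: norm_minus_commute[of "- c"] add.commute)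
  show "mobius c 0 = c" by (simp add: mobius_def)
  show "cmod (mobius c z) < 1" if z: "cmod z < 1"
  proof -
    have "(cmod c)\<^sup>2 < 1" "(cmod z)\<^sup>2 < 1" using c z by (simp_all add: power_less_one_iff abs_square_less_1)
    then have "0 < (1 - (cmod c)\<^sup>2) * (1 - (cmod z)\<^sup>2)" by simp
    then have "(cmod (z + c))\<^sup>2 < (cmod (1 + cnj c * z))\<^sup>2" using id[of z] by linarith
    then have "cmod (z + c) < cmod (1 + cnj c * z)" by (rule power2_less_imp_less) simp
    then show ?thesis using nz[of z] z by (simp add: mobius_def norm_divide)
  qed
  show "cmod (mobius c z) = 1" if z: "cmod z = 1"
  proof -
    have "(cmod (z + c))\<^sup>2 = (cmod (1 + cnj c * z))\<^sup>2" using id[of z] z by simp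
    then have "cmod (z + c) = cmod (1 + cnj c * z)" by (simp add: power2_eq_iff_nonneg)
    then show ?thesis using nz[of z] z by (simp add: mobius_def norm_divide)
  qed
  show "mobius c holomorphic_on ball 0 1"
    unfolding mobius_def by (intro holomorphic_intros) (use nz in auto)
  show "continuous_on (cball 0 1) (mobius c)"
    unfolding mobius_def by (intro continuous_intros) (use nz in auto)
qed

section \<open>The unit ball\<close>

lemma norm_square_vec2: "(norm (z :: complex ^ 2))\<^sup>2 = (cmod (z $ 1))\<^sup>2 + (cmod (z $ 2))\<^sup>2"
  by (simp add: norm_vec_def L2_set_def sum_2)

text \<open>The discs are the intersections of the ball with complex lines through the origin, recentred by a
  Moebius map. The function \<open>z \<mapsto> (1 + \<langle>z, p\<rangle>) / 2\<close> peaks at \<open>p\<close>.\<close>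

lemma distinguished_boundary_ball:
  "distinguished_boundary unit_ball2 = {z. (cmod (z $ 1))\<^sup>2 + (cmod (z $ 2))\<^sup>2 = 1}"
proof -
  have sphere: "{z. (cmod (z $ 1))\<^sup>2 + (cmod (z $ 2))\<^sup>2 = 1} = sphere (0 :: complex ^ 2) 1"
    unfolding norm_square_vec2[symmetric] by (auto simp: power2_eq_1_iff) (metis norm_ge_zero neg_0_le_iff_le not_one_le_zero)
  have "distinguished_boundary unit_ball2 = sphere 0 1"
  proof (rule distinguished_boundary_eqI)
    show "sphere 0 1 \<noteq> ({} :: (complex ^ 2) set)" by simp
    fix z :: "complex ^ 2" assume z: "z \<in> ball 0 1"
    define c where "c = complex_of_real (norm z)"
    define e where "e = (if z = 0 then axis 1 1 else (1 / norm z) *\<^sub>R z)"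
    have e: "norm e = 1" "c *s e = z"
      by (auto simp: e_def c_def vec_eq_iff norm_axis_1 scaleR_conv_of_real[of _ "z $ i" for i])
    have c: "cmod c < 1" using z by (simp add: c_def)
    have n: "norm (w *s e) = cmod w" for w
    proof -
      have "(norm (w *s e))\<^sup>2 = (cmod w)\<^sup>2 * (norm e)\<^sup>2"
        unfolding norm_square_vec2 by (simp add: norm_mult power_mult_distrib algebra_simps)
      then show ?thesis by (simp add: e power2_eq_iff_nonneg)
    qed
    show "disc_through unit_ball2 (sphere 0 1) z"
      unfolding disc_through_def
    proof (intro exI[of _ "\<lambda>\<zeta>. mobius c \<zeta> *s e"] conjI allI)
      show "(\<lambda>\<zeta>. (mobius c \<zeta> *s e) $ i) holomorphic_on ball 0 1" for i
        using mobius_props(4)[OF c] by (auto intro!: holomorphic_intros)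
      show "continuous_on (cball 0 1) (\<lambda>\<zeta>. (mobius c \<zeta> *s e) $ i)" for i
        using mobius_props(5)[OF c] by (auto intro!: continuous_intros)
    qed (use mobius_props(1-3)[OF c] e n in auto)
  next
    fix p :: "complex ^ 2" assume p: "p \<in> sphere 0 1"
    define h where "h z = (1 + (z $ 1 * cnj (p $ 1) + z $ 2 * cnj (p $ 2))) / 2" for z :: "complex ^ 2"
    have p1: "(cmod (p $ 1))\<^sup>2 + (cmod (p $ 2))\<^sup>2 = 1" using p norm_square_vec2[of p] by simp
    have z1: "(cmod (z $ 1))\<^sup>2 + (cmod (z $ 2))\<^sup>2 \<le> 1" if "z \<in> closure (ball 0 1)" for z :: "complex ^ 2"
      using that power_mono[of "norm z" 1 2] by (simp flip: norm_square_vec2)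
    show "two_stage_peak unit_ball2 p"
      unfolding two_stage_peak_def
    proof (rule exI[of _ h], rule exI[of _ "\<lambda>_. 1"], intro conjI ballI impI)
      show "continuous_on (closure unit_ball2) h"
        unfolding h_def by (intro continuous_intros) auto
      show "holomorphic_in h unit_ball2" unfolding h_def by (intro holomorphic_in_intros)
      have "p $ 1 * cnj (p $ 1) + p $ 2 * cnj (p $ 2) = of_real 1"
        unfolding p1[symmetric] by (simp add: complex_norm_square del: of_real_power)
      then show "cmod (h p) = 1" by (simp add: h_def)
      fix z assume z: "z \<in> closure unit_ball2"
      note u = unit_sphere_peak[OF z1[OF z] p1]
      show "cmod (h z) \<le> 1"
        using norm_triangle_ineq[of 1 "z $ 1 * cnj (p $ 1) + z $ 2 * cnj (p $ 2)"] u(1)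
        unfolding h_def by (simp add: norm_divide)
      assume "1 \<le> cmod (h z)"
      then have "2 \<le> cmod (1 + (z $ 1 * cnj (p $ 1) + z $ 2 * cnj (p $ 2)))"
        by (simp add: h_def norm_divide)
      from u(2)[OF this] show "z = p" by (simp add: vec_eq_iff forall_2)
    qed (simp_all add: holomorphic_in_const)
  qed auto
  then show ?thesis using sphere by simp
qed

section \<open>The tetrablock\<close>

text \<open>The denominator in the definitions of both domains, the weight in the definition of the
  hexablock, and the denominator of the automorphisms used below.\<close>

abbreviation tetra_den :: "complex \<Rightarrow> complex \<Rightarrow> complex \<Rightarrow> complex \<Rightarrow> complex \<Rightarrow> complex" where
  "tetra_den x1 x2 x3 z1 z2 \<equiv> 1 - x1 * z1 - x2 * z2 + x3 * z1 * z2"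

abbreviation bidisc_weight :: "complex \<Rightarrow> complex \<Rightarrow> real" where
  "bidisc_weight z1 z2 \<equiv> sqrt ((1 - (cmod z1)\<^sup>2) * (1 - (cmod z2)\<^sup>2))"

abbreviation tetra_scale :: "complex \<Rightarrow> complex \<Rightarrow> complex \<Rightarrow> complex" where
  "tetra_scale \<alpha> \<beta> w \<equiv> 1 + cnj \<alpha> * cnj \<beta> * w"

lemma mem_tetrablock:
  "vector [x1, x2, x3] \<in> tetrablock \<longleftrightarrow>
    (\<forall>z1 z2. cmod z1 \<le> 1 \<longrightarrow> cmod z2 \<le> 1 \<longrightarrow> tetra_den x1 x2 x3 z1 z2 \<noteq> 0)"
  unfolding tetrablock_def mem_Collect_eq vector_3 by blast

lemma mem_tetrablock_vec: "x \<in> tetrablock \<longleftrightarrow> vector [x $ 1, x $ 2, x $ 3] \<in> tetrablock"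
  by (simp add: tetrablock_def vector_3)

lemma tetrablock_swap:
  assumes "vector [x1, x2, x3] \<in> tetrablock"
  shows "vector [x2, x1, x3] \<in> tetrablock"
  unfolding mem_tetrablock
proof (intro allI impI)
  fix z1 z2 :: complex assume "cmod z1 \<le> 1" "cmod z2 \<le> 1"
  then have "tetra_den x1 x2 x3 z2 z1 \<noteq> 0" using assms by (simp add: mem_tetrablock)
  then show "tetra_den x2 x1 x3 z1 z2 \<noteq> 0" by (simp add: algebra_simps)
qed

text \<open>Solving \<open>tetra_den x1 x2 x3 z1 z = 0\<close> for \<open>z1\<close> gives \<open>(1 - x2 z) / (x1 - x3 z)\<close>, which must lie outside the
  closed disc.\<close>

lemma tetrablock_fraction:
  assumes x: "vector [x1, x2, x3] \<in> tetrablock" and z: "cmod z \<le> 1"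
  shows "1 - x2 * z \<noteq> 0" "cmod (x1 - x3 * z) < cmod (1 - x2 * z)"
proof -
  show nz: "1 - x2 * z \<noteq> 0" using x z unfolding mem_tetrablock by (metis diff_zero mult_zero_left
    mult_zero_right norm_zero zero_le_one add.right_neutral)
  show "cmod (x1 - x3 * z) < cmod (1 - x2 * z)"
  proof (rule ccontr)
    assume H: "\<not> ?thesis"
    with nz have nz': "x1 - x3 * z \<noteq> 0" by auto
    define w where "w = (1 - x2 * z) / (x1 - x3 * z)"
    have "cmod w \<le> 1" using H nz' by (simp add: w_def norm_divide)
    then have "tetra_den x1 x2 x3 w z \<noteq> 0" using x z by (simp add: mem_tetrablock)
    moreover have "w * (x1 - x3 * z) = 1 - x2 * z" using nz' by (simp add: w_def)
    ultimately show False by (simp add: algebra_simps)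
  qed
qed

text \<open>Closed conditions that hold on the tetrablock, and hence on its closure. They locate the part of the
  closure with \<open>\<bar>x3\<bar> = 1\<close>.\<close>

definition tetra_shell :: "complex \<Rightarrow> complex \<Rightarrow> complex \<Rightarrow> bool" where
  "tetra_shell x1 x2 x3 \<longleftrightarrow> cmod x1 \<le> 1 \<and> cmod x2 \<le> 1 \<and> cmod x3 \<le> 1 \<and>
    (\<forall>z. cmod z \<le> 1 \<longrightarrow> cmod (x1 - x3 * z) \<le> cmod (1 - x2 * z)) \<and>
    (\<forall>z. cmod z \<le> 1 \<longrightarrow> cmod (x2 - x3 * z) \<le> cmod (1 - x1 * z))"

text \<open>Adding the inequalities of \<open>tetrablock_fraction\<close> at \<open>z = 1\<close> and \<open>z = -1\<close> cancels the mixed terms and leaves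
  \<open>\<bar>x1\<bar>\<^sup>2 + \<bar>x3\<bar>\<^sup>2 < 1 + \<bar>x2\<bar>\<^sup>2\<close>. Add the same with \<open>x1\<close> and \<open>x2\<close> exchanged.\<close>

lemma tetrablock_cmod_x3:
  assumes x: "vector [x1, x2, x3] \<in> tetrablock"
  shows "cmod x3 < 1"
proof -
  have *: "(cmod y1)\<^sup>2 + (cmod x3)\<^sup>2 < 1 + (cmod y2)\<^sup>2" if "vector [y1, y2, x3] \<in> tetrablock" for y1 y2
  proof -
    have "(cmod (y1 - x3 * z))\<^sup>2 < (cmod (1 - y2 * z))\<^sup>2" if "cmod z \<le> 1" for z
      using tetrablock_fraction(2)[OF \<open>vector [y1, y2, x3] \<in> tetrablock\<close> that]
      by (intro power_strict_mono) auto
    from this[of 1] this[of "-1"] show ?thesis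
      unfolding cmod_power2 by (simp add: power2_eq_square algebra_simps)
  qed
  from *[OF x] *[OF tetrablock_swap[OF x]] have "(cmod x3)\<^sup>2 < 1" by linarith
  then show ?thesis by (simp add: power_less_one_iff abs_square_less_1)
qed

lemma tetrablock_shell:
  assumes x: "vector [x1, x2, x3] \<in> tetrablock"
  shows "tetra_shell x1 x2 x3"
  unfolding tetra_shell_def
  using tetrablock_fraction(2)[OF x] tetrablock_fraction(2)[OF tetrablock_swap[OF x]]
    tetrablock_cmod_x3[OF x] tetrablock_fraction(2)[OF x, of 0]
    tetrablock_fraction(2)[OF tetrablock_swap[OF x], of 0]
  by (auto simp: less_imp_le)

text \<open>The argument of \<open>tetrablock_cmod_x3\<close> now gives \<open>\<bar>x1\<bar> = \<bar>x2\<bar>\<close>. The shell inequality at a unimodular \<open>z\<close> then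
  reads \<open>Re ((x2 - cnj x1 x3) z) \<le> 0\<close>, and \<open>z\<close> may be replaced by \<open>- z\<close>.\<close>

lemma tetra_shell_boundary:
  assumes s: "tetra_shell x1 x2 x3" and x3: "cmod x3 = 1"
  shows "x1 = cnj x2 * x3"
proof -
  have n: "(Re x3)\<^sup>2 + (Im x3)\<^sup>2 = 1" using x3 by (metis cmod_power2 power_one)
  have *: "(cmod (x1 - x3 * z))\<^sup>2 \<le> (cmod (1 - x2 * z))\<^sup>2"
    "(cmod (x2 - x3 * z))\<^sup>2 \<le> (cmod (1 - x1 * z))\<^sup>2" if "cmod z \<le> 1" for z
    using s that by (auto simp: tetra_shell_def intro!: power_mono)
  have sq: "x1 = cnj x2 * x3 \<longleftrightarrow> cnj x1 * x3 = x2"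
  proof -
    have c: "x3 * cnj x3 = 1" using complex_norm_square[of x3] x3 by simp
    show ?thesis
    proof
      assume "x1 = cnj x2 * x3"
      then have "cnj x1 * x3 = x2 * (x3 * cnj x3)" by (simp add: mult_ac)
      then show "cnj x1 * x3 = x2" by (simp add: c)
    next
      assume "cnj x1 * x3 = x2"
      then have "cnj x2 * x3 = x1 * (x3 * cnj x3)" by (auto simp: mult_ac)
      then show "x1 = cnj x2 * x3" by (simp add: c)
    qed
  qed
  have e: "(Re x1 - Re x3)\<^sup>2 = (Re x1)\<^sup>2 - 2 * (Re x1 * Re x3) + (Re x3)\<^sup>2" by (simp add: power2_diff)
  have eq: "(Re x1)\<^sup>2 + (Im x1)\<^sup>2 = (Re x2)\<^sup>2 + (Im x2)\<^sup>2"
    using *(1)[of 1] *(1)[of "-1"] *(2)[of 1] *(2)[of "-1"] n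
    unfolding cmod_power2 by (simp add: power2_eq_square algebra_simps)
  have "Re (cnj x1 * x3) = Re x2"
    using *(1)[of 1] *(1)[of "-1"] n eq
    unfolding cmod_power2 by (simp add: power2_eq_square algebra_simps)
  moreover have "Im (cnj x1 * x3) = Im x2"
    using *(1)[of \<i>] *(1)[of "-\<i>"] n eq
    unfolding cmod_power2 by (simp add: power2_eq_square algebra_simps)
  ultimately have "cnj x1 * x3 = x2" by (rule complex_eqI)
  then show ?thesis using sq by blast
qed

text \<open>With \<open>m\<^sub>\<alpha>(z) = (cnj \<alpha> - z) / (1 - \<alpha> z)\<close>, these equations say that \<open>tetra_den x1 x2 x3 z1 z2\<close> is
  proportional to \<open>1 + w m\<^sub>\<alpha>(z1) m\<^sub>\<beta>(z2)\<close> times \<open>(1 - \<alpha> z1) (1 - \<beta> z2)\<close>; that is, \<open>x\<close> arises from \<open>(0, 0, w)\<close> by an automorphism of the tetrablock.\<close>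

definition tetra_param :: "complex \<Rightarrow> complex \<Rightarrow> complex \<Rightarrow> complex \<Rightarrow> complex \<Rightarrow> complex \<Rightarrow> bool" where
  "tetra_param \<alpha> \<beta> w x1 x2 x3 \<longleftrightarrow>
    x1 * (tetra_scale \<alpha> \<beta> w) = \<alpha> + cnj \<beta> * w \<and>
    x2 * (tetra_scale \<alpha> \<beta> w) = \<beta> + cnj \<alpha> * w \<and>
    x3 * (tetra_scale \<alpha> \<beta> w) = w + \<alpha> * \<beta>"

lemma tetra_param_denominator:
  assumes "tetra_param \<alpha> \<beta> w x1 x2 x3"
  shows "(tetra_den x1 x2 x3 z1 z2) * (tetra_scale \<alpha> \<beta> w)
    = (1 - \<alpha> * z1) * (1 - \<beta> * z2) + w * (cnj \<alpha> - z1) * (cnj \<beta> - z2)"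
  using assms unfolding tetra_param_def by algebra

lemma mult_lt_one:
  fixes a b :: complex
  assumes "cmod a < 1" "cmod b < 1"
  shows "cmod (a * b) < 1"
  using mult_strict_mono'[of "cmod a" 1 "cmod b" 1] assms by (simp add: norm_mult)

lemma tetra_param_nonzero:
  assumes "cmod \<alpha> < 1" "cmod \<beta> < 1" "cmod w \<le> 1"
  shows "tetra_scale \<alpha> \<beta> w \<noteq> 0"
  using one_plus_mult_nonzero[of "cnj \<alpha> * cnj \<beta>" w] mult_lt_one[of "cnj \<alpha>" "cnj \<beta>"] assms by simp

lemma tetra_param_exists:
  assumes "cmod \<alpha> < 1" "cmod \<beta> < 1" "cmod w \<le> 1"
  shows "tetra_param \<alpha> \<beta> w ((\<alpha> + cnj \<beta> * w) / (tetra_scale \<alpha> \<beta> w))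
    ((\<beta> + cnj \<alpha> * w) / (tetra_scale \<alpha> \<beta> w)) ((w + \<alpha> * \<beta>) / (tetra_scale \<alpha> \<beta> w))"
  using tetra_param_nonzero[OF assms] by (simp add: tetra_param_def)

text \<open>The parameters are found from Brouwer's theorem: \<open>\<beta>\<close> is a fixed point of a continuous map of the
  closed disc into the open disc, composed of the two fractional maps that characterise membership
  in the tetrablock.\<close>

lemma tetrablock_param:
  assumes x: "vector [x1, x2, x3] \<in> tetrablock"
  shows "\<exists>\<alpha> \<beta> w. cmod \<alpha> < 1 \<and> cmod \<beta> < 1 \<and> cmod w < 1 \<and> tetra_param \<alpha> \<beta> w x1 x2 x3"
proof -
  note f1 = tetrablock_fraction[OF x] and f2 = tetrablock_fraction[OF tetrablock_swap[OF x]]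
  define A where "A b = (x1 - x3 * cnj b) / (1 - x2 * cnj b)" for b
  define B where "B a = (x2 - x3 * cnj a) / (1 - x1 * cnj a)" for a
  have A: "cmod (A b) < 1" if "cmod b \<le> 1" for b
    using f1[of "cnj b"] that by (simp add: A_def norm_divide)
  have B: "cmod (B a) < 1" if "cmod a \<le> 1" for a
    using f2[of "cnj a"] that by (simp add: B_def norm_divide)
  have cA: "continuous_on (cball 0 1) A"
    unfolding A_def by (intro continuous_intros) (use f1(1) in auto)
  have cB: "continuous_on (cball 0 1) B"
    unfolding B_def by (intro continuous_intros) (use f2(1) in auto)
  have "continuous_on (cball 0 1) (\<lambda>b. B (A b))"
    by (rule continuous_on_compose2[OF cB cA]) (use A in \<open>auto simp: less_imp_le\<close>)
  moreover have "(\<lambda>b. B (A b)) \<in> cball 0 1 \<rightarrow> cball 0 1"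
    using A B by (auto simp: less_imp_le)
  ultimately obtain \<beta> where \<beta>: "\<beta> \<in> cball 0 1" "B (A \<beta>) = \<beta>"
    using brouwer_ball[of 1 0 "\<lambda>b. B (A b)"] by auto
  define \<alpha> where "\<alpha> = A \<beta>"
  have \<alpha>1: "cmod \<alpha> < 1" using A[of \<beta>] \<beta>(1) by (simp add: \<alpha>_def)
  have \<beta>1: "cmod \<beta> < 1" using B[of \<alpha>] \<alpha>1 \<beta>(2) by (simp add: \<alpha>_def)
  have e1: "\<alpha> * (1 - x2 * cnj \<beta>) = x1 - x3 * cnj \<beta>"
    using f1(1)[of "cnj \<beta>"] \<beta>1 by (simp add: \<alpha>_def A_def)
  have e2: "\<beta> * (1 - x1 * cnj \<alpha>) = x2 - x3 * cnj \<alpha>"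
    using f2(1)[of "cnj \<alpha>"] \<alpha>1 \<beta>(2) by (simp add: B_def field_simps flip: \<alpha>_def)
  have x3: "cmod x3 < 1" by (rule tetrablock_cmod_x3[OF x])
  have c: "cmod (\<alpha> * \<beta>) < 1" by (rule mult_lt_one[OF \<alpha>1 \<beta>1])
  define t where "t = 1 - cnj \<alpha> * cnj \<beta> * x3"
  define w where "w = mobius (- (\<alpha> * \<beta>)) x3"
  have t: "t \<noteq> 0" using one_plus_mult_nonzero[of "- (cnj \<alpha> * cnj \<beta>)" x3] c x3
    by (simp add: t_def norm_mult)
  have wt: "w * t = x3 - \<alpha> * \<beta>"
    using t unfolding w_def mobius_def t_def by simp
  have w1: "cmod w < 1" unfolding w_def by (rule mobius_props(2)) (use c x3 in auto)
  have "t * (x1 * (tetra_scale \<alpha> \<beta> w)) = t * (\<alpha> + cnj \<beta> * w)"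
    using wt e1 e2 t_def by algebra
  moreover have "t * (x2 * (tetra_scale \<alpha> \<beta> w)) = t * (\<beta> + cnj \<alpha> * w)"
    using wt e1 e2 t_def by algebra
  moreover have "t * (x3 * (tetra_scale \<alpha> \<beta> w)) = t * (w + \<alpha> * \<beta>)"
    using wt t_def by algebra
  ultimately have "tetra_param \<alpha> \<beta> w x1 x2 x3"
    unfolding tetra_param_def using t by simp
  then show ?thesis using \<alpha>1 \<beta>1 w1 by blast
qed

lemma sqrt_reverse_Cauchy_Schwarz:
  fixes u v u' v' :: real
  assumes "0 \<le> v" "v \<le> u" "0 \<le> v'" "v' \<le> u'"
  shows "sqrt ((u\<^sup>2 - v\<^sup>2) * (u'\<^sup>2 - v'\<^sup>2)) \<le> u * u' - v * v'"
proof (rule real_le_lsqrt)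
  show "0 \<le> u * u' - v * v'" using assms by (simp add: mult_mono)
  have "0 \<le> (u * v' - u' * v)\<^sup>2" by simp
  then show "(u\<^sup>2 - v\<^sup>2) * (u'\<^sup>2 - v'\<^sup>2) \<le> (u * u' - v * v')\<^sup>2"
    by (simp add: power2_eq_square algebra_simps)
qed

lemma cmod_mobius_le:
  assumes "cmod a \<le> 1" "cmod z \<le> 1"
  shows "cmod (cnj a - z) \<le> cmod (1 - a * z)"
proof -
  have "0 \<le> (1 - (cmod a)\<^sup>2) * (1 - (cmod z)\<^sup>2)" using assms by (simp add: power_le_one)
  then have "(cmod (cnj a - z))\<^sup>2 \<le> (cmod (1 - a * z))\<^sup>2" using cmod_mobius_identity[of a z] by linarith
  then show ?thesis by (rule power2_le_imp_le) simp
qed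

text \<open>In terms of \<open>u\<^sub>j, v\<^sub>j\<close>, the moduli of denominators and numerators of the two disc automorphisms at
  \<open>z\<^sub>j\<close>, the left side is \<open>sqrt ((u\<^sub>1\<^sup>2 - v\<^sub>1\<^sup>2) (u\<^sub>2\<^sup>2 - v\<^sub>2\<^sup>2))\<close> and the right side is at least
  \<open>u\<^sub>1 u\<^sub>2 - v\<^sub>1 v\<^sub>2\<close>. This shows that the discs constructed for the hexablock stay inside it.\<close>

lemma tetra_param_denominator_lower:
  assumes \<alpha>: "cmod \<alpha> < 1" and \<beta>: "cmod \<beta> < 1" and w: "cmod w \<le> 1"
    and z: "cmod z1 \<le> 1" "cmod z2 \<le> 1"
    and p: "tetra_param \<alpha> \<beta> w x1 x2 x3"
  shows "bidisc_weight \<alpha> \<beta> * bidisc_weight z1 z2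
    \<le> cmod (tetra_den x1 x2 x3 z1 z2) * cmod (tetra_scale \<alpha> \<beta> w)"
proof -
  define u1 v1 u2 v2 where "u1 = cmod (1 - \<alpha> * z1)" and "v1 = cmod (cnj \<alpha> - z1)"
    and "u2 = cmod (1 - \<beta> * z2)" and "v2 = cmod (cnj \<beta> - z2)"
  have le: "v1 \<le> u1" "v2 \<le> u2"
    unfolding u1_def v1_def u2_def v2_def using \<alpha> \<beta> z by (auto intro!: cmod_mobius_le)
  have "bidisc_weight \<alpha> \<beta> * bidisc_weight z1 z2
      = sqrt ((u1\<^sup>2 - v1\<^sup>2) * (u2\<^sup>2 - v2\<^sup>2))"
    unfolding u1_def v1_def u2_def v2_def cmod_mobius_identity
    by (simp add: mult_ac flip: real_sqrt_mult)
  also have "\<dots> \<le> u1 * u2 - v1 * v2"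
    using le by (intro sqrt_reverse_Cauchy_Schwarz) (auto simp: v1_def v2_def)
  also have "\<dots> \<le> u1 * u2 - cmod w * (v1 * v2)"
    using mult_right_mono[OF w, of "v1 * v2"] by (simp add: v1_def v2_def)
  also have "\<dots> = cmod ((1 - \<alpha> * z1) * (1 - \<beta> * z2)) - cmod (w * (cnj \<alpha> - z1) * (cnj \<beta> - z2))"
    by (simp add: norm_mult u1_def u2_def v1_def v2_def)
  also have "\<dots> \<le> cmod ((1 - \<alpha> * z1) * (1 - \<beta> * z2) + w * (cnj \<alpha> - z1) * (cnj \<beta> - z2))"
    using norm_diff_ineq by blast
  also have "\<dots> = cmod (tetra_den x1 x2 x3 z1 z2) * cmod (tetra_scale \<alpha> \<beta> w)"
    unfolding tetra_param_denominator[OF p, symmetric] by (simp add: norm_mult)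
  finally show ?thesis .
qed

lemma tetra_param_in_tetrablock:
  assumes \<alpha>: "cmod \<alpha> < 1" and \<beta>: "cmod \<beta> < 1" and w: "cmod w < 1"
    and p: "tetra_param \<alpha> \<beta> w x1 x2 x3"
  shows "vector [x1, x2, x3] \<in> tetrablock"
  unfolding mem_tetrablock
proof (intro allI impI notI)
  fix z1 z2 :: complex assume z: "cmod z1 \<le> 1" "cmod z2 \<le> 1"
    and "tetra_den x1 x2 x3 z1 z2 = 0"
  then have "(1 - \<alpha> * z1) * (1 - \<beta> * z2) + w * (cnj \<alpha> - z1) * (cnj \<beta> - z2) = 0"
    using tetra_param_denominator[OF p, of z1 z2] by simp
  then have "(1 - \<alpha> * z1) * (1 - \<beta> * z2) = - (w * (cnj \<alpha> - z1) * (cnj \<beta> - z2))"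
    by (simp add: add_eq_0_iff2)
  then have eq: "cmod (1 - \<alpha> * z1) * cmod (1 - \<beta> * z2)
      = cmod w * (cmod (cnj \<alpha> - z1) * cmod (cnj \<beta> - z2))"
    by (metis (no_types, lifting) norm_minus_cancel norm_mult mult.assoc)
  have pos: "0 < cmod (1 - \<alpha> * z1) * cmod (1 - \<beta> * z2)"
    using one_plus_mult_nonzero[of "- \<alpha>" z1] one_plus_mult_nonzero[of "- \<beta>" z2] \<alpha> \<beta> z by simp
  have "cmod w * (cmod (cnj \<alpha> - z1) * cmod (cnj \<beta> - z2))
      \<le> cmod w * (cmod (1 - \<alpha> * z1) * cmod (1 - \<beta> * z2))"
    using \<alpha> \<beta> z by (intro mult_left_mono mult_mono cmod_mobius_le) auto
  also have "\<dots> < 1 * (cmod (1 - \<alpha> * z1) * cmod (1 - \<beta> * z2))"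
    using w pos by (intro mult_strict_right_mono)
  finally show False using eq by simp
qed

lemma tetra_param_boundary:
  assumes \<alpha>: "cmod \<alpha> < 1" and \<beta>: "cmod \<beta> < 1" and w: "cmod w = 1"
    and p: "tetra_param \<alpha> \<beta> w x1 x2 x3"
  shows "cmod x3 = 1" "x1 = cnj x2 * x3"
    "(1 - (cmod x1)\<^sup>2) * (cmod (tetra_scale \<alpha> \<beta> w))\<^sup>2 = (1 - (cmod \<alpha>)\<^sup>2) * (1 - (cmod \<beta>)\<^sup>2)"
    "cmod x2 \<le> 1"
proof -
  define q where "q = tetra_scale \<alpha> \<beta> w"
  have q: "q \<noteq> 0" unfolding q_def using tetra_param_nonzero \<alpha> \<beta> w by simp
  have p': "x1 * q = \<alpha> + cnj \<beta> * w" "x2 * q = \<beta> + cnj \<alpha> * w" "x3 * q = w + \<alpha> * \<beta>"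
    using p by (auto simp: tetra_param_def q_def)
  have ww: "w * cnj w = 1" using complex_norm_square[of w] w by simp
  have cq: "w * cnj q = w + \<alpha> * \<beta>"
    unfolding q_def using ww by (simp add: distrib_left mult_ac)
  have "cmod (x3 * q) = cmod (w * cnj q)" by (simp add: p' cq)
  then show x3: "cmod x3 = 1" using w q by (simp add: norm_mult)
  have x3q: "x3 * q = w * cnj q" by (simp add: p' cq)
  have "(x1 - cnj x2 * x3) * q * cnj q = x1 * q * cnj q - cnj (x2 * q) * (x3 * q)"
    by (simp add: algebra_simps)
  also have "\<dots> = (\<alpha> + cnj \<beta> * w) * cnj q - (cnj \<beta> + \<alpha> * cnj w) * (w * cnj q)"
    unfolding p'(1,2) x3q by simp
  also have "\<dots> = (\<alpha> - \<alpha> * (w * cnj w)) * cnj q" by (simp add: algebra_simps)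
  finally show x1: "x1 = cnj x2 * x3" using q by (simp add: ww)
  have "(cmod q)\<^sup>2 - (cmod (x1 * q))\<^sup>2 = (1 - (cmod \<alpha>)\<^sup>2) * (1 - (cmod \<beta>)\<^sup>2)"
  proof -
    have "complex_of_real ((cmod q)\<^sup>2 - (cmod (x1 * q))\<^sup>2)
        = q * cnj q - (\<alpha> + cnj \<beta> * w) * cnj (\<alpha> + cnj \<beta> * w)"
      unfolding p'(1) by (simp add: complex_norm_square del: of_real_power)
    also have "\<dots> = (1 - \<alpha> * cnj \<alpha>) * (1 - \<beta> * cnj \<beta>)"
    proof -
      have "q * cnj q - (\<alpha> + cnj \<beta> * w) * cnj (\<alpha> + cnj \<beta> * w)
          = 1 + \<alpha> * cnj \<alpha> * \<beta> * cnj \<beta> * (w * cnj w) - \<alpha> * cnj \<alpha> - \<beta> * cnj \<beta> * (w * cnj w)"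
        unfolding q_def by (simp add: algebra_simps)
      then show ?thesis unfolding ww by (simp add: algebra_simps)
    qed
    also have "\<dots> = complex_of_real ((1 - (cmod \<alpha>)\<^sup>2) * (1 - (cmod \<beta>)\<^sup>2))"
      by (simp add: complex_norm_square del: of_real_power)
    finally show ?thesis by (simp only: of_real_eq_iff)
  qed
  then show id: "(1 - (cmod x1)\<^sup>2) * (cmod (tetra_scale \<alpha> \<beta> w))\<^sup>2 = (1 - (cmod \<alpha>)\<^sup>2) * (1 - (cmod \<beta>)\<^sup>2)"
    unfolding q_def[symmetric] by (simp add: norm_mult power_mult_distrib algebra_simps)
  have "0 \<le> (1 - (cmod \<alpha>)\<^sup>2) * (1 - (cmod \<beta>)\<^sup>2)" using \<alpha> \<beta> by (simp add: power_le_one less_imp_le)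
  then have "0 \<le> (1 - (cmod x1)\<^sup>2) * (cmod q)\<^sup>2" using id q_def by simp
  then have "(cmod x1)\<^sup>2 \<le> 1" using q by (simp add: zero_le_mult_iff)
  moreover have "cmod x1 = cmod x2" using x1 x3 by (simp add: norm_mult)
  ultimately show "cmod x2 \<le> 1" by (simp add: abs_square_le_1)
qed

text \<open>The points \<open>(r x1, r x2, r\<^sup>2 x3)\<close> with \<open>r < 1\<close> exhibit a boundary point \<open>x\<close> as a limit of points of the
  domain. Their denominator factors as \<open>(1 - x2 s2) - x3 s1 (cnj x2 - s2)\<close> with \<open>s\<^sub>j = r z\<^sub>j\<close>.\<close>

lemma tetra_scaled_denominator:
  assumes x: "cmod x3 = 1" "x1 = cnj x2 * x3" "cmod x2 \<le> 1" and r: "0 < r" "r < 1"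
    and z: "cmod z1 \<le> 1" "cmod z2 \<le> 1"
  shows "sqrt (1 - (cmod x2)\<^sup>2) * bidisc_weight z1 z2
    \<le> cmod (1 - of_real r * x1 * z1 - of_real r * x2 * z2 + (of_real r)\<^sup>2 * x3 * z1 * z2)" (is ?low)
    and "1 - of_real r * x1 * z1 - of_real r * x2 * z2 + (of_real r)\<^sup>2 * x3 * z1 * z2 \<noteq> 0" (is ?nz)
proof -
  define s1 s2 where "s1 = of_real r * z1" and "s2 = of_real r * z2"
  define u v where "u = cmod (1 - x2 * s2)" and "v = cmod (cnj x2 - s2)"
  define D where "D = 1 - of_real r * x1 * z1 - of_real r * x2 * z2 + (of_real r)\<^sup>2 * x3 * z1 * z2"
  have n1: "cmod s1 = r * cmod z1" and n2: "cmod s2 = r * cmod z2"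
    using r by (simp_all add: s1_def s2_def norm_mult)
  have l1: "cmod s1 \<le> cmod z1" and l2: "cmod s2 \<le> cmod z2"
    unfolding n1 n2 using r by (auto intro!: mult_left_le_one_le)
  have "r * cmod z1 \<le> r * 1" "r * cmod z2 \<le> r * 1" using r z by (intro mult_left_mono; simp)+
  then have s: "cmod s1 < 1" "cmod s2 < 1" using r n1 n2 by linarith+
  have D: "D = (1 - x2 * s2) - x3 * s1 * (cnj x2 - s2)"
    unfolding D_def s1_def s2_def x(2) by (simp add: algebra_simps power2_eq_square)
  have vu: "v \<le> u" unfolding u_def v_def using x(3) s(2) by (intro cmod_mobius_le) auto
  have v0: "0 \<le> v" by (simp add: v_def)
  have lower: "u - cmod s1 * v \<le> cmod D"
    unfolding D u_def v_def
    using norm_triangle_ineq2[of "1 - x2 * s2" "x3 * s1 * (cnj x2 - s2)"] x(1) by (simp add: norm_mult)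
  have "1 + s2 * (- x2) \<noteq> 0" using s(2) x(3) by (intro one_plus_mult_nonzero) auto
  then have "u > 0" by (simp add: u_def mult.commute)
  moreover have "cmod s1 * v \<le> cmod s1 * u" using vu by (intro mult_left_mono) auto
  moreover have "cmod s1 * u < 1 * u" using s(1) \<open>u > 0\<close> by (intro mult_strict_right_mono)
  ultimately have "0 < cmod D" using lower by linarith
  then show ?nz unfolding D_def by auto
  have "sqrt (1 - (cmod x2)\<^sup>2) * bidisc_weight z1 z2
      = sqrt ((1 - (cmod x2)\<^sup>2) * ((1 - (cmod z1)\<^sup>2) * (1 - (cmod z2)\<^sup>2)))"
    by (simp add: real_sqrt_mult)
  also have "\<dots> \<le> sqrt ((1 - (cmod x2)\<^sup>2) * ((1 - (cmod s1)\<^sup>2) * (1 - (cmod s2)\<^sup>2)))"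
    using x(3) z s l1 l2
    by (intro real_sqrt_le_mono mult_left_mono mult_mono diff_left_mono power_mono)
      (auto simp: power_le_one less_imp_le)
  also have "\<dots> = sqrt ((1\<^sup>2 - (cmod s1)\<^sup>2) * (u\<^sup>2 - v\<^sup>2))"
    unfolding u_def v_def cmod_mobius_identity by (simp add: mult_ac)
  also have "\<dots> \<le> 1 * u - cmod s1 * v"
    using s(1) v0 vu by (intro sqrt_reverse_Cauchy_Schwarz) auto
  finally show ?low using lower unfolding D_def by simp
qed

lemma bounded_cvecI:
  assumes "\<And>x i. x \<in> S \<Longrightarrow> cmod (x $ i) \<le> 1"
  shows "bounded (S :: (complex ^ 'n) set)"
proof (rule boundedI)
  fix x assume "x \<in> S"
  have "norm x \<le> (\<Sum>i\<in>UNIV. cmod (x $ i))" unfolding norm_vec_def by (rule L2_set_le_sum) simp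
  also have "\<dots> \<le> (\<Sum>i\<in>(UNIV :: 'n set). 1)" by (intro sum_mono assms \<open>x \<in> S\<close>)
  finally show "norm x \<le> of_nat (card (UNIV :: 'n set))" by simp
qed

lemma radial_limit_in_closure:
  fixes p :: "complex ^ 'n" and g :: "real \<Rightarrow> complex ^ 'n"
  assumes "\<And>r. 0 < r \<Longrightarrow> r < 1 \<Longrightarrow> g r \<in> \<Omega>" and "\<And>i. continuous_on UNIV (\<lambda>r. g r $ i)"
    and "g 1 = p"
  shows "p \<in> closure \<Omega>"
proof -
  define r where "r n = 1 - inverse (real (Suc (Suc n)))" for n
  have r: "0 < r n" "r n < 1" for n by (simp_all add: r_def field_simps)
  have "r \<longlonglongrightarrow> 1 - 0"
    unfolding r_def by (intro tendsto_intros LIMSEQ_Suc[OF LIMSEQ_inverse_real_of_nat])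
  then have "(\<lambda>n. g (r n) $ i) \<longlonglongrightarrow> g 1 $ i" for i
    using assms(2)[of i] by (intro isCont_tendsto_compose[of 1 "\<lambda>r. g r $ i"])
      (auto simp: continuous_on_eq_continuous_at)
  then have "(\<lambda>n. g (r n)) \<longlonglongrightarrow> p" unfolding assms(3)[symmetric] by (rule vec_tendstoI)
  moreover have "\<forall>n. g (r n) \<in> \<Omega>" using assms(1)[OF r] by blast
  ultimately show ?thesis unfolding closure_sequential by (intro exI[of _ "\<lambda>n. g (r n)"]) simp
qed

lemma closure_tetrablock_shell:
  assumes "x \<in> closure tetrablock"
  shows "tetra_shell (x $ 1) (x $ 2) (x $ 3)"
proof -
  have "closed {x :: complex ^ 3. tetra_shell (x $ 1) (x $ 2) (x $ 3)}"
    unfolding tetra_shell_def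
    by (intro closed_Collect_conj closed_Collect_all closed_Collect_imp open_Collect_const
        closed_Collect_le continuous_intros)
  moreover have "tetrablock \<subseteq> {x. tetra_shell (x $ 1) (x $ 2) (x $ 3)}"
    using mem_tetrablock_vec tetrablock_shell by auto
  ultimately show ?thesis using closure_minimal[of tetrablock] assms by blast
qed

lemma peak_first_factor:
  fixes p x :: complex
  assumes "cmod p = 1" "cmod x \<le> 1"
  shows "cmod ((1 + cnj p * x) / 2) \<le> 1" and "1 \<le> cmod ((1 + cnj p * x) / 2) \<Longrightarrow> x = p"
proof -
  have c: "cmod (cnj p * x) \<le> 1" using assms by (simp add: norm_mult)
  then show "cmod ((1 + cnj p * x) / 2) \<le> 1"
    using norm_triangle_ineq[of 1 "cnj p * x"] by (simp add: norm_divide)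
  assume "1 \<le> cmod ((1 + cnj p * x) / 2)"
  then have "cnj p * x = 1" by (intro eq_one_if_norm_one_plus_ge_two[OF c]) (simp add: norm_divide)
  moreover have "p * cnj p = 1" using complex_norm_square[of p] assms(1) by simp
  ultimately show "x = p" by (metis mult.assoc mult.right_neutral mult_1)
qed

text \<open>In \<open>tetra_param\<close> with \<open>\<alpha>, \<beta>\<close> fixed, letting \<open>w\<close> run through the disc gives the discs. The peak at \<open>p\<close> uses
  \<open>h = (1 + cnj p3 x3) / 2\<close>, which peaks on \<open>x3 = p3\<close>. There the closure satisfies \<open>cnj p3 x1 = cnj x2\<close>, so
  that \<open>G = 1 - (x2 - p2) (cnj p3 x1 - cnj p2) / 8\<close> becomes \<open>1 - \<bar>x2 - p2\<bar>\<^sup>2 / 8\<close>, which is positive as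
  \<open>\<bar>x2 - p2\<bar> \<le> 2\<close>.\<close>

lemma distinguished_boundary_tetrablock:
  "distinguished_boundary tetrablock
    = {x. cmod (x $ 3) = 1 \<and> x $ 1 = cnj (x $ 2) * x $ 3 \<and> cmod (x $ 2) \<le> 1}" (is "_ = ?B")
proof (rule distinguished_boundary_eqI)
  show "bounded tetrablock"
  proof (rule bounded_cvecI)
    fix x :: "complex ^ 3" and i assume "x \<in> tetrablock"
    then have "tetra_shell (x $ 1) (x $ 2) (x $ 3)" using mem_tetrablock_vec tetrablock_shell by blast
    then have "cmod (x $ 1) \<le> 1" "cmod (x $ 2) \<le> 1" "cmod (x $ 3) \<le> 1"
      unfolding tetra_shell_def by blast+
    then show "cmod (x $ i) \<le> 1" using exhaust_3[of i] by metis
  qed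
  show "closed ?B"
    by (intro closed_Collect_conj closed_Collect_eq closed_Collect_le continuous_intros)
  show "?B \<noteq> {}"
  proof -
    have "vector [0, 0, 1] \<in> ?B" by (simp add: vector_3)
    then show ?thesis by blast
  qed
  show "?B \<subseteq> closure tetrablock"
  proof
    fix x assume "x \<in> ?B"
    then have x: "cmod (x $ 3) = 1" "x $ 1 = cnj (x $ 2) * x $ 3" "cmod (x $ 2) \<le> 1" by auto
    show "x \<in> closure tetrablock"
    proof (rule radial_limit_in_closure[where g = "\<lambda>r. vector [of_real r * x $ 1, of_real r * x $ 2,
          (of_real r)\<^sup>2 * x $ 3]"])
      fix r :: real assume "0 < r" "r < 1"
      then show "vector [of_real r * x $ 1, of_real r * x $ 2, (of_real r)\<^sup>2 * x $ 3] \<in> tetrablock"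
        unfolding mem_tetrablock using tetra_scaled_denominator(2)[OF x] by blast
    next
      fix i :: 3
      show "continuous_on UNIV (\<lambda>r. (vector [of_real r * x $ 1, of_real r * x $ 2,
          (of_real r)\<^sup>2 * x $ 3] :: complex ^ 3) $ i)"
        using exhaust_3[of i] by (elim disjE; hypsubst; simp only: vector_3; intro continuous_intros)
    qed (simp add: vec_eq_iff forall_3 vector_3)
  qed
  fix x assume "x \<in> tetrablock"
  then obtain \<alpha> \<beta> w where \<alpha>: "cmod \<alpha> < 1" and \<beta>: "cmod \<beta> < 1" and w: "cmod w < 1"
    and p: "tetra_param \<alpha> \<beta> w (x $ 1) (x $ 2) (x $ 3)"
    using mem_tetrablock_vec tetrablock_param by blast
  define q where "q \<zeta> = tetra_scale \<alpha> \<beta> (mobius w \<zeta>)" for \<zeta>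
  define \<phi> where "\<phi> \<zeta> = (vector [(\<alpha> + cnj \<beta> * mobius w \<zeta>) / q \<zeta>, (\<beta> + cnj \<alpha> * mobius w \<zeta>) / q \<zeta>,
    (mobius w \<zeta> + \<alpha> * \<beta>) / q \<zeta>] :: complex ^ 3)" for \<zeta>
  note m = mobius_props[OF w]
  have m1: "cmod (mobius w \<zeta>) \<le> 1" if "\<zeta> \<in> cball 0 1" for \<zeta>
    using m(2,3)[of \<zeta>] that by (auto simp: le_less)
  have par: "tetra_param \<alpha> \<beta> (mobius w \<zeta>) (\<phi> \<zeta> $ 1) (\<phi> \<zeta> $ 2) (\<phi> \<zeta> $ 3)" if "\<zeta> \<in> cball 0 1" for \<zeta>
    using tetra_param_exists[OF \<alpha> \<beta> m1[OF that]] by (simp add: \<phi>_def q_def vector_3)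
  have qnz: "q \<zeta> \<noteq> 0" if "\<zeta> \<in> cball 0 1" for \<zeta>
    unfolding q_def by (rule tetra_param_nonzero[OF \<alpha> \<beta> m1[OF that]])
  have mh: "(\<lambda>\<zeta>. mobius w \<zeta>) holomorphic_on ball 0 1" and mc: "continuous_on (cball 0 1) (\<lambda>\<zeta>. mobius w \<zeta>)"
    using m(4,5) by auto
  have qh: "q holomorphic_on ball 0 1" and qc: "continuous_on (cball 0 1) q"
    unfolding q_def by (intro holomorphic_intros mh, intro continuous_intros mc)
  show "disc_through tetrablock ?B x"
    unfolding disc_through_def
  proof (intro exI[of _ \<phi>] conjI allI)
    show "\<phi> 0 = x"
      using par[of 0] p qnz[of 0] unfolding tetra_param_def m(1) q_def
      by (auto simp: vec_eq_iff forall_3 nonzero_eq_divide_eq intro: mult_right_cancel[THEN iffD1])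
    have "\<forall>i. (\<lambda>\<zeta>. \<phi> \<zeta> $ i) holomorphic_on ball 0 1"
      unfolding forall_3 \<phi>_def vector_3
      by (intro conjI holomorphic_intros mh qh) (use qnz in auto)
    then show "(\<lambda>\<zeta>. \<phi> \<zeta> $ i) holomorphic_on ball 0 1" for i by blast
    have "\<forall>i. continuous_on (cball 0 1) (\<lambda>\<zeta>. \<phi> \<zeta> $ i)"
      unfolding forall_3 \<phi>_def vector_3
      by (intro conjI continuous_intros mc qc) (use qnz in auto)
    then show "continuous_on (cball 0 1) (\<lambda>\<zeta>. \<phi> \<zeta> $ i)" for i by blast
  next
    show "\<phi> ` ball 0 1 \<subseteq> tetrablock"
      using tetra_param_in_tetrablock[OF \<alpha> \<beta> m(2) par] mem_tetrablock_vec by auto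
    show "\<phi> ` sphere 0 1 \<subseteq> ?B"
      using tetra_param_boundary[OF \<alpha> \<beta> m(3) par] by auto
  qed
next
  fix p assume "p \<in> ?B"
  then have p: "cmod (p $ 3) = 1" "p $ 1 = cnj (p $ 2) * p $ 3" "cmod (p $ 2) \<le> 1" by auto
  define h where "h x = (1 + cnj (p $ 3) * x $ 3) / 2" for x :: "complex ^ 3"
  define G where "G x = 1 - (x $ 2 - p $ 2) * (cnj (p $ 3) * x $ 1 - cnj (p $ 2)) / 8" for x :: "complex ^ 3"
  have p3: "cnj (p $ 3) * p $ 3 = 1" using complex_norm_square[of "p $ 3"] p(1) by (simp add: mult.commute)
  show "two_stage_peak tetrablock p"
    unfolding two_stage_peak_def
  proof (rule exI[of _ h], rule exI[of _ G], intro conjI ballI impI)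
    show "continuous_on (closure tetrablock) h" "continuous_on (closure tetrablock) G"
      unfolding h_def G_def by (intro continuous_intros; simp)+
    show "holomorphic_in h tetrablock" "holomorphic_in G tetrablock"
      unfolding h_def G_def by (intro holomorphic_in_intros)+
    show "cmod (h p) = 1" by (simp add: h_def p3)
    show "cmod (G p) = 1" by (simp add: G_def)
    fix x assume "x \<in> closure tetrablock"
    then have s: "tetra_shell (x $ 1) (x $ 2) (x $ 3)" by (rule closure_tetrablock_shell)
    have x3: "cmod (x $ 3) \<le> 1" and x2: "cmod (x $ 2) \<le> 1" using s by (auto simp: tetra_shell_def)
    show "cmod (h x) \<le> 1" unfolding h_def by (rule peak_first_factor(1)[OF p(1) x3])
    assume "1 \<le> cmod (h x)" and G1: "1 \<le> cmod (G x)"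
    then have e3: "x $ 3 = p $ 3" unfolding h_def by (intro peak_first_factor(2)[OF p(1) x3])
    have e1: "x $ 1 = cnj (x $ 2) * x $ 3" using tetra_shell_boundary[OF s] p(1) e3 by simp
    have "cnj (p $ 3) * x $ 1 = cnj (x $ 2) * (cnj (p $ 3) * p $ 3)" unfolding e1 e3 by (simp add: mult_ac)
    then have "cnj (p $ 3) * x $ 1 - cnj (p $ 2) = cnj (x $ 2 - p $ 2)" by (simp add: p3)
    then have "G x = of_real (1 - (cmod (x $ 2 - p $ 2))\<^sup>2 / 8)"
      by (simp add: G_def complex_norm_square flip: of_real_power)
    then have g: "1 \<le> \<bar>1 - (cmod (x $ 2 - p $ 2))\<^sup>2 / 8\<bar>" using G1 by (simp only: norm_of_real)
    have "cmod (x $ 2 - p $ 2) \<le> 2" using norm_triangle_ineq4[of "x $ 2" "p $ 2"] x2 p(3) by linarith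
    then have "(cmod (x $ 2 - p $ 2))\<^sup>2 \<le> 2\<^sup>2" by (intro power_mono) auto
    then have "(cmod (x $ 2 - p $ 2))\<^sup>2 \<le> 0" using g by simp
    then have "x $ 2 = p $ 2" by simp
    then show "x = p" using e1 e3 p(2) by (simp add: vec_eq_iff forall_3)
  qed
qed

section \<open>The hexablock\<close>

lemma tetrablock_denominator_bounded_below:
  assumes x: "vector [x1, x2, x3] \<in> tetrablock"
  shows "\<exists>d>0. \<forall>z1 z2. cmod z1 \<le> 1 \<longrightarrow> cmod z2 \<le> 1 \<longrightarrow>
    d \<le> cmod (tetra_den x1 x2 x3 z1 z2)"
proof -
  define f where "f p = cmod (tetra_den x1 x2 x3 (fst p) (snd p))" for p
  have "continuous_on (cball 0 1 \<times> cball 0 1) f" unfolding f_def by (intro continuous_intros)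
  moreover have "compact (cball (0 :: complex) 1 \<times> cball (0 :: complex) 1)" by (intro compact_Times compact_cball)
  moreover have "cball (0 :: complex) 1 \<times> cball (0 :: complex) 1 \<noteq> {}" by simp
  ultimately obtain p where p: "p \<in> cball 0 1 \<times> cball 0 1" "\<And>q. q \<in> cball 0 1 \<times> cball 0 1 \<Longrightarrow> f p \<le> f q"
    using continuous_attains_inf[of "cball 0 1 \<times> cball 0 1" f] by blast
  have "f p > 0" using p(1) x unfolding mem_tetrablock f_def by auto
  moreover have "f p \<le> cmod (tetra_den x1 x2 x3 z1 z2)" if "cmod z1 \<le> 1" "cmod z2 \<le> 1" for z1 z2
    using p(2)[of "(z1, z2)"] that by (simp add: f_def)
  ultimately show ?thesis by blast
qed

text \<open>The uniform constant replaces the supremum, which is bounded because the denominator is bounded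
  away from zero.\<close>

lemma mem_hexablock:
  "vector [a, x1, x2, x3] \<in> hexablock \<longleftrightarrow> vector [x1, x2, x3] \<in> tetrablock \<and>
    (\<exists>c<1. \<forall>z1 z2. cmod z1 < 1 \<longrightarrow> cmod z2 < 1 \<longrightarrow>
      cmod a * bidisc_weight z1 z2
        \<le> c * cmod (tetra_den x1 x2 x3 z1 z2))"
  (is "_ \<longleftrightarrow> _ \<and> ?C")
proof -
  define F where "F p = cmod (a * complex_of_real (bidisc_weight (fst p) (snd p)) /
    (tetra_den x1 x2 x3 (fst p) (snd p)))" for p
  have pos: "0 \<le> (1 - (cmod z1)\<^sup>2) * (1 - (cmod z2)\<^sup>2)" if "cmod z1 < 1" "cmod z2 < 1" for z1 z2 :: complex
    using that by (simp add: power_le_one less_imp_le)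
  have F: "F (z1, z2) = cmod a * bidisc_weight z1 z2 /
      cmod (tetra_den x1 x2 x3 z1 z2)" if "cmod z1 < 1" "cmod z2 < 1" for z1 z2
    using pos[OF that] by (simp add: F_def norm_mult norm_divide)
  have "vector [a, x1, x2, x3] \<in> hexablock \<longleftrightarrow> vector [x1, x2, x3] \<in> tetrablock \<and>
      (SUP p \<in> ball 0 1 \<times> ball 0 1. F p) < 1"
  proof -
    have eq: "(vector [a, x1, x2, x3] :: complex ^ 4) = vector [a', y1, y2, y3] \<longleftrightarrow>
        a = a' \<and> x1 = y1 \<and> x2 = y2 \<and> x3 = y3" for a' y1 y2 y3
      by (simp add: vec_eq_iff forall_4 vector_4)
    show ?thesis unfolding hexablock_def F_def by (auto simp: eq case_prod_beta)
  qed
  also have "\<dots> \<longleftrightarrow> vector [x1, x2, x3] \<in> tetrablock \<and> ?C"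
  proof (intro conj_cong refl)
    assume x: "vector [x1, x2, x3] \<in> tetrablock"
    obtain d where d: "d > 0" "\<And>z1 z2. cmod z1 \<le> 1 \<Longrightarrow> cmod z2 \<le> 1 \<Longrightarrow>
        d \<le> cmod (tetra_den x1 x2 x3 z1 z2)"
      using tetrablock_denominator_bounded_below[OF x] by blast
    have dp: "0 < cmod (tetra_den x1 x2 x3 z1 z2)" if "cmod z1 < 1" "cmod z2 < 1" for z1 z2
      using d(1) d(2)[of z1 z2] that by linarith
    have bdd: "bdd_above (F ` (ball 0 1 \<times> ball 0 1))"
    proof (rule bdd_aboveI2[of _ _ "cmod a / d"], clarify)
      fix z1 z2 :: complex assume "z1 \<in> ball 0 1" "z2 \<in> ball 0 1"
      then have z: "cmod z1 < 1" "cmod z2 < 1" by auto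
      have "(1 - (cmod z1)\<^sup>2) * (1 - (cmod z2)\<^sup>2) \<le> 1"
        using z by (intro mult_le_one) (auto simp: power_le_one less_imp_le)
      then have "cmod a * bidisc_weight z1 z2 \<le> cmod a"
        by (simp add: mult_left_le)
      then show "F (z1, z2) \<le> cmod a / d"
        unfolding F[OF z] using d(1) d(2)[of z1 z2] z by (intro frac_le) auto
    qed
    show "(SUP p \<in> ball 0 1 \<times> ball 0 1. F p) < 1 \<longleftrightarrow> ?C"
    proof
      assume S: "(SUP p \<in> ball 0 1 \<times> ball 0 1. F p) < 1"
      have "F (z1, z2) \<le> (SUP p \<in> ball 0 1 \<times> ball 0 1. F p)" if "cmod z1 < 1" "cmod z2 < 1" for z1 z2
        using that by (intro cSUP_upper bdd) auto
      then show ?C using S dp by (intro exI[of _ "SUP p \<in> ball 0 1 \<times> ball 0 1. F p"]) (simp add: F divide_le_eq)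
    next
      assume ?C
      then obtain c where c: "c < 1" "\<And>z1 z2. cmod z1 < 1 \<Longrightarrow> cmod z2 < 1 \<Longrightarrow>
        cmod a * bidisc_weight z1 z2
          \<le> c * cmod (tetra_den x1 x2 x3 z1 z2)" by blast
      have "(SUP p \<in> ball 0 1 \<times> ball 0 1. F p) \<le> c"
        by (rule cSUP_least) (use c(2) dp in \<open>auto simp: F divide_le_eq\<close>)
      then show "(SUP p \<in> ball 0 1 \<times> ball 0 1. F p) < 1" using c(1) by simp
    qed
  qed
  finally show ?thesis .
qed

text \<open>As \<open>tetra_shell\<close>, with the strict bound in the definition of the hexablock relaxed to a closed one.\<close>

definition hexa_shell :: "complex \<Rightarrow> complex \<Rightarrow> complex \<Rightarrow> complex \<Rightarrow> bool" where
  "hexa_shell a x1 x2 x3 \<longleftrightarrow> tetra_shell x1 x2 x3 \<and>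
    (\<forall>z1 z2. cmod z1 < 1 \<longrightarrow> cmod z2 < 1 \<longrightarrow>
      cmod a * bidisc_weight z1 z2 \<le> cmod (tetra_den x1 x2 x3 z1 z2))"

lemma hexablock_shell:
  assumes "y \<in> hexablock"
  shows "hexa_shell (y $ 1) (y $ 2) (y $ 3) (y $ 4)"
proof -
  obtain a x1 x2 x3 where y: "y = vector [a, x1, x2, x3]"
    using assms by (auto simp: hexablock_def)
  obtain c where c: "c < 1" "\<And>z1 z2. cmod z1 < 1 \<Longrightarrow> cmod z2 < 1 \<Longrightarrow>
      cmod a * bidisc_weight z1 z2
        \<le> c * cmod (tetra_den x1 x2 x3 z1 z2)"
    and x: "vector [x1, x2, x3] \<in> tetrablock"
    using assms unfolding y mem_hexablock by blast
  have "c * cmod v \<le> cmod v" for v using mult_right_mono[of c 1 "cmod v"] c(1) by simp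
  then have "hexa_shell a x1 x2 x3"
    unfolding hexa_shell_def using tetrablock_shell[OF x] c(2) order_trans by blast
  then show ?thesis by (simp add: y vector_4)
qed

lemma hexa_shell_cmod: "hexa_shell a x1 x2 x3 \<Longrightarrow> cmod a \<le> 1"
  unfolding hexa_shell_def by (elim conjE allE[of _ 0]) simp

lemma closure_hexablock_shell:
  assumes "y \<in> closure hexablock"
  shows "hexa_shell (y $ 1) (y $ 2) (y $ 3) (y $ 4)"
proof -
  have "closed {y :: complex ^ 4. hexa_shell (y $ 1) (y $ 2) (y $ 3) (y $ 4)}"
    unfolding tetra_shell_def hexa_shell_def
    by (intro closed_Collect_conj closed_Collect_all closed_Collect_imp open_Collect_const
        closed_Collect_le continuous_intros)
  moreover have "hexablock \<subseteq> {y. hexa_shell (y $ 1) (y $ 2) (y $ 3) (y $ 4)}"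
    using hexablock_shell by blast
  ultimately show ?thesis using closure_minimal[of hexablock] assms by blast
qed

text \<open>The bound on \<open>a\<close> comes from testing the shell inequality at \<open>(0, cnj x2)\<close>, or, when \<open>x2\<close> is
  unimodular, from approaching the corresponding boundary point.\<close>

lemma hexa_shell_boundary:
  assumes s: "hexa_shell a x1 x2 x3" and x3: "cmod x3 = 1"
  shows "(cmod a)\<^sup>2 + (cmod x2)\<^sup>2 \<le> 1"
proof -
  have x1: "x1 = cnj x2 * x3" using tetra_shell_boundary x3 s by (simp add: hexa_shell_def)
  have x2: "cmod x2 \<le> 1" using s by (simp add: hexa_shell_def tetra_shell_def)
  have low: "cmod a * bidisc_weight z1 z2 \<le> cmod (tetra_den x1 x2 x3 z1 z2)"
    if "cmod z1 < 1" "cmod z2 < 1" for z1 z2 using s that by (simp add: hexa_shell_def)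
  show ?thesis
  proof (cases "cmod x2 < 1")
    case True
    define t where "t = 1 - (cmod x2)\<^sup>2"
    have t: "t > 0" using True by (simp add: t_def abs_square_less_1)
    have "1 - x2 * cnj x2 = of_real t" by (simp add: t_def complex_norm_square del: of_real_power)
    then have "cmod (1 - x2 * cnj x2) = t" using t by (simp only: norm_of_real abs_of_pos)
    then have "cmod a * sqrt t \<le> t" using low[of 0 "cnj x2"] True by (simp add: t_def)
    also have "t = sqrt t * sqrt t" using t by simp
    finally have "cmod a \<le> sqrt t" by (rule mult_right_le_imp_le) (use t in simp)
    then have "(cmod a)\<^sup>2 \<le> (sqrt t)\<^sup>2" by (intro power_mono) auto
    then show ?thesis using t by (simp add: t_def)
  next
    case False
    then have n2: "cmod x2 = 1" using x2 by simp
    have c2: "x2 * cnj x2 = 1" and c3: "x3 * cnj x3 = 1"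
      using complex_norm_square[of x2] complex_norm_square[of x3] n2 x3 by simp_all
    have a: "cmod a \<le> 1 - r" if r: "0 \<le> r" "r < 1" for r
    proof -
      define z1 z2 where "z1 = of_real r * x2 * cnj x3" and "z2 = of_real r * cnj x2"
      have z: "cmod z1 = r" "cmod z2 = r" using r n2 x3 by (simp_all add: z1_def z2_def norm_mult)
      have "tetra_den x1 x2 x3 z1 z2
          = 1 - of_real r * (x2 * cnj x2) * (x3 * cnj x3) - of_real r * (x2 * cnj x2)
            + (of_real r)\<^sup>2 * (x2 * cnj x2) * (x3 * cnj x3)"
        unfolding x1 z1_def z2_def by (simp add: algebra_simps power2_eq_square)
      also have "\<dots> = of_real ((1 - r)\<^sup>2)" unfolding c2 c3 by (simp add: power2_eq_square algebra_simps)
      finally have "cmod (tetra_den x1 x2 x3 z1 z2) = (1 - r)\<^sup>2"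
        by (simp only: norm_of_real) simp
      moreover have "sqrt ((1 - r\<^sup>2) * (1 - r\<^sup>2)) = 1 - r\<^sup>2"
        using r by (simp add: power_le_one)
      ultimately have "cmod a * (1 - r\<^sup>2) \<le> (1 - r)\<^sup>2" using low[of z1 z2] r unfolding z by simp
      then have "(cmod a * (1 + r)) * (1 - r) \<le> (1 - r) * (1 - r)"
        by (simp add: power2_eq_square algebra_simps)
      then have "cmod a * (1 + r) \<le> 1 - r" using r by simp
      moreover have "cmod a * 1 \<le> cmod a * (1 + r)" using r by (intro mult_left_mono) auto
      ultimately show ?thesis by simp
    qed
    have "cmod a \<le> 0"
    proof (rule field_le_epsilon)
      fix e :: real assume "e > 0"
      then have "cmod a \<le> min e 1" using a[of "1 - min e 1"] by simp
      then show "cmod a \<le> 0 + e" by simp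
    qed
    then show ?thesis by (simp add: n2)
  qed
qed

text \<open>A point \<open>(a, x)\<close> has a second parameter \<open>b\<close> besides \<open>w\<close>, given by \<open>a q = \<rho> b\<close> with \<open>q\<close> the denominator and
  \<open>\<rho> = bidisc_weight \<alpha> \<beta>\<close>. Testing the definition of the hexablock at \<open>(cnj \<alpha>, cnj \<beta>)\<close>, where the weighted
  supremum is attained, gives \<open>\<bar>b\<bar> < 1\<close>. Moving \<open>b\<close> and \<open>w\<close> by Moebius maps of the same variable gives a disc
  whose boundary values have \<open>\<bar>b\<bar> = \<bar>w\<bar> = 1\<close>. On the set \<open>x3 = p3\<close>, the closure satisfies
  \<open>\<bar>a\<bar>\<^sup>2 + \<bar>x2\<bar>\<^sup>2 \<le> 1\<close>, so that the peak function of the ball in \<open>(a, x2)\<close> serves as \<open>G\<close>.\<close>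

lemma distinguished_boundary_hexablock:
  "distinguished_boundary hexablock
    = {y. cmod (y $ 4) = 1 \<and> y $ 2 = cnj (y $ 3) * y $ 4 \<and> (cmod (y $ 1))\<^sup>2 + (cmod (y $ 2))\<^sup>2 = 1}"
  (is "_ = ?B")
proof (rule distinguished_boundary_eqI)
  show "bounded hexablock"
  proof (rule bounded_cvecI)
    fix y :: "complex ^ 4" and i assume "y \<in> hexablock"
    then have "hexa_shell (y $ 1) (y $ 2) (y $ 3) (y $ 4)" by (rule hexablock_shell)
    then have "cmod (y $ 1) \<le> 1" "tetra_shell (y $ 2) (y $ 3) (y $ 4)"
      by (rule hexa_shell_cmod, simp add: hexa_shell_def)
    then have "cmod (y $ 1) \<le> 1" "cmod (y $ 2) \<le> 1" "cmod (y $ 3) \<le> 1" "cmod (y $ 4) \<le> 1"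
      unfolding tetra_shell_def by blast+
    then show "cmod (y $ i) \<le> 1" using exhaust_4[of i] by metis
  qed
  show "closed ?B"
    by (intro closed_Collect_conj closed_Collect_eq closed_Collect_le continuous_intros)
  show "?B \<noteq> {}"
  proof -
    have "vector [1, 0, 0, 1] \<in> ?B" by (simp add: vector_4)
    then show ?thesis by blast
  qed
  show "?B \<subseteq> closure hexablock"
  proof
    fix y assume "y \<in> ?B"
    then have y: "cmod (y $ 4) = 1" "y $ 2 = cnj (y $ 3) * y $ 4" "(cmod (y $ 1))\<^sup>2 + (cmod (y $ 2))\<^sup>2 = 1" by auto
    have n: "cmod (y $ 2) = cmod (y $ 3)" using y(1,2) by (simp add: norm_mult)
    have a2: "(cmod (y $ 1))\<^sup>2 = 1 - (cmod (y $ 3))\<^sup>2" using y(3) n by simp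
    then have "(cmod (y $ 3))\<^sup>2 \<le> 1" by (metis diff_ge_0_iff_ge zero_le_power2)
    then have y3: "cmod (y $ 3) \<le> 1" by (simp add: abs_square_le_1)
    have a: "cmod (y $ 1) = sqrt (1 - (cmod (y $ 3))\<^sup>2)" using a2 by (metis norm_ge_zero real_sqrt_unique)
    show "y \<in> closure hexablock"
    proof (rule radial_limit_in_closure[where g = "\<lambda>r. vector [of_real r * y $ 1, of_real r * y $ 2,
          of_real r * y $ 3, (of_real r)\<^sup>2 * y $ 4]"])
      fix r :: real assume r: "0 < r" "r < 1"
      note den = tetra_scaled_denominator[OF y(1,2) y3 r]
      show "vector [of_real r * y $ 1, of_real r * y $ 2, of_real r * y $ 3, (of_real r)\<^sup>2 * y $ 4] \<in> hexablock"
        unfolding mem_hexablock mem_tetrablock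
      proof (intro conjI allI impI exI[of _ r])
        fix z1 z2 :: complex assume z: "cmod z1 < 1" "cmod z2 < 1"
        show "cmod (of_real r * y $ 1) * bidisc_weight z1 z2
          \<le> r * cmod (1 - of_real r * y $ 2 * z1 - of_real r * y $ 3 * z2 + (of_real r)\<^sup>2 * y $ 4 * z1 * z2)"
          using mult_left_mono[OF den(1)[of z1 z2], of r] z r by (simp add: norm_mult a mult.assoc)
      qed (use r den(2) in auto)
    next
      fix i :: 4
      show "continuous_on UNIV (\<lambda>r. (vector [of_real r * y $ 1, of_real r * y $ 2,
          of_real r * y $ 3, (of_real r)\<^sup>2 * y $ 4] :: complex ^ 4) $ i)"
        using exhaust_4[of i] by (elim disjE; hypsubst; simp only: vector_4; intro continuous_intros)
    qed (simp add: vec_eq_iff forall_4 vector_4)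
  qed
  fix y assume yH: "y \<in> hexablock"
  then obtain a x1 x2 x3 where y: "y = vector [a, x1, x2, x3]" by (auto simp: hexablock_def)
  obtain c where c: "c < 1" "\<And>z1 z2. cmod z1 < 1 \<Longrightarrow> cmod z2 < 1 \<Longrightarrow>
      cmod a * bidisc_weight z1 z2
        \<le> c * cmod (tetra_den x1 x2 x3 z1 z2)"
    and x: "vector [x1, x2, x3] \<in> tetrablock"
    using yH unfolding y mem_hexablock by blast
  obtain \<alpha> \<beta> w where \<alpha>: "cmod \<alpha> < 1" and \<beta>: "cmod \<beta> < 1" and w: "cmod w < 1"
    and p: "tetra_param \<alpha> \<beta> w x1 x2 x3"
    using tetrablock_param[OF x] by blast
  define \<rho> where "\<rho> = bidisc_weight \<alpha> \<beta>"
  have \<rho>pos: "0 < (1 - (cmod \<alpha>)\<^sup>2) * (1 - (cmod \<beta>)\<^sup>2)"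
    using \<alpha> \<beta> by (simp add: abs_square_less_1)
  then have \<rho>: "\<rho> > 0" and \<rho>2: "\<rho>\<^sup>2 = (1 - (cmod \<alpha>)\<^sup>2) * (1 - (cmod \<beta>)\<^sup>2)"
    unfolding \<rho>_def by (simp, intro real_sqrt_pow2 less_imp_le)
  define q0 where "q0 = tetra_scale \<alpha> \<beta> w"
  have q0: "q0 \<noteq> 0" unfolding q0_def using tetra_param_nonzero \<alpha> \<beta> w by simp
  define b where "b = a * q0 / of_real \<rho>"
  have b: "cmod b < 1"
  proof -
    have "(tetra_den x1 x2 x3 (cnj \<alpha>) (cnj \<beta>)) * q0
        = (1 - \<alpha> * cnj \<alpha>) * (1 - \<beta> * cnj \<beta>)"
      unfolding q0_def tetra_param_denominator[OF p] by simp
    also have "\<dots> = of_real (\<rho>\<^sup>2)" unfolding \<rho>2 by (simp add: complex_norm_square del: of_real_power)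
    finally have den: "cmod (tetra_den x1 x2 x3 (cnj \<alpha>) (cnj \<beta>)) * cmod q0 = \<rho>\<^sup>2"
      by (metis norm_mult norm_of_real abs_of_nonneg zero_le_power2)
    have "cmod a * \<rho> \<le> c * cmod (tetra_den x1 x2 x3 (cnj \<alpha>) (cnj \<beta>))"
      using c(2)[of "cnj \<alpha>" "cnj \<beta>"] \<alpha> \<beta> by (simp add: \<rho>_def)
    then have "cmod a * \<rho> * cmod q0
        \<le> (c * cmod (tetra_den x1 x2 x3 (cnj \<alpha>) (cnj \<beta>))) * cmod q0"
      by (rule mult_right_mono) simp
    also have "\<dots> = c * \<rho>\<^sup>2" unfolding den[symmetric] by simp
    also have "\<dots> < 1 * \<rho>\<^sup>2" using c(1) \<rho> by (intro mult_strict_right_mono) auto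
    finally have "(cmod a * cmod q0) * \<rho> < \<rho> * \<rho>" by (simp add: power2_eq_square mult_ac)
    then have "cmod a * cmod q0 < \<rho>" using \<rho> by simp
    then show ?thesis using \<rho> by (simp add: b_def norm_mult norm_divide)
  qed
  define q where "q \<zeta> = tetra_scale \<alpha> \<beta> (mobius w \<zeta>)" for \<zeta>
  define \<phi> where "\<phi> \<zeta> = (vector [of_real \<rho> * mobius b \<zeta> / q \<zeta>, (\<alpha> + cnj \<beta> * mobius w \<zeta>) / q \<zeta>,
    (\<beta> + cnj \<alpha> * mobius w \<zeta>) / q \<zeta>, (mobius w \<zeta> + \<alpha> * \<beta>) / q \<zeta>] :: complex ^ 4)" for \<zeta>
  note m = mobius_props[OF w] and mb = mobius_props[OF b]
  have m1: "cmod (mobius w \<zeta>) \<le> 1" if "\<zeta> \<in> cball 0 1" for \<zeta>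
    using m(2,3)[of \<zeta>] that by (auto simp: le_less)
  have par: "tetra_param \<alpha> \<beta> (mobius w \<zeta>) (\<phi> \<zeta> $ 2) (\<phi> \<zeta> $ 3) (\<phi> \<zeta> $ 4)" if "\<zeta> \<in> cball 0 1" for \<zeta>
    using tetra_param_exists[OF \<alpha> \<beta> m1[OF that]] by (simp add: \<phi>_def q_def vector_4)
  have qnz: "q \<zeta> \<noteq> 0" if "\<zeta> \<in> cball 0 1" for \<zeta>
    unfolding q_def by (rule tetra_param_nonzero[OF \<alpha> \<beta> m1[OF that]])
  have \<phi>1: "cmod (\<phi> \<zeta> $ 1) * cmod (q \<zeta>) = \<rho> * cmod (mobius b \<zeta>)" if "\<zeta> \<in> cball 0 1" for \<zeta>
    using qnz[OF that] \<rho> by (simp add: \<phi>_def vector_4 norm_mult norm_divide)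
  have mh: "(\<lambda>\<zeta>. mobius w \<zeta>) holomorphic_on ball 0 1" "(\<lambda>\<zeta>. mobius b \<zeta>) holomorphic_on ball 0 1"
    and mc: "continuous_on (cball 0 1) (\<lambda>\<zeta>. mobius w \<zeta>)" "continuous_on (cball 0 1) (\<lambda>\<zeta>. mobius b \<zeta>)"
    using m(4,5) mb(4,5) by auto
  have qh: "q holomorphic_on ball 0 1" and qc: "continuous_on (cball 0 1) q"
    unfolding q_def by (intro holomorphic_intros mh, intro continuous_intros mc)
  show "disc_through hexablock ?B y"
    unfolding disc_through_def
  proof (intro exI[of _ \<phi>] conjI allI)
    have q00: "q 0 = q0" by (simp add: q_def q0_def m(1))
    have "x1 * q0 = \<alpha> + cnj \<beta> * w" "x2 * q0 = \<beta> + cnj \<alpha> * w" "x3 * q0 = w + \<alpha> * \<beta>"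
      using p by (auto simp: tetra_param_def q0_def)
    moreover have "of_real \<rho> * b / q0 = a" using q0 \<rho> by (simp add: b_def)
    ultimately show "\<phi> 0 = y"
      using q0 by (simp add: \<phi>_def y q00 m(1) mb(1) vec_eq_iff forall_4 vector_4 nonzero_eq_divide_eq[OF q0]
          flip: \<open>x1 * q0 = _\<close> \<open>x2 * q0 = _\<close> \<open>x3 * q0 = _\<close>)
    have "\<forall>i. (\<lambda>\<zeta>. \<phi> \<zeta> $ i) holomorphic_on ball 0 1"
      unfolding forall_4 \<phi>_def vector_4
      by (intro conjI holomorphic_intros mh qh) (use qnz in auto)
    then show "(\<lambda>\<zeta>. \<phi> \<zeta> $ i) holomorphic_on ball 0 1" for i by blast
    have "\<forall>i. continuous_on (cball 0 1) (\<lambda>\<zeta>. \<phi> \<zeta> $ i)"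
      unfolding forall_4 \<phi>_def vector_4
      by (intro conjI continuous_intros mc qc) (use qnz in auto)
    then show "continuous_on (cball 0 1) (\<lambda>\<zeta>. \<phi> \<zeta> $ i)" for i by blast
  next
    show "\<phi> ` ball 0 1 \<subseteq> hexablock"
    proof (rule image_subsetI)
      fix \<zeta> :: complex assume "\<zeta> \<in> ball 0 1"
      then have \<zeta>: "cmod \<zeta> < 1" "\<zeta> \<in> cball 0 1" by auto
      have v: "\<phi> \<zeta> = vector [\<phi> \<zeta> $ 1, \<phi> \<zeta> $ 2, \<phi> \<zeta> $ 3, \<phi> \<zeta> $ 4]"
        by (simp add: vec_eq_iff forall_4 vector_4)
      have "vector [\<phi> \<zeta> $ 1, \<phi> \<zeta> $ 2, \<phi> \<zeta> $ 3, \<phi> \<zeta> $ 4] \<in> hexablock"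
        unfolding mem_hexablock
      proof (intro conjI exI[of _ "cmod (mobius b \<zeta>)"] allI impI)
        show "vector [\<phi> \<zeta> $ 2, \<phi> \<zeta> $ 3, \<phi> \<zeta> $ 4] \<in> tetrablock"
          by (rule tetra_param_in_tetrablock[OF \<alpha> \<beta> m(2) par]) (use \<zeta> in auto)
        show "cmod (mobius b \<zeta>) < 1" by (rule mb(2)[OF \<zeta>(1)])
        fix z1 z2 :: complex assume z: "cmod z1 < 1" "cmod z2 < 1"
        define D where "D = cmod (tetra_den (\<phi> \<zeta> $ 2) (\<phi> \<zeta> $ 3) (\<phi> \<zeta> $ 4) z1 z2)"
        define S where "S = bidisc_weight z1 z2"
        have "\<rho> * S \<le> D * cmod (q \<zeta>)"
          unfolding \<rho>_def D_def S_def q_def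
          by (rule tetra_param_denominator_lower[OF \<alpha> \<beta> m1 _ _ par]) (use \<zeta> z in auto)
        then have "cmod (mobius b \<zeta>) * (\<rho> * S) \<le> cmod (mobius b \<zeta>) * (D * cmod (q \<zeta>))"
          by (rule mult_left_mono) simp
        then have "(cmod (\<phi> \<zeta> $ 1) * S) * cmod (q \<zeta>) \<le> (cmod (mobius b \<zeta>) * D) * cmod (q \<zeta>)"
          using \<phi>1[OF \<zeta>(2)] by (simp add: mult_ac)
        then show "cmod (\<phi> \<zeta> $ 1) * S \<le> cmod (mobius b \<zeta>) * D"
          using qnz[OF \<zeta>(2)] by simp
      qed
      then show "\<phi> \<zeta> \<in> hexablock" using v by simp
    qed
    show "\<phi> ` sphere 0 1 \<subseteq> ?B"
    proof (rule image_subsetI)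
      fix \<zeta> :: complex assume "\<zeta> \<in> sphere 0 1"
      then have \<zeta>: "cmod \<zeta> = 1" "\<zeta> \<in> cball 0 1" by auto
      note tb = tetra_param_boundary[OF \<alpha> \<beta> m(3)[OF \<zeta>(1)] par[OF \<zeta>(2)], folded q_def]
      have "(cmod (\<phi> \<zeta> $ 1))\<^sup>2 * (cmod (q \<zeta>))\<^sup>2 = (1 - (cmod (\<phi> \<zeta> $ 2))\<^sup>2) * (cmod (q \<zeta>))\<^sup>2"
        unfolding tb(3) power_mult_distrib[symmetric] \<phi>1[OF \<zeta>(2)] mb(3)[OF \<zeta>(1)] using \<rho>2 by simp
      then have "(cmod (\<phi> \<zeta> $ 1))\<^sup>2 = 1 - (cmod (\<phi> \<zeta> $ 2))\<^sup>2" using qnz[OF \<zeta>(2)] by simp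
      then show "\<phi> \<zeta> \<in> ?B" using tb(1,2) by simp
    qed
  qed
next
  fix p assume "p \<in> ?B"
  then have p: "cmod (p $ 4) = 1" "p $ 2 = cnj (p $ 3) * p $ 4" "(cmod (p $ 1))\<^sup>2 + (cmod (p $ 2))\<^sup>2 = 1" by auto
  have p13: "(cmod (p $ 1))\<^sup>2 + (cmod (p $ 3))\<^sup>2 = 1" using p by (simp add: norm_mult)
  define h where "h x = (1 + cnj (p $ 4) * x $ 4) / 2" for x :: "complex ^ 4"
  define G where "G x = (1 + (x $ 1 * cnj (p $ 1) + x $ 3 * cnj (p $ 3))) / 2" for x :: "complex ^ 4"
  show "two_stage_peak hexablock p"
    unfolding two_stage_peak_def
  proof (rule exI[of _ h], rule exI[of _ G], intro conjI ballI impI)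
    show "continuous_on (closure hexablock) h" "continuous_on (closure hexablock) G"
      unfolding h_def G_def by (intro continuous_intros; simp)+
    show "holomorphic_in h hexablock" "holomorphic_in G hexablock"
      unfolding h_def G_def by (intro holomorphic_in_intros)+
    have "cnj (p $ 4) * p $ 4 = 1" using complex_norm_square[of "p $ 4"] p(1) by (simp add: mult.commute)
    then show "cmod (h p) = 1" by (simp add: h_def)
    have "p $ 1 * cnj (p $ 1) + p $ 3 * cnj (p $ 3) = of_real 1"
      unfolding p13[symmetric] by (simp add: complex_norm_square del: of_real_power)
    then show "cmod (G p) = 1" by (simp add: G_def)
    fix x assume "x \<in> closure hexablock"
    then have s: "hexa_shell (x $ 1) (x $ 2) (x $ 3) (x $ 4)" by (rule closure_hexablock_shell)
    then have s': "tetra_shell (x $ 2) (x $ 3) (x $ 4)" by (simp add: hexa_shell_def)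
    have x4: "cmod (x $ 4) \<le> 1" using s' by (simp add: tetra_shell_def)
    show "cmod (h x) \<le> 1" unfolding h_def by (rule peak_first_factor(1)[OF p(1) x4])
    assume "1 \<le> cmod (h x)" and G1: "1 \<le> cmod (G x)"
    then have e4: "x $ 4 = p $ 4" unfolding h_def by (intro peak_first_factor(2)[OF p(1) x4])
    have n4: "cmod (x $ 4) = 1" using e4 p(1) by simp
    have e2: "x $ 2 = cnj (x $ 3) * x $ 4" by (rule tetra_shell_boundary[OF s' n4])
    have "2 \<le> cmod (1 + (x $ 1 * cnj (p $ 1) + x $ 3 * cnj (p $ 3)))"
      using G1 by (simp add: G_def norm_divide)
    from unit_sphere_peak(2)[OF hexa_shell_boundary[OF s n4] p13 this]
    show "x = p" using e2 e4 p(2) by (simp add: vec_eq_iff forall_4)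
  qed
qed

section \<open>Operator identities from the Taylor spectrum\<close>

abbreviation joint_defect ::
  "('a::chilbert_space \<Rightarrow>\<^sub>L 'a, 'n::finite) vec \<Rightarrow> (complex, 'n) vec \<Rightarrow> 'a \<Rightarrow> real" where
  "joint_defect T l x \<equiv> (\<Sum>i\<in>UNIV. norm ((T $ i) x - l $ i *\<^sub>C x))"

text \<open>On approximate joint eigenvectors of \<open>T\<close> for \<open>l\<close>, the operator \<open>D\<close> acts approximately as the
  scalar \<open>c\<close>. For \<open>D\<close> a polynomial in the \<open>T\<^sub>i\<close> and \<open>T\<^sub>i\<^sup>*\<close>, this is its value at \<open>l\<close>.\<close>

definition joint_value ::
  "('a::chilbert_space \<Rightarrow>\<^sub>L 'a, 'n::finite) vec \<Rightarrow> (complex, 'n) vec \<Rightarrow> ('a \<Rightarrow>\<^sub>L 'a) \<Rightarrow> complex \<Rightarrow> bool"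
  where "joint_value T l D c \<longleftrightarrow>
    (\<exists>K. \<forall>x. norm (D x - c *\<^sub>C x) \<le> K * joint_defect T l x)"

lemma joint_value_component: "joint_value T l (T $ i) (l $ i)"
  unfolding joint_value_def
  by (intro exI[of _ 1] allI, unfold mult_1, rule member_le_sum) auto

lemma joint_value_hadjoint_component:
  assumes n: "normal_op (T $ i)"
  shows "joint_value T l (hadjoint (T $ i)) (cnj (l $ i))"
  unfolding joint_value_def
proof (intro exI[of _ 1] allI)
  fix x
  have c: "complex_linear (T $ i)" using n by (simp add: normal_op_def)
  have "hadjoint (T $ i - scalar_op (l $ i)) = hadjoint (T $ i) - scalar_op (cnj (l $ i))"
    by (simp add: hadjoint_diff c complex_linear_scalar_op hadjoint_scalar_op)
  then have "norm (hadjoint (T $ i) x - cnj (l $ i) *\<^sub>C x) = norm ((T $ i) x - l $ i *\<^sub>C x)"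
    using norm_hadjoint_normal[OF normal_op_diff_scalar[OF n], of "l $ i" x] by (simp add: blinfun.diff_left)
  also have "\<dots> \<le> joint_defect T l x"
    by (rule member_le_sum) auto
  finally show "norm (hadjoint (T $ i) x - cnj (l $ i) *\<^sub>C x)
      \<le> 1 * joint_defect T l x" by simp
qed

lemma joint_value_id: "joint_value T l id_blinfun 1"
  unfolding joint_value_def by (intro exI[of _ 0]) simp

lemma joint_value_compose:
  assumes D: "complex_linear D" and "joint_value T l D c" "joint_value T l E d"
  shows "joint_value T l (D o\<^sub>L E) (c * d)"
proof -
  define w where "w x = joint_defect T l x" for x
  obtain K L where K: "\<And>x. norm (D x - c *\<^sub>C x) \<le> K * w x" and L: "\<And>x. norm (E x - d *\<^sub>C x) \<le> L * w x"
    using assms(2,3) unfolding joint_value_def w_def by blast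
  have "norm ((D o\<^sub>L E) x - (c * d) *\<^sub>C x) \<le> (norm D * L + cmod d * K) * w x" for x
  proof -
    have "(D o\<^sub>L E) x - (c * d) *\<^sub>C x = D (E x - d *\<^sub>C x) + d *\<^sub>C (D x - c *\<^sub>C x)"
      by (simp add: blinfun.diff_right complex_linearD[OF D] scaleC_diff_right scaleC_scaleC mult.commute)
    then have "norm ((D o\<^sub>L E) x - (c * d) *\<^sub>C x) \<le> norm (D (E x - d *\<^sub>C x)) + norm (d *\<^sub>C (D x - c *\<^sub>C x))"
      by (simp add: norm_triangle_ineq)
    also have "\<dots> \<le> norm D * norm (E x - d *\<^sub>C x) + cmod d * norm (D x - c *\<^sub>C x)"
      by (simp add: norm_blinfun norm_scaleC)
    also have "\<dots> \<le> norm D * (L * w x) + cmod d * (K * w x)"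
      by (intro add_mono mult_left_mono K L) auto
    finally show ?thesis by (simp add: algebra_simps)
  qed
  then show ?thesis unfolding joint_value_def w_def by blast
qed

lemma joint_value_diff:
  assumes "joint_value T l D c" "joint_value T l E d"
  shows "joint_value T l (D - E) (c - d)"
proof -
  define w where "w x = joint_defect T l x" for x
  obtain K L where K: "\<And>x. norm (D x - c *\<^sub>C x) \<le> K * w x" and L: "\<And>x. norm (E x - d *\<^sub>C x) \<le> L * w x"
    using assms unfolding joint_value_def w_def by blast
  have "norm ((D - E) x - (c - d) *\<^sub>C x) \<le> (K + L) * w x" for x
  proof -
    have "(D - E) x - (c - d) *\<^sub>C x = (D x - c *\<^sub>C x) - (E x - d *\<^sub>C x)"
      by (simp add: blinfun.diff_left scaleC_diff_left)
    then have "norm ((D - E) x - (c - d) *\<^sub>C x) \<le> norm (D x - c *\<^sub>C x) + norm (E x - d *\<^sub>C x)"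
      by (simp add: norm_triangle_ineq4)
    also have "\<dots> \<le> K * w x + L * w x" by (intro add_mono K L)
    finally show ?thesis by (simp add: algebra_simps)
  qed
  then show ?thesis unfolding joint_value_def w_def by blast
qed

lemma joint_value_add:
  assumes "joint_value T l D c" "joint_value T l E d"
  shows "joint_value T l (D + E) (c + d)"
proof -
  have "joint_value T l 0 0" unfolding joint_value_def by (intro exI[of _ 0]) simp
  then have "joint_value T l (D - (0 - E)) (c - (0 - d))" by (intro joint_value_diff assms)
  then show ?thesis by simp
qed

lemma approx_null_sequence:
  assumes "approx_null F"
  shows "\<exists>x. (\<forall>k. norm (x k) = 1) \<and> (\<forall>E\<in>F. (\<lambda>k. E (x k)) \<longlonglongrightarrow> 0)"
proof -
  have "\<exists>x. norm x = 1 \<and> (\<forall>E\<in>F. norm (E x) \<le> inverse (real (Suc k)))" for k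
    using approx_nullD[OF assms, of "inverse (real (Suc k))"] by simp
  then obtain x where x: "\<And>k. norm (x k) = 1" "\<And>k E. E \<in> F \<Longrightarrow> norm (E (x k)) \<le> inverse (real (Suc k))"
    by metis
  have "(\<lambda>k. E (x k)) \<longlonglongrightarrow> 0" if "E \<in> F" for E
    by (rule Lim_null_comparison[OF _ LIMSEQ_inverse_real_of_nat]) (use x(2)[OF that] in auto)
  then show ?thesis using x(1) by blast
qed

lemma joint_value_limit:
  fixes T :: "('a::chilbert_space \<Rightarrow>\<^sub>L 'a, 'n::finite) vec" and x :: "nat \<Rightarrow> 'a"
  assumes x: "\<And>k. norm (x k) = 1" "\<And>i. (\<lambda>k. (T $ i - scalar_op (l $ i)) (x k)) \<longlonglongrightarrow> 0"
    and D: "joint_value T l D c"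
  shows "(\<lambda>k. norm (D (x k))) \<longlonglongrightarrow> cmod c"
proof -
  obtain K where K: "\<And>y. norm (D y - c *\<^sub>C y) \<le> K * joint_defect T l y"
    using D unfolding joint_value_def by blast
  have "(\<lambda>k. norm ((T $ i) (x k) - l $ i *\<^sub>C x k)) \<longlonglongrightarrow> 0" for i
    using tendsto_norm[OF x(2)[of i]] by (simp add: blinfun.diff_left)
  then have "(\<lambda>k. \<Sum>i\<in>UNIV. norm ((T $ i) (x k) - l $ i *\<^sub>C x k)) \<longlonglongrightarrow> (\<Sum>i\<in>(UNIV :: 'n set). 0)"
    by (intro tendsto_sum)
  from tendsto_mult_left[OF this, of K]
  have lim: "(\<lambda>k. K * joint_defect T l (x k)) \<longlonglongrightarrow> 0" by simp
  have "(\<lambda>k. norm (D (x k)) - cmod c) \<longlonglongrightarrow> 0"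
  proof (rule Lim_null_comparison[OF _ lim], rule always_eventually, rule allI)
    fix k
    have "\<bar>norm (D (x k)) - norm (c *\<^sub>C x k)\<bar> \<le> norm (D (x k) - c *\<^sub>C x k)" by (rule norm_triangle_ineq3)
    also have "\<dots> \<le> K * joint_defect T l (x k)" by (rule K)
    finally show "norm (norm (D (x k)) - cmod c) \<le> K * joint_defect T l (x k)"
      by (simp add: norm_scaleC x(1))
  qed
  then show ?thesis by (simp add: LIM_zero_iff)
qed

lemma joint_value_le_norm:
  fixes T :: "('a::chilbert_space \<Rightarrow>\<^sub>L 'a, 'n::{finite,linorder}) vec"
  assumes comm: "commuting_tuple T" and normal: "\<And>i. normal_op (T $ i)"
    and l: "l \<in> taylor_spectrum T" and D: "joint_value T l D c"
  shows "cmod c \<le> norm D"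
proof -
  have "approx_null (range (\<lambda>i. T $ i - scalar_op (l $ i)))"
    using taylor_spectrum_normal_iff[OF comm normal] l by blast
  from approx_null_sequence[OF this] obtain x :: "nat \<Rightarrow> 'a"
    where x: "\<And>k. norm (x k) = 1" "\<And>i. (\<lambda>k. (T $ i - scalar_op (l $ i)) (x k)) \<longlonglongrightarrow> 0"
    by blast
  have "norm (D (x k)) \<le> norm D" for k using norm_blinfun[of D "x k"] x(1)[of k] by simp
  then show ?thesis by (intro LIMSEQ_le_const2[OF joint_value_limit[OF x D]]) auto
qed

definition star_commutes ::
  "('a::chilbert_space \<Rightarrow>\<^sub>L 'a) \<Rightarrow> ('a \<Rightarrow>\<^sub>L 'a, 'n::finite) vec \<Rightarrow> bool" where
  "star_commutes D T \<longleftrightarrow> complex_linear D \<and>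
    (\<forall>i. D o\<^sub>L T $ i = T $ i o\<^sub>L D \<and> D o\<^sub>L hadjoint (T $ i) = hadjoint (T $ i) o\<^sub>L D)"

lemma star_commutes_add: "star_commutes D T \<Longrightarrow> star_commutes E T \<Longrightarrow> star_commutes (D + E) T"
  by (auto simp: star_commutes_def complex_linear_add bounded_bilinear.add_left[OF bounded_bilinear_blinfun_compose]
      bounded_bilinear.add_right[OF bounded_bilinear_blinfun_compose])

lemma star_commutes_diff: "star_commutes D T \<Longrightarrow> star_commutes E T \<Longrightarrow> star_commutes (D - E) T"
  by (auto simp: star_commutes_def complex_linear_diff bounded_bilinear.diff_left[OF bounded_bilinear_blinfun_compose]
      bounded_bilinear.diff_right[OF bounded_bilinear_blinfun_compose])

lemma star_commutes_id: "star_commutes id_blinfun T"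
  by (auto simp: star_commutes_def complex_linear_id intro!: blinfun_eqI)

lemma star_commutes_compose:
  assumes "star_commutes D T" "star_commutes E T"
  shows "star_commutes (D o\<^sub>L E) T"
proof -
  have c: "(D o\<^sub>L E) o\<^sub>L S = S o\<^sub>L (D o\<^sub>L E)" if "D o\<^sub>L S = S o\<^sub>L D" "E o\<^sub>L S = S o\<^sub>L E" for S
    using that by (intro blinfun_eqI) (simp add: commute_apply)
  show ?thesis using assms c unfolding star_commutes_def by (auto intro: complex_linear_compose)
qed

lemma star_commutes_hadjoint:
  assumes D: "star_commutes D T" and T: "\<And>i. complex_linear (T $ i)"
  shows "star_commutes (hadjoint D) T"
proof -
  have cD: "complex_linear D" using D by (simp add: star_commutes_def)
  have "hadjoint D o\<^sub>L T $ i = T $ i o\<^sub>L hadjoint D" for i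
    using commute_hadjoint[OF cD complex_linear_hadjoint[OF T], of i] D T
    by (simp add: star_commutes_def)
  moreover have "hadjoint D o\<^sub>L hadjoint (T $ i) = hadjoint (T $ i) o\<^sub>L hadjoint D" for i
    using commute_hadjoint[OF cD T, of i] D by (simp add: star_commutes_def)
  ultimately show ?thesis using cD by (simp add: star_commutes_def complex_linear_hadjoint)
qed

lemma star_commutes_component:
  assumes "commuting_tuple T" "\<And>i. normal_op (T $ i)"
  shows "star_commutes (T $ i) T"
proof -
  have c: "complex_linear (T $ i)" for i using assms by (simp add: commuting_tuple_def)
  have cm: "T $ i o\<^sub>L T $ j = T $ j o\<^sub>L T $ i" for i j using assms by (simp add: commuting_tuple_def)
  have "hadjoint (T $ j) o\<^sub>L T $ i = T $ i o\<^sub>L hadjoint (T $ j)" for i j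
    by (rule Fuglede[OF assms(2) c cm])
  then show ?thesis using c cm by (simp add: star_commutes_def)
qed

text \<open>Start from approximate eigenvectors of \<open>D\<^sup>* D\<close> for \<open>\<parallel>D\<parallel>\<^sup>2\<close> and refine them to approximate joint
  eigenvectors of \<open>T\<close>.\<close>

lemma spectrum_attains_norm:
  fixes T :: "('a::chilbert_space \<Rightarrow>\<^sub>L 'a, 'n::{finite,linorder}) vec"
  assumes comm: "commuting_tuple T" and normal: "\<And>i. normal_op (T $ i)"
    and D: "star_commutes D T" and nz: "D \<noteq> 0"
  shows "\<exists>l\<in>taylor_spectrum T. \<forall>c. joint_value T l D c \<longrightarrow> cmod c = norm D"
proof -
  have cT: "complex_linear (T $ i)" for i using normal by (simp add: normal_op_def)
  have cD: "complex_linear D" using D by (simp add: star_commutes_def)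
  define m where "m = (norm D)\<^sup>2"
  define P where "P = hadjoint D o\<^sub>L D"
  define E where "E = P - scalar_op (of_real m)"
  have "star_commutes P T"
    unfolding P_def by (intro star_commutes_compose star_commutes_hadjoint D cT)
  moreover have "star_commutes (scalar_op (of_real m)) T"
    using cT by (auto simp: star_commutes_def complex_linear_scalar_op complex_linearD
        complex_linear_hadjoint intro!: blinfun_eqI)
  ultimately have E: "star_commutes E T" unfolding E_def by (rule star_commutes_diff)
  have an: "approx_null {E}"
    unfolding E_def P_def m_def by (rule approx_null_norm_square[OF cD nz])
  have "\<exists>l. approx_null ({E} \<union> (\<lambda>i. T $ i - scalar_op (l i)) ` UNIV)"
    using comm E
    by (intro approx_null_extend_tuple[OF finite an normal])
      (auto simp: commuting_tuple_def star_commutes_def)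
  then obtain l where "approx_null ({E} \<union> (\<lambda>i. T $ i - scalar_op (l i)) ` UNIV)" by blast
  then have l: "approx_null ({E} \<union> range (\<lambda>i. T $ i - scalar_op (vec_lambda l $ i)))" by simp
  have spec: "vec_lambda l \<in> taylor_spectrum T"
    using taylor_spectrum_normal_iff[OF comm normal] approx_null_mono[OF l] by blast
  obtain x where x: "\<And>k. norm (x k) = 1" "(\<lambda>k. E (x k)) \<longlonglongrightarrow> 0"
    "\<And>i. (\<lambda>k. (T $ i - scalar_op (vec_lambda l $ i)) (x k)) \<longlonglongrightarrow> 0"
    using approx_null_sequence[OF l] by blast
  have "(\<lambda>k. (norm (D (x k)))\<^sup>2 - m) \<longlonglongrightarrow> 0"
  proof (rule Lim_null_comparison[OF _ tendsto_norm_zero[OF x(2)]], rule always_eventually, rule allI)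
    fix k
    have "(norm (D (x k)))\<^sup>2 - m = Re (cinner (E (x k)) (x k))"
      by (simp add: E_def P_def blinfun.diff_left cinner_simps cinner_hadjoint_left cD cinner_self x(1)
          flip: of_real_power)
    then show "norm ((norm (D (x k)))\<^sup>2 - m) \<le> norm (E (x k))"
      using Re_cinner_le[of "E (x k)" "x k"] x(1)[of k] by simp
  qed
  then have "(\<lambda>k. (norm (D (x k)))\<^sup>2) \<longlonglongrightarrow> m" by (simp add: LIM_zero_iff)
  moreover have "(\<lambda>k. (norm (D (x k)))\<^sup>2) \<longlonglongrightarrow> (cmod c)\<^sup>2" if "joint_value T (vec_lambda l) D c" for c
    by (intro tendsto_power joint_value_limit[OF x(1,3) that])
  ultimately have "(cmod c)\<^sup>2 = (norm D)\<^sup>2" if "joint_value T (vec_lambda l) D c" for c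
    using that LIMSEQ_unique unfolding m_def by blast
  then have "cmod c = norm D" if "joint_value T (vec_lambda l) D c" for c
    using that by (simp add: power2_eq_iff_nonneg)
  then show ?thesis using spec by blast
qed

text \<open>If \<open>D \<noteq> 0\<close>, then \<open>c\<close> takes a value of modulus \<open>\<parallel>D\<parallel>\<close> on the spectrum.\<close>

lemma spectrum_subset_zeros_iff:
  assumes "commuting_tuple T" "\<And>i. normal_op (T $ i)" "star_commutes D T"
    and j: "\<And>l. joint_value T l D (c l)"
  shows "taylor_spectrum T \<subseteq> {l. c l = 0} \<longleftrightarrow> D = 0"
proof
  assume S: "taylor_spectrum T \<subseteq> {l. c l = 0}"
  show "D = 0"
  proof (rule ccontr)
    assume "D \<noteq> 0"
    from spectrum_attains_norm[OF assms(1-3) this] obtain l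
      where "l \<in> taylor_spectrum T" "cmod (c l) = norm D" using j by blast
    then show False using S \<open>D \<noteq> 0\<close> by auto
  qed
next
  assume "D = 0"
  then show "taylor_spectrum T \<subseteq> {l. c l = 0}"
    using joint_value_le_norm[OF assms(1,2) _ j] by force
qed

lemma spectrum_subset_disc_iff:
  assumes "commuting_tuple T" "\<And>i. normal_op (T $ i)"
  shows "taylor_spectrum T \<subseteq> {l. cmod (l $ i) \<le> 1} \<longleftrightarrow> norm (T $ i) \<le> 1"
proof
  assume S: "taylor_spectrum T \<subseteq> {l. cmod (l $ i) \<le> 1}"
  show "norm (T $ i) \<le> 1"
  proof (cases "T $ i = 0")
    case False
    from spectrum_attains_norm[OF assms star_commutes_component[OF assms] this]
    obtain l where "l \<in> taylor_spectrum T" "cmod (l $ i) = norm (T $ i)"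
      using joint_value_component by blast
    then show ?thesis using S by auto
  qed simp
next
  assume "norm (T $ i) \<le> 1"
  then show "taylor_spectrum T \<subseteq> {l. cmod (l $ i) \<le> 1}"
    using joint_value_le_norm[OF assms _ joint_value_component, of _ i] by (auto intro: order_trans)
qed

section \<open>Unitary tuples for the three domains\<close>

lemma cnj_mult_self_add_eq_1:
  "cnj z * z + cnj w * w - 1 = 0 \<longleftrightarrow> (cmod z)\<^sup>2 + (cmod w)\<^sup>2 = 1"
proof -
  have "cnj z * z + cnj w * w - 1 = of_real ((cmod z)\<^sup>2 + (cmod w)\<^sup>2 - 1)"
    by (simp add: complex_norm_square mult.commute del: of_real_power)
  then show ?thesis by (metis diff_eq_diff_eq of_real_eq_0_iff right_minus_eq)
qed

lemma cnj_mult_self_eq_1: "cnj z * z - 1 = 0 \<longleftrightarrow> cmod z = 1"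
  using cnj_mult_self_add_eq_1[of z 0]
  by (auto simp: power2_eq_1_iff) (metis norm_ge_zero neg_0_le_iff_le not_one_le_zero)

text \<open>Each of the following three lemmas writes the distinguished boundary as the common zero set of
  polynomials in the coordinates and their conjugates (and a disc, for the tetrablock), and replaces
  the coordinates by the operators.\<close>

lemma tetrablock_unitary_iff:
  fixes N1 N2 N3 :: "'a::chilbert_space \<Rightarrow>\<^sub>L 'a"
  defines "T \<equiv> vector [N1, N2, N3] :: ('a \<Rightarrow>\<^sub>L 'a) ^ 3"
  shows "domain_unitary tetrablock T \<longleftrightarrow> commuting_tuple T \<and> (\<forall>i. normal_op (T $ i)) \<and>
    hadjoint N3 o\<^sub>L N3 = id_blinfun \<and> N1 = hadjoint N2 o\<^sub>L N3 \<and> norm N2 \<le> 1"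
proof (cases "commuting_tuple T \<and> (\<forall>i. normal_op (T $ i))")
  case True
  have T: "T $ 1 = N1" "T $ 2 = N2" "T $ 3 = N3" by (simp_all add: T_def vector_3)
  from True have ct: "commuting_tuple T" and nt: "\<And>i. normal_op (T $ i)" by auto
  have cT: "complex_linear (T $ i)" for i using nt by (simp add: normal_op_def)
  note intros = star_commutes_diff star_commutes_compose star_commutes_id
    star_commutes_hadjoint[OF _ cT] star_commutes_component[OF ct nt]
  note jv = joint_value_diff joint_value_compose joint_value_id joint_value_component
    joint_value_hadjoint_component nt complex_linear_hadjoint cT
  have "distinguished_boundary tetrablock = {l. cnj (l $ 3) * l $ 3 - 1 = 0} \<inter>
      {l. l $ 1 - cnj (l $ 2) * l $ 3 = 0} \<inter> {l. cmod (l $ 2) \<le> 1}"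
    unfolding cnj_mult_self_eq_1 distinguished_boundary_tetrablock by auto
  moreover have "taylor_spectrum T \<subseteq> {l. cnj (l $ 3) * l $ 3 - 1 = 0} \<longleftrightarrow>
      (hadjoint (T $ 3) o\<^sub>L T $ 3) - id_blinfun = 0"
    by (rule spectrum_subset_zeros_iff[OF ct nt]) (intro intros, intro jv)
  moreover have "taylor_spectrum T \<subseteq> {l. l $ 1 - cnj (l $ 2) * l $ 3 = 0} \<longleftrightarrow>
      T $ 1 - (hadjoint (T $ 2) o\<^sub>L T $ 3) = 0"
    by (rule spectrum_subset_zeros_iff[OF ct nt]) (intro intros, intro jv)
  moreover have "taylor_spectrum T \<subseteq> {l. cmod (l $ 2) \<le> 1} \<longleftrightarrow> norm (T $ 2) \<le> 1"
    by (rule spectrum_subset_disc_iff[OF ct nt])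
  ultimately show ?thesis using True unfolding domain_unitary_def T by simp
qed (auto simp: domain_unitary_def)

lemma hexablock_unitary_iff:
  fixes N0 N1 N2 N3 :: "'a::chilbert_space \<Rightarrow>\<^sub>L 'a"
  defines "T \<equiv> vector [N0, N1, N2, N3] :: ('a \<Rightarrow>\<^sub>L 'a) ^ 4"
  shows "domain_unitary hexablock T \<longleftrightarrow> commuting_tuple T \<and> (\<forall>i. normal_op (T $ i)) \<and>
    hadjoint N3 o\<^sub>L N3 = id_blinfun \<and> N1 = hadjoint N2 o\<^sub>L N3 \<and>
    (hadjoint N0 o\<^sub>L N0) + (hadjoint N1 o\<^sub>L N1) = id_blinfun"
proof (cases "commuting_tuple T \<and> (\<forall>i. normal_op (T $ i))")
  case True
  have T: "T $ 1 = N0" "T $ 2 = N1" "T $ 3 = N2" "T $ 4 = N3" by (simp_all add: T_def vector_4)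
  from True have ct: "commuting_tuple T" and nt: "\<And>i. normal_op (T $ i)" by auto
  have cT: "complex_linear (T $ i)" for i using nt by (simp add: normal_op_def)
  note intros = star_commutes_diff star_commutes_add star_commutes_compose star_commutes_id
    star_commutes_hadjoint[OF _ cT] star_commutes_component[OF ct nt]
  note jv = joint_value_diff joint_value_add joint_value_compose joint_value_id joint_value_component
    joint_value_hadjoint_component nt complex_linear_hadjoint cT
  have "distinguished_boundary hexablock = {l. cnj (l $ 4) * l $ 4 - 1 = 0} \<inter>
      {l. l $ 2 - cnj (l $ 3) * l $ 4 = 0} \<inter> {l. cnj (l $ 1) * l $ 1 + cnj (l $ 2) * l $ 2 - 1 = 0}"
    unfolding cnj_mult_self_eq_1 cnj_mult_self_add_eq_1 distinguished_boundary_hexablock by auto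
  moreover have "taylor_spectrum T \<subseteq> {l. cnj (l $ 4) * l $ 4 - 1 = 0} \<longleftrightarrow>
      (hadjoint (T $ 4) o\<^sub>L T $ 4) - id_blinfun = 0"
    by (rule spectrum_subset_zeros_iff[OF ct nt]) (intro intros, intro jv)
  moreover have "taylor_spectrum T \<subseteq> {l. l $ 2 - cnj (l $ 3) * l $ 4 = 0} \<longleftrightarrow>
      T $ 2 - (hadjoint (T $ 3) o\<^sub>L T $ 4) = 0"
    by (rule spectrum_subset_zeros_iff[OF ct nt]) (intro intros, intro jv)
  moreover have "taylor_spectrum T \<subseteq> {l. cnj (l $ 1) * l $ 1 + cnj (l $ 2) * l $ 2 - 1 = 0} \<longleftrightarrow>
      (hadjoint (T $ 1) o\<^sub>L T $ 1) + (hadjoint (T $ 2) o\<^sub>L T $ 2) - id_blinfun = 0"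
    by (rule spectrum_subset_zeros_iff[OF ct nt]) (intro intros, intro jv)
  ultimately show ?thesis using True unfolding domain_unitary_def T by simp
qed (auto simp: domain_unitary_def)

lemma ball_unitary_iff:
  fixes N0 N1 :: "'a::chilbert_space \<Rightarrow>\<^sub>L 'a"
  defines "T \<equiv> vector [N0, N1] :: ('a \<Rightarrow>\<^sub>L 'a) ^ 2"
  shows "domain_unitary unit_ball2 T \<longleftrightarrow> commuting_tuple T \<and> (\<forall>i. normal_op (T $ i)) \<and>
    (hadjoint N0 o\<^sub>L N0) + (hadjoint N1 o\<^sub>L N1) = id_blinfun"
proof (cases "commuting_tuple T \<and> (\<forall>i. normal_op (T $ i))")
  case True
  have T: "T $ 1 = N0" "T $ 2 = N1" by (simp_all add: T_def vector_2)
  from True have ct: "commuting_tuple T" and nt: "\<And>i. normal_op (T $ i)" by auto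
  have cT: "complex_linear (T $ i)" for i using nt by (simp add: normal_op_def)
  have "taylor_spectrum T \<subseteq> {l. cnj (l $ 1) * l $ 1 + cnj (l $ 2) * l $ 2 - 1 = 0} \<longleftrightarrow>
      (hadjoint (T $ 1) o\<^sub>L T $ 1) + (hadjoint (T $ 2) o\<^sub>L T $ 2) - id_blinfun = 0"
    by (rule spectrum_subset_zeros_iff[OF ct nt])
      (intro star_commutes_diff star_commutes_add star_commutes_compose star_commutes_id
        star_commutes_hadjoint[OF _ cT] star_commutes_component[OF ct nt],
       intro joint_value_diff joint_value_add joint_value_compose joint_value_id joint_value_component
        joint_value_hadjoint_component nt complex_linear_hadjoint cT)
  then show ?thesis
    using True unfolding cnj_mult_self_add_eq_1 domain_unitary_def T distinguished_boundary_ball by simp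
qed (auto simp: domain_unitary_def)

section \<open>Normality\<close>

lemma normal_opI:
  assumes "complex_linear T" "\<And>x. hadjoint T (T x) = T (hadjoint T x)"
  shows "normal_op T"
  unfolding normal_op_def using assms by (auto intro!: blinfun_eqI)

lemma normal_op_apply: "normal_op T \<Longrightarrow> hadjoint T (T x) = T (hadjoint T x)"
  unfolding normal_op_def by (auto intro: commute_apply)

lemma normal_op_hadjoint: "normal_op T \<Longrightarrow> normal_op (hadjoint T)"
  by (rule normal_opI) (simp_all add: normal_op_apply complex_linear_hadjoint normal_op_def)

lemma normal_op_normal_extension:
  fixes T :: "'a::chilbert_space \<Rightarrow>\<^sub>L 'a"
  assumes "normal_op T"
  shows "normal_extension_in TYPE('k::chilbert_space) T"
proof -
  have cT: "complex_linear T" using assms by (simp add: normal_op_def)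
  have bl: "bounded_linear (\<lambda>p :: 'a \<times> 'k. (S (fst p), 0 :: 'k))" for S :: "'a \<Rightarrow>\<^sub>L 'a"
    by (intro bounded_linear_Pair bounded_linear_zero
        bounded_linear_compose[OF blinfun.bounded_linear_right bounded_linear_fst])
  define ext :: "('a \<Rightarrow>\<^sub>L 'a) \<Rightarrow> ('a \<times> 'k) \<Rightarrow>\<^sub>L ('a \<times> 'k)" where
    "ext S = Blinfun (\<lambda>p. (S (fst p), 0))" for S
  have ext: "ext S p = (S (fst p), 0)" for S p by (simp add: ext_def bounded_linear_Blinfun_apply bl)
  have cl: "complex_linear (ext T)"
    by (simp add: complex_linear_def ext scaleC_prod_def complex_linearD[OF cT])
  have "hadjoint (ext T) = ext (hadjoint T)"
    by (rule hadjoint_eqI[OF cl]) (simp add: ext cinner_prod_def cinner_hadjoint cT)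
  then have "normal_op (ext T)"
    by (intro normal_opI cl) (simp add: ext normal_op_apply[OF assms])
  then show ?thesis unfolding normal_extension_in_def using ext by (intro exI[of _ "ext T"]) simp
qed

text \<open>The adjoint of \<open>T\<close> is the compression of the adjoint of its normal extension.\<close>

lemma subnormal_norm_hadjoint_le:
  fixes T :: "'a::chilbert_space \<Rightarrow>\<^sub>L 'a"
  assumes cT: "complex_linear T" and ext: "normal_extension_in TYPE('k::chilbert_space) T"
  shows "norm (hadjoint T x) \<le> norm (T x)"
proof -
  obtain M :: "('a \<times> 'k) \<Rightarrow>\<^sub>L ('a \<times> 'k)" where M: "normal_op M" "\<And>x. M (x, 0) = (T x, 0)"
    using ext unfolding normal_extension_in_def by blast
  have cM: "complex_linear M" using M(1) by (simp add: normal_op_def)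
  have "fst (hadjoint M (x, 0)) = hadjoint T x"
  proof (rule cinner_eqI)
    fix y
    have "cinner y (fst (hadjoint M (x, 0))) = cinner (y, 0 :: 'k) (hadjoint M (x, 0))"
      by (simp add: cinner_prod_def)
    also have "\<dots> = cinner (T y) x" unfolding cinner_hadjoint[OF cM] M(2) by (simp add: cinner_prod_def)
    finally show "cinner y (fst (hadjoint M (x, 0))) = cinner y (hadjoint T x)"
      by (simp add: cinner_hadjoint cT)
  qed
  then have "norm (hadjoint T x) \<le> norm (hadjoint M (x, 0))"
    by (metis norm_fst_le prod.collapse)
  also have "\<dots> = norm (T x)" 
    unfolding norm_hadjoint_normal[OF M(1)] M(2) by (simp add: norm_prod_def)
  finally show ?thesis .
qed

text \<open>A quasinormal operator \<open>T\<close>, one that commutes with \<open>T\<^sup>* T\<close>, satisfies \<open>T T\<^sup>* \<le> T\<^sup>* T\<close>. If the reverse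
  inequality holds too, \<open>T\<close> is normal. The proof works with \<open>Q = T T\<^sup>* - T\<^sup>* T\<close>, for which \<open>Q T = 0\<close> and
  \<open>T\<^sup>* Q = 0\<close>, so that \<open>\<langle>Q y, y\<rangle> = - \<parallel>T y\<parallel>\<^sup>2\<close> for \<open>y\<close> in the range of \<open>Q\<close>.\<close>

lemma quasinormal_cohyponormal_normal:
  fixes T :: "'a::chilbert_space \<Rightarrow>\<^sub>L 'a"
  assumes cT: "complex_linear T"
    and quasi: "\<And>x. T (hadjoint T (T x)) = hadjoint T (T (T x))"
    and co: "\<And>x. norm (T x) \<le> norm (hadjoint T x)"
  shows "normal_op T"
proof (rule normal_opI[OF cT])
  define q where "q x = T (hadjoint T x) - hadjoint T (T x)" for x
  have sym: "cinner (q x) y = cinner x (q y)" for x y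
  proof -
    have "cinner (T (hadjoint T x)) y = cinner x (T (hadjoint T y))"
      by (simp flip: cinner_hadjoint[OF cT] cinner_hadjoint_left[OF cT])
    moreover have "cinner (hadjoint T (T x)) y = cinner x (hadjoint T (T y))"
      by (simp add: cinner_hadjoint[OF cT] cinner_hadjoint_left[OF cT])
    ultimately show ?thesis by (simp add: q_def cinner_diff_left cinner_diff_right)
  qed
  have qT: "q (T x) = 0" for x by (simp add: q_def quasi)
  have Tq: "hadjoint T (q x) = 0" for x
    by (rule cinner_eqI) (simp add: cinner_hadjoint cT flip: sym, simp add: qT)
  have qq: "q (q x) = - hadjoint T (T (q x))" for x
    using Tq[of x] by (simp add: q_def)
  have pos: "0 \<le> Re (cinner (q y) y)" for y
  proof -
    have "Re (cinner (q y) y) = (norm (hadjoint T y))\<^sup>2 - (norm (T y))\<^sup>2"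
    proof -
      have "Re (cinner (T (hadjoint T y)) y) = (norm (hadjoint T y))\<^sup>2"
        by (metis cinner_hadjoint[OF cT] Re_cinner_self)
      moreover have "Re (cinner (hadjoint T (T y)) y) = (norm (T y))\<^sup>2"
        by (simp add: cinner_hadjoint_left[OF cT] Re_cinner_self)
      ultimately show ?thesis by (simp add: q_def cinner_diff_left)
    qed
    then show ?thesis using power_mono[OF co[of y], of 2] by simp
  qed
  have q0: "q x = 0" for x
  proof -
    have "Re (cinner (q (q x)) (q x)) = - (norm (T (q x)))\<^sup>2"
      by (simp add: qq cinner_simps cinner_hadjoint_left cT Re_cinner_self)
    then have "(norm (T (q x)))\<^sup>2 \<le> 0" using pos[of "q x"] by simp
    then have "q (q x) = 0" by (simp add: qq)
    then have "cinner (q x) (q x) = 0" by (metis sym cinner_zero_left)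
    then show ?thesis by (simp add: cinner_self)
  qed
  show "hadjoint T (T x) = T (hadjoint T x)" for x using q0[of x] by (simp add: q_def)
qed

section \<open>Characterisations of hexablock unitaries\<close>

lemma block_op_apply [simp]:
  "block_op A B C D p = (A (fst p) + B (snd p), C (fst p) + D (snd p))"
  by transfer simp

lemma complex_linear_block_op:
  assumes "complex_linear A" "complex_linear B" "complex_linear C" "complex_linear D"
  shows "complex_linear (block_op A B C D)"
  using assms by (simp add: complex_linear_def scaleC_prod_def scaleC_add_right)

lemma hadjoint_block_op:
  assumes "complex_linear A" "complex_linear B" "complex_linear C" "complex_linear D"
  shows "hadjoint (block_op A B C D)
    = block_op (hadjoint A) (hadjoint C) (hadjoint B) (hadjoint D)"
  by (rule hadjoint_eqI[OF complex_linear_block_op[OF assms]])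
    (simp add: cinner_prod_def cinner_simps cinner_hadjoint assms)

lemma commuting_tuple_4:
  "commuting_tuple (vector [A, B, C, D] :: ('a::chilbert_space \<Rightarrow>\<^sub>L 'a) ^ 4) \<longleftrightarrow>
    complex_linear A \<and> complex_linear B \<and> complex_linear C \<and> complex_linear D \<and>
    A o\<^sub>L B = B o\<^sub>L A \<and> A o\<^sub>L C = C o\<^sub>L A \<and> A o\<^sub>L D = D o\<^sub>L A \<and>
    B o\<^sub>L C = C o\<^sub>L B \<and> B o\<^sub>L D = D o\<^sub>L B \<and> C o\<^sub>L D = D o\<^sub>L C"
  unfolding commuting_tuple_def forall_4 vector_4 by metis

lemma commuting_tuple_3:
  "commuting_tuple (vector [A, B, C] :: ('a::chilbert_space \<Rightarrow>\<^sub>L 'a) ^ 3) \<longleftrightarrow>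
    complex_linear A \<and> complex_linear B \<and> complex_linear C \<and>
    A o\<^sub>L B = B o\<^sub>L A \<and> A o\<^sub>L C = C o\<^sub>L A \<and> B o\<^sub>L C = C o\<^sub>L B"
  unfolding commuting_tuple_def forall_3 vector_3 by metis

lemma commuting_tuple_2:
  "commuting_tuple (vector [A, B] :: ('a::chilbert_space \<Rightarrow>\<^sub>L 'a) ^ 2) \<longleftrightarrow>
    complex_linear A \<and> complex_linear B \<and> A o\<^sub>L B = B o\<^sub>L A"
  unfolding commuting_tuple_def forall_2 vector_2 by metis

lemma normal_commute_apply:
  fixes S T :: "'a::chilbert_space \<Rightarrow>\<^sub>L 'a"
  assumes S: "normal_op S" and T: "normal_op T" and ST: "S o\<^sub>L T = T o\<^sub>L S"
  shows "S (T x) = T (S x)" "hadjoint S (T x) = T (hadjoint S x)"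
    "S (hadjoint T x) = hadjoint T (S x)" "hadjoint S (hadjoint T x) = hadjoint T (hadjoint S x)"
proof -
  have c: "complex_linear S" "complex_linear T" using S T by (auto simp: normal_op_def)
  show "S (T x) = T (S x)" by (rule commute_apply[OF ST])
  show "hadjoint S (T x) = T (hadjoint S x)" by (rule commute_apply[OF Fuglede[OF S c(2) ST]])
  show "S (hadjoint T x) = hadjoint T (S x)"
    by (rule commute_apply[OF Fuglede[OF T c(1) ST[symmetric], symmetric]])
  show "hadjoint S (hadjoint T x) = hadjoint T (hadjoint S x)"
    by (rule commute_apply[OF commute_hadjoint[OF c ST]])
qed

definition hexa_relations ::
  "('a::chilbert_space \<Rightarrow>\<^sub>L 'a) \<Rightarrow> ('a \<Rightarrow>\<^sub>L 'a) \<Rightarrow> ('a \<Rightarrow>\<^sub>L 'a) \<Rightarrow> ('a \<Rightarrow>\<^sub>L 'a) \<Rightarrow> bool" where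
  "hexa_relations N0 N1 N2 N3 \<longleftrightarrow>
    normal_op N0 \<and> normal_op N1 \<and> normal_op N2 \<and> normal_op N3 \<and>
    hadjoint N3 o\<^sub>L N3 = id_blinfun \<and> N1 = hadjoint N2 o\<^sub>L N3 \<and>
    (hadjoint N0 o\<^sub>L N0) + (hadjoint N1 o\<^sub>L N1) = id_blinfun"

context
  fixes N0 N1 N2 N3 :: "'h::chilbert_space \<Rightarrow>\<^sub>L 'h"
  assumes comm: "commuting_tuple (vector [N0, N1, N2, N3] :: ('h \<Rightarrow>\<^sub>L 'h) ^ 4)"
begin

lemma hexablock_unitary_iff_relations:
  "domain_unitary hexablock (vector [N0, N1, N2, N3]) \<longleftrightarrow> hexa_relations N0 N1 N2 N3"
  unfolding hexablock_unitary_iff hexa_relations_def forall_4 vector_4 using comm by auto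

lemma tetrablock_unitary_iff_relations:
  "domain_unitary tetrablock (vector [N1, N2, N3]) \<longleftrightarrow>
    normal_op N1 \<and> normal_op N2 \<and> normal_op N3 \<and> hadjoint N3 o\<^sub>L N3 = id_blinfun \<and>
    N1 = hadjoint N2 o\<^sub>L N3 \<and> norm N2 \<le> 1"
  unfolding tetrablock_unitary_iff forall_3 vector_3
  using comm by (auto simp: commuting_tuple_4 commuting_tuple_3)

lemma ball_unitary_iff_relations:
  "domain_unitary unit_ball2 (vector [N0, N1]) \<longleftrightarrow>
    normal_op N0 \<and> normal_op N1 \<and> (hadjoint N0 o\<^sub>L N0) + (hadjoint N1 o\<^sub>L N1) = id_blinfun"
  unfolding ball_unitary_iff forall_2 vector_2
  using comm by (auto simp: commuting_tuple_4 commuting_tuple_2)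

text \<open>The bound on \<open>N2\<close> holds because \<open>N2\<^sup>* = N1 N3\<^sup>*\<close>, where \<open>N3\<close> is unitary and \<open>N1\<close> is a contraction.\<close>

lemma hexa_relations_tetrablock:
  assumes "hexa_relations N0 N1 N2 N3"
  shows "domain_unitary tetrablock (vector [N1, N2, N3])"
proof -
  have n: "normal_op N0" "normal_op N1" "normal_op N2" "normal_op N3"
    and r: "hadjoint N3 o\<^sub>L N3 = id_blinfun" "N1 = hadjoint N2 o\<^sub>L N3"
    "(hadjoint N0 o\<^sub>L N0) + (hadjoint N1 o\<^sub>L N1) = id_blinfun"
    using assms by (auto simp: hexa_relations_def)
  have c: "complex_linear N0" "complex_linear N1" "complex_linear N2" "complex_linear N3"
    using n by (auto simp: normal_op_def)
  have N1: "norm (N1 y) \<le> norm y" for y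
  proof -
    have "hadjoint N0 (N0 y) + hadjoint N1 (N1 y) = y"
      using arg_cong[OF r(3), of "\<lambda>T. T y"] by (simp add: blinfun.add_left)
    then have "cinner (hadjoint N0 (N0 y)) y + cinner (hadjoint N1 (N1 y)) y = cinner y y"
      by (metis cinner_add_left)
    then have "(norm (N0 y))\<^sup>2 + (norm (N1 y))\<^sup>2 = (norm y)\<^sup>2"
      by (simp add: cinner_hadjoint_left c cinner_self flip: of_real_power of_real_add)
    then have "(norm (N1 y))\<^sup>2 \<le> (norm y)\<^sup>2" by (smt (verit) zero_le_power2)
    then show ?thesis by (rule power2_le_imp_le) simp
  qed
  have u: "hadjoint N3 (N3 x) = x" for x using arg_cong[OF r(1), of "\<lambda>T. T x"] by simp
  have iso: "norm (N3 x) = norm x" for x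
  proof -
    have "(norm (N3 x))\<^sup>2 = Re (cinner (hadjoint N3 (N3 x)) x)"
      by (simp add: cinner_hadjoint_left c Re_cinner_self)
    then show ?thesis by (simp add: u Re_cinner_self power2_eq_iff_nonneg)
  qed
  have "norm (N2 x) \<le> 1 * norm x" for x
  proof -
    have "N1 (hadjoint N3 x) = hadjoint N2 x"
      unfolding r(2) using u normal_op_apply[OF n(4)] by simp
    then have "norm (N2 x) = norm (N1 (hadjoint N3 x))" by (simp add: norm_hadjoint_normal n)
    also have "\<dots> \<le> norm (hadjoint N3 x)" by (rule N1)
    finally show ?thesis by (simp add: norm_hadjoint_normal n iso)
  qed
  then have "norm N2 \<le> 1" by (intro norm_blinfun_bound) auto
  then show ?thesis unfolding tetrablock_unitary_iff_relations using n r by blast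
qed

text \<open>By Fuglede's theorem \<open>N0\<close> commutes with \<open>N0\<^sup>* N0 = I - N1\<^sup>* N1\<close>, and subnormality of \<open>N0\<^sup>*\<close> provides the
  reverse estimate.\<close>

lemma hexa_relations_if_cosubnormal:
  assumes ext: "normal_extension_in TYPE('k::chilbert_space) (hadjoint N0)"
    and t: "domain_unitary tetrablock (vector [N1, N2, N3])"
    and r: "hadjoint N0 o\<^sub>L N0 = id_blinfun - (hadjoint N1 o\<^sub>L N1)"
  shows "hexa_relations N0 N1 N2 N3"
proof -
  have c: "complex_linear N0" "complex_linear N1" and N01: "N0 o\<^sub>L N1 = N1 o\<^sub>L N0"
    using comm by (auto simp: commuting_tuple_4)
  have n1: "normal_op N1" using t unfolding tetrablock_unitary_iff_relations by blast
  have r': "hadjoint N0 (N0 x) = x - hadjoint N1 (N1 x)" for x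
    using arg_cong[OF r, of "\<lambda>T. T x"] by (simp add: blinfun.diff_left)
  have co: "N0 (N1 x) = N1 (N0 x)" "N0 (hadjoint N1 x) = hadjoint N1 (N0 x)" for x
    using commute_apply[OF N01] commute_apply[OF Fuglede[OF n1 c(1) N01[symmetric]]] by auto
  have "normal_op N0"
  proof (rule quasinormal_cohyponormal_normal[OF c(1)])
    show "N0 (hadjoint N0 (N0 x)) = hadjoint N0 (N0 (N0 x))" for x
      unfolding r' by (simp add: blinfun.diff_right co)
    show "norm (N0 x) \<le> norm (hadjoint N0 x)" for x
      using subnormal_norm_hadjoint_le[OF complex_linear_hadjoint[OF c(1)] ext] c(1) by simp
  qed
  moreover have "(hadjoint N0 o\<^sub>L N0) + (hadjoint N1 o\<^sub>L N1) = id_blinfun" by (simp add: r)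
  ultimately show ?thesis
    using t unfolding hexa_relations_def tetrablock_unitary_iff_relations by blast
qed

text \<open>The entry \<open>B\<close> is dictated by Cramer's rule \<open>A\<^sup>* det A = adj A\<close> for a unitary matrix \<open>A\<close> with determinant
  \<open>N3\<close>.\<close>

lemma hexa_relations_block:
  assumes H: "hexa_relations N0 N1 N2 N3"
  defines "B \<equiv> - (hadjoint N0 o\<^sub>L N3)"
  shows "normal_op B" "unitary_op (block_op N1 B N0 N2)" "N3 = (N1 o\<^sub>L N2) - (B o\<^sub>L N0)"
    "\<And>S. S \<in> {N0, N1, N2} \<Longrightarrow> B o\<^sub>L S = S o\<^sub>L B"
proof -
  have n: "normal_op N0" "normal_op N1" "normal_op N2" "normal_op N3"
    and r: "hadjoint N3 o\<^sub>L N3 = id_blinfun" "N1 = hadjoint N2 o\<^sub>L N3"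
    "(hadjoint N0 o\<^sub>L N0) + (hadjoint N1 o\<^sub>L N1) = id_blinfun"
    using H by (auto simp: hexa_relations_def)
  have c: "complex_linear N0" "complex_linear N1" "complex_linear N2" "complex_linear N3"
    using n by (auto simp: normal_op_def)
  have cm: "N0 o\<^sub>L N2 = N2 o\<^sub>L N0" "N0 o\<^sub>L N3 = N3 o\<^sub>L N0" "N2 o\<^sub>L N3 = N3 o\<^sub>L N2"
    "N0 o\<^sub>L N1 = N1 o\<^sub>L N0"
    using comm by (auto simp: commuting_tuple_4)
  \<comment> \<open>Rewriting to the normal form \<open>N2, N2\<^sup>*, N0, N0\<^sup>*, N3, N3\<^sup>*\<close> from the outside in.\<close>
  note order = normal_commute_apply[OF n(1) n(3) cm(1)]
    normal_commute_apply[OF n(4) n(1) cm(2)[symmetric]] normal_commute_apply[OF n(4) n(3) cm(3)[symmetric]]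
    normal_op_apply[OF n(1)] normal_op_apply[OF n(3)] normal_op_apply[OF n(4)]
  have u: "N3 (hadjoint N3 x) = x" for x
    using arg_cong[OF r(1), of "\<lambda>T. T x"] by (simp add: order)
  have s: "N0 (hadjoint N0 x) = x - N2 (hadjoint N2 x)" for x
  proof -
    have "hadjoint N1 = hadjoint N3 o\<^sub>L N2" unfolding r(2) by (simp add: hadjoint_compose complex_linear_hadjoint c)
    then show ?thesis
      using arg_cong[OF r(3), of "\<lambda>T. T x"]
      by (simp add: r(2) blinfun.add_left order u algebra_simps)
  qed
  have h1: "hadjoint N1 = hadjoint N3 o\<^sub>L N2"
    unfolding r(2) by (simp add: hadjoint_compose complex_linear_hadjoint c)
  have cB: "complex_linear B" unfolding B_def by (intro complex_linear_intros c)
  have hB: "hadjoint B = - (hadjoint N3 o\<^sub>L N0)"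
    unfolding B_def by (simp add: hadjoint_minus hadjoint_compose complex_linear_compose complex_linear_hadjoint c)
  show nB: "normal_op B"
    by (rule normal_opI[OF cB], unfold hB)
      (simp add: B_def blinfun.minus_left blinfun.minus_right order u)
  show "N3 = (N1 o\<^sub>L N2) - (B o\<^sub>L N0)"
    by (rule blinfun_eqI)
      (simp add: r(2) B_def blinfun.diff_left blinfun.minus_left blinfun.diff_right order s)
  show "B o\<^sub>L S = S o\<^sub>L B" if "S \<in> {N0, N1, N2}" for S
    using that by (intro blinfun_eqI)
      (auto simp: r(2) B_def blinfun.minus_left blinfun.minus_right order)
  show "unitary_op (block_op N1 B N0 N2)"
    unfolding unitary_op_def hadjoint_block_op[OF c(2) cB c(1) c(3)]
  proof (intro conjI blinfun_eqI)
    show "complex_linear (block_op N1 B N0 N2)" by (rule complex_linear_block_op[OF c(2) cB c(1) c(3)])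
  qed (simp_all add: prod_eq_iff h1 hB, simp_all add: r(2) B_def blinfun.add_right blinfun.minus_left
      blinfun.minus_right blinfun.diff_right order u s)
qed

text \<open>The relation \<open>N2\<^sup>* N3 = N1\<close> and its companion \<open>N0\<^sup>* N3 = - B\<close> are entries of \<open>A\<^sup>* det A = adj A\<close>.
  Together they give \<open>N3\<^sup>* N3 = N1\<^sup>* N1 + B\<^sup>* B = I\<close>.\<close>

lemma hexa_relations_if_block:
  assumes n: "\<And>S. S \<in> {N1, B, N0, N2} \<Longrightarrow> normal_op S"
    and cm: "\<And>S T. S \<in> {N1, B, N0, N2} \<Longrightarrow> T \<in> {N1, B, N0, N2} \<Longrightarrow> S o\<^sub>L T = T o\<^sub>L S"
    and U: "unitary_op (block_op N1 B N0 N2)" and N3: "N3 = (N1 o\<^sub>L N2) - (B o\<^sub>L N0)"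
  shows "hexa_relations N0 N1 N2 N3"
proof -
  have nn: "normal_op N1" "normal_op B" "normal_op N0" "normal_op N2" using n by auto
  have c: "complex_linear N1" "complex_linear B" "complex_linear N0" "complex_linear N2"
    using nn by (auto simp: normal_op_def)
  have cc: "B o\<^sub>L N1 = N1 o\<^sub>L B" "N0 o\<^sub>L N1 = N1 o\<^sub>L N0" "N2 o\<^sub>L N1 = N1 o\<^sub>L N2"
    "N0 o\<^sub>L B = B o\<^sub>L N0" "N2 o\<^sub>L B = B o\<^sub>L N2" "N2 o\<^sub>L N0 = N0 o\<^sub>L N2"
    using cm by auto
  \<comment> \<open>Rewriting to the normal form \<open>N1, N1\<^sup>*, B, B\<^sup>*, N0, N0\<^sup>*, N2, N2\<^sup>*\<close> from the outside in.\<close>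
  note order = normal_commute_apply[OF nn(2,1) cc(1)] normal_commute_apply[OF nn(3,1) cc(2)]
    normal_commute_apply[OF nn(4,1) cc(3)] normal_commute_apply[OF nn(3,2) cc(4)]
    normal_commute_apply[OF nn(4,2) cc(5)] normal_commute_apply[OF nn(4,3) cc(6)]
    normal_op_apply[OF nn(1)] normal_op_apply[OF nn(2)] normal_op_apply[OF nn(3)] normal_op_apply[OF nn(4)]
  note hb = hadjoint_block_op[OF c]
  have U1: "block_op (hadjoint N1) (hadjoint N0) (hadjoint B) (hadjoint N2) (block_op N1 B N0 N2 p) = p"
    and U2: "block_op N1 B N0 N2 (block_op (hadjoint N1) (hadjoint N0) (hadjoint B) (hadjoint N2) p) = p" for p
    using U unfolding unitary_op_def hb
    by (metis blinfun_apply_blinfun_compose id_blinfun.rep_eq id_apply)+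
  have a: "N0 (hadjoint N0 x) = x - N1 (hadjoint N1 x)" "hadjoint B (N1 x) + hadjoint N2 (N0 x) = 0" for x
    using U1[of "(x, 0)"] by (simp_all add: order eq_diff_eq add.commute)
  have b: "B (hadjoint B x) = x - N1 (hadjoint N1 x)" "N0 (hadjoint N1 x) + N2 (hadjoint B x) = 0" for x
    using U2[of "(x, 0)"] by (simp_all add: order eq_diff_eq add.commute)
  have d: "hadjoint N1 (B x) + hadjoint N0 (N2 x) = 0" "B (hadjoint B x) + N2 (hadjoint N2 x) = x" for x
    using U1[of "(0, x)"] by (simp_all add: order)
  have e: "N2 (hadjoint N2 x) = N1 (hadjoint N1 x)" for x using b(1)[of x] d(2)[of x]
    by (metis add_diff_cancel_left' diff_diff_eq2 add.commute)
  have f: "N0 (hadjoint N2 x) = - N1 (hadjoint B x)" for x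
    using a(2)[of x] by (simp add: order eq_neg_iff_add_eq_0 add.commute)
  have g: "hadjoint N0 (N2 x) = - hadjoint N1 (B x)" for x
    using d(1)[of x] by (simp add: eq_neg_iff_add_eq_0 add.commute)
  have c3: "complex_linear N3" unfolding N3 by (intro complex_linear_intros c)
  have h3: "hadjoint N3 x = hadjoint N1 (hadjoint N2 x) - hadjoint B (hadjoint N0 x)" for x
    unfolding N3 by (simp add: hadjoint_diff hadjoint_compose complex_linear_compose c blinfun.diff_left order)
  have N3x: "N3 x = N1 (N2 x) - B (N0 x)" for x by (simp add: N3 blinfun.diff_left)
  have s: "hadjoint N2 (N3 x) = N1 x" for x
    by (simp add: N3x blinfun.diff_right order e f a b blinfun.minus_right)
  have t: "hadjoint N0 (N3 x) = - B x" for x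
    by (simp add: N3x blinfun.diff_right order a g blinfun.minus_right)
  have one: "hadjoint N3 (N3 x) = x" for x
    unfolding h3 s t by (simp add: order b blinfun.minus_right)
  have n3: "normal_op N3"
    by (rule normal_opI[OF c3]) (simp add: N3x h3 blinfun.diff_right order)
  have "hadjoint N3 o\<^sub>L N3 = id_blinfun" by (rule blinfun_eqI) (simp add: one)
  moreover have "N1 = hadjoint N2 o\<^sub>L N3" by (rule blinfun_eqI) (simp add: s)
  moreover have "(hadjoint N0 o\<^sub>L N0) + (hadjoint N1 o\<^sub>L N1) = id_blinfun"
    by (rule blinfun_eqI) (simp add: blinfun.add_left order a)
  ultimately show ?thesis using nn n3 by (simp add: hexa_relations_def)
qed

end

theorem theorem3p5:
  fixes N0 N1 N2 N3 :: "'h::chilbert_space \<Rightarrow>\<^sub>L 'h"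
  assumes "commuting_tuple (vector [N0, N1, N2, N3] :: ('h \<Rightarrow>\<^sub>L 'h)^4)"
  shows
    "(domain_unitary hexablock (vector [N0, N1, N2, N3]) \<longleftrightarrow>
        subnormal (hadjoint N0) \<and> domain_unitary tetrablock (vector [N1, N2, N3]) \<and>
        hadjoint N0 o\<^sub>L N0 = id_blinfun - (hadjoint N1 o\<^sub>L N1)) \<and>
     (domain_unitary hexablock (vector [N0, N1, N2, N3]) \<longleftrightarrow>
        domain_unitary tetrablock (vector [N1, N2, N3]) \<and>
        hadjoint N0 o\<^sub>L N0 = id_blinfun - (hadjoint N1 o\<^sub>L N1) \<and>
        N0 o\<^sub>L hadjoint N0 = id_blinfun - (N1 o\<^sub>L hadjoint N1)) \<and>
     (domain_unitary hexablock (vector [N0, N1, N2, N3]) \<longleftrightarrow>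
        domain_unitary unit_ball2 (vector [N0, N1]) \<and>
        domain_unitary tetrablock (vector [N1, N2, N3])) \<and>
     (domain_unitary hexablock (vector [N0, N1, N2, N3]) \<longleftrightarrow>
        (\<exists>A11 A12 A21 A22 :: 'h \<Rightarrow>\<^sub>L 'h.
           (\<forall>S\<in>{A11, A12, A21, A22}. normal_op S) \<and>
           (\<forall>S\<in>{A11, A12, A21, A22}. \<forall>T\<in>{A11, A12, A21, A22}. S o\<^sub>L T = T o\<^sub>L S) \<and>
           unitary_op (block_op A11 A12 A21 A22) \<and>
           N0 = A21 \<and> N1 = A11 \<and> N2 = A22 \<and> N3 = (A11 o\<^sub>L A22) - (A12 o\<^sub>L A21))) \<and>
     (normal_extension_in TYPE('k::chilbert_space) (hadjoint N0) \<and>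
        domain_unitary tetrablock (vector [N1, N2, N3]) \<and>
        hadjoint N0 o\<^sub>L N0 = id_blinfun - (hadjoint N1 o\<^sub>L N1) \<longrightarrow>
        domain_unitary hexablock (vector [N0, N1, N2, N3]))"
proof -
  let ?H = "hexa_relations N0 N1 N2 N3"
  note H = hexablock_unitary_iff_relations[OF assms]
  have fwd: "domain_unitary tetrablock (vector [N1, N2, N3])" "normal_op N0" "normal_op N1"
    "hadjoint N0 o\<^sub>L N0 = id_blinfun - (hadjoint N1 o\<^sub>L N1)" if ?H
    using hexa_relations_tetrablock[OF assms that] that
    by (auto simp: hexa_relations_def eq_diff_eq)
  have sub: "subnormal (hadjoint N0)" if ?H
    unfolding subnormal_def by (rule normal_op_normal_extension[OF normal_op_hadjoint[OF fwd(2)[OF that]]])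
  have two: "?H" if "subnormal (hadjoint N0)" "domain_unitary tetrablock (vector [N1, N2, N3])"
    "hadjoint N0 o\<^sub>L N0 = id_blinfun - (hadjoint N1 o\<^sub>L N1)"
    by (rule hexa_relations_if_cosubnormal[OF assms that(1)[unfolded subnormal_def] that(2,3)])
  have three: "?H \<longleftrightarrow> domain_unitary tetrablock (vector [N1, N2, N3]) \<and>
      hadjoint N0 o\<^sub>L N0 = id_blinfun - (hadjoint N1 o\<^sub>L N1) \<and>
      N0 o\<^sub>L hadjoint N0 = id_blinfun - (N1 o\<^sub>L hadjoint N1)" (is "_ \<longleftrightarrow> ?R")
  proof
    assume ?H
    then show ?R using fwd by (simp add: normal_op_def)
  next
    assume R: ?R
    then have "hadjoint N1 o\<^sub>L N1 = N1 o\<^sub>L hadjoint N1"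
      unfolding tetrablock_unitary_iff_relations[OF assms] normal_op_def by blast
    then have "normal_op N0" using R assms by (simp add: normal_op_def commuting_tuple_4)
    moreover have "(hadjoint N0 o\<^sub>L N0) + (hadjoint N1 o\<^sub>L N1) = id_blinfun" using R by simp
    ultimately show ?H
      using R unfolding hexa_relations_def tetrablock_unitary_iff_relations[OF assms] by blast
  qed
  have four: "?H \<longleftrightarrow> domain_unitary unit_ball2 (vector [N0, N1]) \<and>
      domain_unitary tetrablock (vector [N1, N2, N3])"
    using fwd(1) unfolding hexa_relations_def ball_unitary_iff_relations[OF assms]
      tetrablock_unitary_iff_relations[OF assms] by blast
  have five: "?H \<longleftrightarrow> (\<exists>A11 A12 A21 A22 :: 'h \<Rightarrow>\<^sub>L 'h.
      (\<forall>S\<in>{A11, A12, A21, A22}. normal_op S) \<and>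
      (\<forall>S\<in>{A11, A12, A21, A22}. \<forall>T\<in>{A11, A12, A21, A22}. S o\<^sub>L T = T o\<^sub>L S) \<and>
      unitary_op (block_op A11 A12 A21 A22) \<and>
      N0 = A21 \<and> N1 = A11 \<and> N2 = A22 \<and> N3 = (A11 o\<^sub>L A22) - (A12 o\<^sub>L A21))" (is "_ \<longleftrightarrow> ?R")
  proof
    assume h: ?H
    define B where "B = - (hadjoint N0 o\<^sub>L N3)"
    note b = hexa_relations_block[OF assms h, folded B_def]
    show ?R
    proof (intro exI conjI)
      show "\<forall>S\<in>{N1, B, N0, N2}. normal_op S" using h b(1) by (auto simp: hexa_relations_def)
      show "\<forall>S\<in>{N1, B, N0, N2}. \<forall>T\<in>{N1, B, N0, N2}. S o\<^sub>L T = T o\<^sub>L S"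
        using b(4)[of N0] b(4)[of N1] b(4)[of N2] assms by (auto simp: commuting_tuple_4)
    qed (use b in auto)
  next
    assume ?R
    then obtain B where "\<forall>S\<in>{N1, B, N0, N2}. normal_op S"
      "\<forall>S\<in>{N1, B, N0, N2}. \<forall>T\<in>{N1, B, N0, N2}. S o\<^sub>L T = T o\<^sub>L S"
      "unitary_op (block_op N1 B N0 N2)" "N3 = (N1 o\<^sub>L N2) - (B o\<^sub>L N0)" by metis
    then show ?H by (intro hexa_relations_if_block[OF assms, of B]) blast+
  qed
  show ?thesis
    unfolding H
    using fwd sub two three four five hexa_relations_if_cosubnormal[OF assms, where 'k = 'k]
    by (intro conjI) blast+
qed

end
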